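(* Let $T$ be a complete $\omega$-categorical theory in a countable language, with $\kappa$-saturated model $\mathcal{M}$ as in the context. If the exchange property with respect to $n$ holds for every $n<\omega$, then $T$ is rosy.
   Context: Standing setting: $\mathcal{M}\models T$ is $\kappa$-saturated for some large infinite cardinal $\kappa$, with universe $M$; $\mathcal{M}^{\mathrm{eq}}$ is the expansion by imaginaries with universe $M^{\mathrm{eq}}$; $\mathrm{acl}^{\mathrm{eq}}$ is algebraic closure in $\mathcal{M}^{\mathrm{eq}}$; all subsets of $M^{\mathrm{eq}}$ considered have cardinality $<\kappa$. Levels: $M_0=M$ and $M_{k+1}=M_k\cup X_{k+1}$, where $X_{k+1}$ is the set of imaginary elements that are equivalence classes of $\emptyset$-definable equivalence relations on $M^{k+1}$. For $A\subseteq M^{\mathrm{eq}}$, $\mathrm{acl}^n(A)=\mathrm{acl}^{\mathrm{eq}}(A)\cap M_n$. $n$-rank: $\mathrm{rk}^n(A/B)\ge 0$ always; $\mathrm{rk}^n(A/B)\ge\alpha+1$ iff there is $a\in\mathrm{acl}^n(A)\setminus\mathrm{acl}^n(B)$ with $\mathrm{rk}^n(A/\{a\}\cup B)\ge\alpha$; limit stages by intersection; $\mathrm{rk}^n(A/B)=\alpha$ iff $\ge\alpha$ and not $\ge\alpha+1$. For an element $a$, $\mathrm{rk}^n(a/C)=\mathrm{rk}^n(\{a\}/C)$. Exchange property with respect to $n$: whenever $C\subseteq M^{\mathrm{eq}}$, $2\le k<\omega$, $a_1,\dots,a_k\in M_n$, $\mathrm{rk}^n(a_i/C)=1$ for all $i$,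 and $a_k\in\mathrm{acl}^{\mathrm{eq}}(\{a_1,\dots,a_{k-1}\}\cup C)\setminus\mathrm{acl}^{\mathrm{eq}}(\{a_2,\dots,a_{k-1}\}\cup C)$, then $a_1\in\mathrm{acl}^{\mathrm{eq}}(\{a_2,\dots,a_k\}\cup C)$. Rosy is in the sense of Onshuus (equivalently, by Ealy–Onshuus, thorn-independence has local character). *)

theory Defs
  imports Main "HOL-Library.Countable_Set"
begin

unbundle cardinal_syntax

section \<open>Many-sorted first-order logic\<close>

text \<open>
  The logic is many-sorted because the expansion by imaginaries is a many-sorted structure;
  ordinary one-sorted languages are those with \<open>'s = unit\<close> and \<open>sorts L = {()}\<close>.
  The symbols are sets (rather than whole types), so that a language may have no function or no
  relation symbols; constants are function symbols with empty \<open>fdom\<close>.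
\<close>

record ('f, 'r, 's) lang =
  sorts :: "'s set"
  fsyms :: "'f set"
  rsyms :: "'r set"
  fdom :: "'f \<Rightarrow> 's list"
  fcod :: "'f \<Rightarrow> 's"
  rdom :: "'r \<Rightarrow> 's list"

record ('f, 'r, 's, 'a) struct =
  univ :: "'s \<Rightarrow> 'a set"
  fint :: "'f \<Rightarrow> 'a list \<Rightarrow> 'a"
  rint :: "'r \<Rightarrow> 'a list \<Rightarrow> bool"

text \<open>A variable is its sort together with an index.\<close>

type_synonym 's var = "'s \<times> nat"

datatype ('f, 's) tm = Var "'s var" | App 'f "('f, 's) tm list"

datatype ('f, 'r, 's) fm =
    FEq "('f, 's) tm" "('f, 's) tm"
  | FRel 'r "('f, 's) tm list"
  | FNeg "('f, 'r, 's) fm"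
  | FConj "('f, 'r, 's) fm" "('f, 'r, 's) fm"
  | FEx "'s var" "('f, 'r, 's) fm"

fun sort_of :: "('f, 'r, 's) lang \<Rightarrow> ('f, 's) tm \<Rightarrow> 's" where
  "sort_of L (Var v) = fst v"
| "sort_of L (App f ts) = fcod L f"

fun wf_tm :: "('f, 'r, 's) lang \<Rightarrow> ('f, 's) tm \<Rightarrow> bool" where
  "wf_tm L (Var v) \<longleftrightarrow> fst v \<in> sorts L"
| "wf_tm L (App f ts) \<longleftrightarrow>
     f \<in> fsyms L \<and> map (sort_of L) ts = fdom L f \<and> (\<forall>t\<in>set ts. wf_tm L t)"

fun wf_fm :: "('f, 'r, 's) lang \<Rightarrow> ('f, 'r, 's) fm \<Rightarrow> bool" where
  "wf_fm L (FEq t u) \<longleftrightarrow> wf_tm L t \<and> wf_tm L u \<and> sort_of L t = sort_of L u"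
| "wf_fm L (FRel r ts) \<longleftrightarrow>
     r \<in> rsyms L \<and> map (sort_of L) ts = rdom L r \<and> (\<forall>t\<in>set ts. wf_tm L t)"
| "wf_fm L (FNeg \<phi>) \<longleftrightarrow> wf_fm L \<phi>"
| "wf_fm L (FConj \<phi> \<psi>) \<longleftrightarrow> wf_fm L \<phi> \<and> wf_fm L \<psi>"
| "wf_fm L (FEx v \<phi>) \<longleftrightarrow> fst v \<in> sorts L \<and> wf_fm L \<phi>"

fun fv_tm :: "('f, 's) tm \<Rightarrow> 's var set" where
  "fv_tm (Var v) = {v}"
| "fv_tm (App f ts) = (\<Union>t\<in>set ts. fv_tm t)"

fun fv :: "('f, 'r, 's) fm \<Rightarrow> 's var set" where
  "fv (FEq t u) = fv_tm t \<union> fv_tm u"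
| "fv (FRel r ts) = (\<Union>t\<in>set ts. fv_tm t)"
| "fv (FNeg \<phi>) = fv \<phi>"
| "fv (FConj \<phi> \<psi>) = fv \<phi> \<union> fv \<psi>"
| "fv (FEx v \<phi>) = fv \<phi> - {v}"

fun val :: "('f, 'r, 's, 'a) struct \<Rightarrow> ('s var \<Rightarrow> 'a) \<Rightarrow> ('f, 's) tm \<Rightarrow> 'a" where
  "val M e (Var v) = e v"
| "val M e (App f ts) = fint M f (map (val M e) ts)"

fun sat :: "('f, 'r, 's, 'a) struct \<Rightarrow> ('s var \<Rightarrow> 'a) \<Rightarrow> ('f, 'r, 's) fm \<Rightarrow> bool" where
  "sat M e (FEq t u) \<longleftrightarrow> val M e t = val M e u"
| "sat M e (FRel r ts) \<longleftrightarrow> rint M r (map (val M e) ts)"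
| "sat M e (FNeg \<phi>) \<longleftrightarrow> \<not> sat M e \<phi>"
| "sat M e (FConj \<phi> \<psi>) \<longleftrightarrow> sat M e \<phi> \<and> sat M e \<psi>"
| "sat M e (FEx v \<phi>) \<longleftrightarrow> (\<exists>a\<in>univ M (fst v). sat M (e(v := a)) \<phi>)"

definition is_struct :: "('f, 'r, 's) lang \<Rightarrow> ('f, 'r, 's, 'a) struct \<Rightarrow> bool" where
  "is_struct L M \<longleftrightarrow>
     (\<forall>s\<in>sorts L. univ M s \<noteq> {}) \<and>
     (\<forall>f\<in>fsyms L. \<forall>as. list_all2 (\<lambda>a s. a \<in> univ M s) as (fdom L f)
        \<longrightarrow> fint M f as \<in> univ M (fcod L f))"

definition is_sentence :: "('f, 'r, 's) lang \<Rightarrow> ('f, 'r, 's) fm \<Rightarrow> bool" where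
  "is_sentence L \<phi> \<longleftrightarrow> wf_fm L \<phi> \<and> fv \<phi> = {}"

definition is_model ::
  "('f, 'r, 's) lang \<Rightarrow> ('f, 'r, 's, 'a) struct \<Rightarrow> ('f, 'r, 's) fm set \<Rightarrow> bool" where
  "is_model L M T \<longleftrightarrow> is_struct L M \<and> (\<forall>\<phi>\<in>T. \<forall>e. sat M e \<phi>)"

text \<open>
  Theories are deductively closed sets of sentences, so a consistent theory is complete iff it
  decides every sentence by membership.  Consistency is not part of this definition; it
  follows whenever a model is given.
\<close>

definition complete_theory :: "('f, 'r, 's) lang \<Rightarrow> ('f, 'r, 's) fm set \<Rightarrow> bool" where
  "complete_theory L T \<longleftrightarrow>
     (\<forall>\<phi>\<in>T. is_sentence L \<phi>) \<and> (\<forall>\<phi>. is_sentence L \<phi> \<longrightarrow> \<phi> \<in> T \<or> FNeg \<phi> \<in> T)"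

text \<open>
  Algebraic closure: \<open>b\<close> is algebraic over \<open>A\<close> if it lies in a finite set defined by a formula
  in one variable \<open>x\<close> with parameters in \<open>A\<close>.  A formula with parameters is a formula together
  with an assignment of its remaining free variables.
\<close>

definition acl :: "('f, 'r, 's) lang \<Rightarrow> ('f, 'r, 's, 'a) struct \<Rightarrow> 'a set \<Rightarrow> 'a set" where
  "acl L M A = {b. \<exists>x \<phi> e. fst x \<in> sorts L \<and> b \<in> univ M (fst x) \<and> wf_fm L \<phi> \<and>
     (\<forall>v\<in>fv \<phi> - {x}. e v \<in> A \<inter> univ M (fst v)) \<and>
     sat M (e(x := b)) \<phi> \<and> finite {b' \<in> univ M (fst x). sat M (e(x := b')) \<phi>}}"

section \<open>One-sorted languages\<close>

definition one_sorted :: "('f, 'r, unit) lang \<Rightarrow> bool" where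
  "one_sorted L \<longleftrightarrow> sorts L = {()}"

definition countable_lang :: "('f, 'r, 's) lang \<Rightarrow> bool" where
  "countable_lang L \<longleftrightarrow> countable (fsyms L) \<and> countable (rsyms L)"

definition isomorphic ::
  "('f, 'r, unit) lang \<Rightarrow> ('f, 'r, unit, 'a) struct \<Rightarrow> ('f, 'r, unit, 'b) struct \<Rightarrow> bool" where
  "isomorphic L M N \<longleftrightarrow> (\<exists>h. bij_betw h (univ M ()) (univ N ()) \<and>
     (\<forall>f\<in>fsyms L. \<forall>as. set as \<subseteq> univ M () \<and> length as = length (fdom L f)
        \<longrightarrow> h (fint M f as) = fint N f (map h as)) \<and>
     (\<forall>r\<in>rsyms L. \<forall>as. set as \<subseteq> univ M () \<and> length as = length (rdom L r)
        \<longrightarrow> (rint M r as \<longleftrightarrow> rint N r (map h as))))"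

text \<open>
  Up to isomorphism, \<open>T\<close> has exactly one countably infinite model.  Every such model is
  isomorphic to one whose elements are natural numbers.
\<close>

definition omega_categorical :: "('f, 'r, unit) lang \<Rightarrow> ('f, 'r, unit) fm set \<Rightarrow> bool" where
  "omega_categorical L T \<longleftrightarrow>
     (\<exists>N :: ('f, 'r, unit, nat) struct. is_model L N T \<and> infinite (univ N ())) \<and>
     (\<forall>(N1 :: ('f, 'r, unit, nat) struct) (N2 :: ('f, 'r, unit, nat) struct).
        is_model L N1 T \<and> infinite (univ N1 ()) \<and> is_model L N2 T \<and> infinite (univ N2 ())
        \<longrightarrow> isomorphic L N1 N2)"

text \<open>
  A (partial) type \<open>p\<close> over \<open>A\<close> in the variable \<open>x\<close> is a set of formulas with parameters in \<open>A\<close>,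
  each of them given together with an assignment of its parameters.
\<close>

definition saturated ::
  "'k rel \<Rightarrow> ('f, 'r, unit) lang \<Rightarrow> ('f, 'r, unit, 'a) struct \<Rightarrow> bool" where
  "saturated \<kappa> L M \<longleftrightarrow> (\<forall>A x p. A \<subseteq> univ M () \<and> |A| <o \<kappa> \<and>
     (\<forall>(\<phi>, e)\<in>p. wf_fm L \<phi> \<and> e ` (fv \<phi> - {x}) \<subseteq> A) \<and>
     (\<forall>q\<subseteq>p. finite q \<longrightarrow> (\<exists>a\<in>univ M (). \<forall>(\<phi>, e)\<in>q. sat M (e(x := a)) \<phi>))
     \<longrightarrow> (\<exists>a\<in>univ M (). \<forall>(\<phi>, e)\<in>p. sat M (e(x := a)) \<phi>))"

section \<open>The expansion by imaginaries\<close>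

definition tuples :: "('f, 'r, unit, 'a) struct \<Rightarrow> nat \<Rightarrow> 'a list set" where
  "tuples M k = {as. length as = k \<and> set as \<subseteq> univ M ()}"

definition definable ::
  "('f, 'r, unit) lang \<Rightarrow> ('f, 'r, unit, 'a) struct \<Rightarrow> nat \<Rightarrow> 'a list set \<Rightarrow> bool" where
  "definable L M k D \<longleftrightarrow> (\<exists>\<phi>. wf_fm L \<phi> \<and> fv \<phi> \<subseteq> {((), i) | i. i < k} \<and>
     D = {as \<in> tuples M k. sat M (\<lambda>(_, i). as ! i) \<phi>})"

definition definable_equiv ::
  "('f, 'r, unit) lang \<Rightarrow> ('f, 'r, unit, 'a) struct \<Rightarrow> nat \<Rightarrow> 'a list rel \<Rightarrow> bool" where
  "definable_equiv L M k E \<longleftrightarrow>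
     equiv (tuples M k) E \<and> definable L M (2 * k) {as @ bs | as bs. (as, bs) \<in> E}"

text \<open>
  An imaginary is an equivalence class tagged with its equivalence relation, so
  that different sorts are disjoint.
\<close>

datatype 'a eq_elem = Home (home_val: 'a) | Imag "'a list rel" "'a list set"

datatype 'a eq_sort = Home_sort | Quot nat "'a list rel"

text \<open>
  Besides the symbols of \<open>L\<close>, which live on the home sort, there is for each definable
  equivalence relation \<open>E\<close> on \<open>k\<close>-tuples a function symbol \<open>Inr (k, E)\<close> for the projection
  onto the sort \<open>Quot k E\<close> of \<open>E\<close>-classes.
\<close>

definition eq_lang :: "('f, 'r, unit) lang \<Rightarrow> ('f, 'r, unit, 'a) struct \<Rightarrow>
    ('f + nat \<times> 'a list rel, 'r, 'a eq_sort) lang" where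
  "eq_lang L M =
    \<lparr> sorts = {Home_sort} \<union> {Quot k E | k E. 1 \<le> k \<and> definable_equiv L M k E},
      fsyms = Inl ` fsyms L \<union> {Inr (k, E) | k E. 1 \<le> k \<and> definable_equiv L M k E},
      rsyms = rsyms L,
      fdom = (\<lambda>g. case g of Inl f \<Rightarrow> map (\<lambda>_. Home_sort) (fdom L f)
                          | Inr (k, E) \<Rightarrow> replicate k Home_sort),
      fcod = (\<lambda>g. case g of Inl f \<Rightarrow> Home_sort | Inr (k, E) \<Rightarrow> Quot k E),
      rdom = (\<lambda>r. map (\<lambda>_. Home_sort) (rdom L r)) \<rparr>"

definition eq_struct :: "('f, 'r, unit, 'a) struct \<Rightarrow>
    ('f + nat \<times> 'a list rel, 'r, 'a eq_sort, 'a eq_elem) struct" where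
  "eq_struct M =
    \<lparr> univ = (\<lambda>s. case s of Home_sort \<Rightarrow> Home ` univ M ()
                          | Quot k E \<Rightarrow> Imag E ` (tuples M k // E)),
      fint = (\<lambda>g as. case g of Inl f \<Rightarrow> Home (fint M f (map home_val as))
                             | Inr (k, E) \<Rightarrow> Imag E (E `` {map home_val as})),
      rint = (\<lambda>r as. rint M r (map home_val as)) \<rparr>"

definition eq_univ ::
  "('f, 'r, unit) lang \<Rightarrow> ('f, 'r, unit, 'a) struct \<Rightarrow> 'a eq_elem set" where
  "eq_univ L M = (\<Union>s\<in>sorts (eq_lang L M). univ (eq_struct M) s)"

definition acl_eq :: "('f, 'r, unit) lang \<Rightarrow> ('f, 'r, unit, 'a) struct \<Rightarrow>
    'a eq_elem set \<Rightarrow> 'a eq_elem set" where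
  "acl_eq L M A = acl (eq_lang L M) (eq_struct M) A"

fun level :: "('f, 'r, unit) lang \<Rightarrow> ('f, 'r, unit, 'a) struct \<Rightarrow> nat \<Rightarrow> 'a eq_elem set" where
  "level L M 0 = Home ` univ M ()"
| "level L M (Suc k) = level L M k \<union>
     {Imag E c | E c. definable_equiv L M (Suc k) E \<and> c \<in> tuples M (Suc k) // E}"

definition acl_level :: "('f, 'r, unit) lang \<Rightarrow> ('f, 'r, unit, 'a) struct \<Rightarrow> nat \<Rightarrow>
    'a eq_elem set \<Rightarrow> 'a eq_elem set" where
  "acl_level L M n A = acl_eq L M A \<inter> level L M n"

section \<open>The n-rank and the exchange property\<close>

text \<open>
  \<open>rk_ge L M n A B m\<close> says that the n-rank of \<open>A\<close> over \<open>B\<close> is at least \<open>m\<close>.  Only the finite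
  stages of the ordinal-valued rank are defined: they decide whether the rank equals a given
  natural number, and the exchange property only refers to rank 1.
\<close>

fun rk_ge :: "('f, 'r, unit) lang \<Rightarrow> ('f, 'r, unit, 'a) struct \<Rightarrow> nat \<Rightarrow>
    'a eq_elem set \<Rightarrow> 'a eq_elem set \<Rightarrow> nat \<Rightarrow> bool" where
  "rk_ge L M n A B 0 \<longleftrightarrow> True"
| "rk_ge L M n A B (Suc m) \<longleftrightarrow>
     (\<exists>a \<in> acl_level L M n A - acl_level L M n B. rk_ge L M n A ({a} \<union> B) m)"

definition rk_eq :: "('f, 'r, unit) lang \<Rightarrow> ('f, 'r, unit, 'a) struct \<Rightarrow> nat \<Rightarrow>
    'a eq_elem set \<Rightarrow> 'a eq_elem set \<Rightarrow> nat \<Rightarrow> bool" where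
  "rk_eq L M n A B m \<longleftrightarrow> rk_ge L M n A B m \<and> \<not> rk_ge L M n A B (Suc m)"

definition exchange_property ::
  "'k rel \<Rightarrow> ('f, 'r, unit) lang \<Rightarrow> ('f, 'r, unit, 'a) struct \<Rightarrow> nat \<Rightarrow> bool" where
  "exchange_property \<kappa> L M n \<longleftrightarrow>
     (\<forall>C k (a :: nat \<Rightarrow> 'a eq_elem).
        C \<subseteq> eq_univ L M \<and> |C| <o \<kappa> \<and> 2 \<le> k \<and>
        (\<forall>i\<in>{1..k}. a i \<in> level L M n) \<and>
        (\<forall>i\<in>{1..k}. rk_eq L M n {a i} C 1) \<and>
        a k \<in> acl_eq L M (a ` {1..k - 1} \<union> C) - acl_eq L M (a ` {2..k - 1} \<union> C)
        \<longrightarrow> a 1 \<in> acl_eq L M (a ` {2..k} \<union> C))"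

section \<open>Local thorn-ranks and rosiness\<close>

definition assign :: "('v \<Rightarrow> 'a) \<Rightarrow> 'v list \<Rightarrow> 'a list \<Rightarrow> 'v \<Rightarrow> 'a" where
  "assign e vs as = (\<lambda>v. case map_of (zip vs as) v of None \<Rightarrow> e v | Some a \<Rightarrow> a)"

text \<open>The tuples of elements of the appropriate sorts for the tuple \<open>vs\<close> of variables.\<close>

definition insts :: "('f, 'r, 's, 'a) struct \<Rightarrow> 's var list \<Rightarrow> 'a list set" where
  "insts M vs = {as. list_all2 (\<lambda>a v. a \<in> univ M (fst v)) as vs}"

text \<open>Satisfaction of \<open>\<phi>(vs, ws)\<close>, all of whose free variables are among \<open>vs\<close> and \<open>ws\<close>.\<close>

definition sat2 :: "('f, 'r, 's, 'a) struct \<Rightarrow> ('f, 'r, 's) fm \<Rightarrow>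
    's var list \<Rightarrow> 's var list \<Rightarrow> 'a list \<Rightarrow> 'a list \<Rightarrow> bool" where
  "sat2 M \<phi> vs ws as bs \<longleftrightarrow> sat M (assign undefined (vs @ ws) (as @ bs)) \<phi>"

definition k_inconsistent :: "('f, 'r, 's, 'a) struct \<Rightarrow> nat \<Rightarrow> ('f, 'r, 's) fm \<Rightarrow>
    's var list \<Rightarrow> 's var list \<Rightarrow> 'a list set \<Rightarrow> bool" where
  "k_inconsistent M k \<delta> xs ys S \<longleftrightarrow>
     (\<forall>S0\<subseteq>S. finite S0 \<and> card S0 = k \<longrightarrow> \<not> (\<exists>b\<in>insts M xs. \<forall>a\<in>S0. sat2 M \<delta> xs ys b a))"

text \<open>
  Onshuus' local thorn-rank with respect to \<open>\<Delta>\<close>, a set of formulas \<open>\<delta>(xs; ys)\<close>, \<open>\<Pi>\<close>, a set of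
  formulas \<open>\<pi>(ys; zs)\<close>, and \<open>k\<close>: \<open>thorn_ge M k xs ys zs \<Delta> \<Pi> D m\<close> says that the rank of a formula
  in \<open>xs\<close> with parameters is at least \<open>m\<close>, where \<open>D\<close> is the set of realisations of the formula
  (on which alone the rank depends, so that conjunction with \<open>\<delta>(xs, a)\<close> becomes an
  intersection).
\<close>

fun thorn_ge :: "('f, 'r, 's, 'a) struct \<Rightarrow> nat \<Rightarrow> 's var list \<Rightarrow> 's var list \<Rightarrow> 's var list \<Rightarrow>
    ('f, 'r, 's) fm set \<Rightarrow> ('f, 'r, 's) fm set \<Rightarrow> 'a list set \<Rightarrow> nat \<Rightarrow> bool" where
  "thorn_ge M k xs ys zs \<Delta> \<Pi> D 0 \<longleftrightarrow> D \<noteq> {}"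
| "thorn_ge M k xs ys zs \<Delta> \<Pi> D (Suc m) \<longleftrightarrow>
     (\<exists>\<delta>\<in>\<Delta>. \<exists>\<pi>\<in>\<Pi>. \<exists>c\<in>insts M zs.
        infinite {a \<in> insts M ys. sat2 M \<pi> ys zs a c \<and>
          thorn_ge M k xs ys zs \<Delta> \<Pi> {b \<in> D. sat2 M \<delta> xs ys b a} m} \<and>
        k_inconsistent M k \<delta> xs ys {a \<in> insts M ys. sat2 M \<pi> ys zs a c})"

text \<open>
  A theory is rosy if in its expansion by imaginaries all local thorn-ranks with respect to
  finite \<open>\<Delta>\<close> and \<open>\<Pi>\<close> are finite.  As usual, this is evaluated in a saturated model \<open>M\<close> of the
  theory.  For finite \<open>\<Delta>\<close> and \<open>\<Pi>\<close> the rank is bounded by a natural number unless it exceeds all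
  ordinals, so only its finite stages are needed.
\<close>

definition thorn_ranks_finite ::
  "('f, 'r, 's) lang \<Rightarrow> ('f, 'r, 's, 'a) struct \<Rightarrow> bool" where
  "thorn_ranks_finite L M \<longleftrightarrow>
     (\<forall>k xs ys zs \<Delta> \<Pi> \<phi> e.
        distinct (xs @ ys @ zs) \<and> (\<forall>v\<in>set (xs @ ys @ zs). fst v \<in> sorts L) \<and>
        finite \<Delta> \<and> (\<forall>\<delta>\<in>\<Delta>. wf_fm L \<delta> \<and> fv \<delta> \<subseteq> set xs \<union> set ys) \<and>
        finite \<Pi> \<and> (\<forall>\<pi>\<in>\<Pi>. wf_fm L \<pi> \<and> fv \<pi> \<subseteq> set ys \<union> set zs) \<and>
        wf_fm L \<phi> \<and> (\<forall>v\<in>fv \<phi> - set xs. e v \<in> univ M (fst v))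
        \<longrightarrow> (\<exists>m. \<not> thorn_ge M k xs ys zs \<Delta> \<Pi> {b \<in> insts M xs. sat M (assign e xs b) \<phi>} m))"

definition rosy :: "('f, 'r, unit) lang \<Rightarrow> ('f, 'r, unit, 'a) struct \<Rightarrow> bool" where
  "rosy L M \<longleftrightarrow> thorn_ranks_finite (eq_lang L M) (eq_struct M)"

end

(*
  A chain of m steps in a thorn-rank yields a tuple b and parameters a_1, ..., a_m such that each
  a_i is algebraic over b and parameters c_i (by k-inconsistency) but not over everything chosen
  before it (the set it is chosen from is infinite, and algebraic closures of finite sets are
  finite in each sort). Adding a_i to the base lowers the n-rank of b: otherwise a maximal chain in
  acl^n(b) over C stays one over C and a_i, a_i becomes algebraic at some link b_j of the chain,
  and exchange between b_j and a rank-1 element of acl^n(a_i) makes b_j algebraic over a_i. So m is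
  at most the n-rank of b, which is bounded by the size of acl^n(b), and this size is bounded
  uniformly in b.

  The finiteness comes from the Ryll-Nardzewski theorem. Its proof needs no compactness theorem:
  the types and the type-omitting countable elementary substructure are all realized inside the
  saturated model M.
*)

theory Submission
  imports Defs
begin

section \<open>Syntax\<close>

text \<open>Exchange is available only between elements of rank 1, while neither the
  \<open>a_i\<close> nor the links of a chain need have rank 1. On the side of \<open>a_i\<close>
  minimality helps: among the elements of acl^n(a_i) outside the closure of the base, one whose own
  acl^n is smallest has rank 1. On the side of a link, a rank above 1 is welcome, since such a link
  splits into two and lengthens the chain. Hence the drop of the rank is proved directly, by
  induction on the length of a chain over the larger base. The level n has to contain only the sorts
  of the variables x and y of a thorn-rank; the c_i enter the base, which may hold imaginaries of
  any arity. Ryll-Nardzewski speaks about the home sort. A formula on imaginaries becomes one about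
  representatives, so only finitely many relations between one sort and home tuples of a fixed
  length are definable. For one such relation, the tuples with at most j solutions form an
  increasing sequence of definable sets; finitely many sets are possible, so the sequence becomes
  constant and all finite solution sets obey one bound.\<close>

lemma val_cong: "(\<And>v. v \<in> fv_tm t \<Longrightarrow> e v = e' v) \<Longrightarrow> val M e t = val M e' t"
proof (induction t)
  case (App f ts)
  then have "map (val M e) ts = map (val M e') ts"
    by (intro map_cong) auto
  then show ?case by (simp only: val.simps)
qed simp

lemma sat_cong: "(\<And>v. v \<in> fv \<phi> \<Longrightarrow> e v = e' v) \<Longrightarrow> sat M e \<phi> = sat M e' \<phi>"
proof (induction \<phi> arbitrary: e e')
  case (FEq t u)
  then have "val M e t = val M e' t" "val M e u = val M e' u"
    by (auto intro!: val_cong)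
  then show ?case by simp
next
  case (FRel r ts)
  then have "map (val M e) ts = map (val M e') ts"
    by (intro map_cong refl val_cong) auto
  then show ?case by (simp only: sat.simps)
next
  case (FNeg \<phi>)
  have "sat M e \<phi> = sat M e' \<phi>" by (rule FNeg.IH) (simp add: FNeg.prems)
  then show ?case by simp
next
  case (FConj \<phi> \<psi>)
  have "sat M e \<phi> = sat M e' \<phi>" by (rule FConj.IH) (simp add: FConj.prems)
  moreover have "sat M e \<psi> = sat M e' \<psi>" by (rule FConj.IH) (simp add: FConj.prems)
  ultimately show ?case by simp
next
  case (FEx x \<phi>)
  have "sat M (e(x := a)) \<phi> = sat M (e'(x := a)) \<phi>" for a
    by (rule FEx.IH) (use FEx.prems in auto)
  then show ?case by simp
qed

lemma finite_fv_tm: "finite (fv_tm t)"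
  by (induction t) auto

lemma finite_fv: "finite (fv \<phi>)"
  by (induction \<phi>) (auto simp: finite_fv_tm)

lemma wf_tm_fv_sorts: "wf_tm L t \<Longrightarrow> v \<in> fv_tm t \<Longrightarrow> fst v \<in> sorts L"
  by (induction t) auto

lemma wf_fm_fv_sorts: "wf_fm L \<phi> \<Longrightarrow> v \<in> fv \<phi> \<Longrightarrow> fst v \<in> sorts L"
  by (induction \<phi>) (auto dest: wf_tm_fv_sorts)

text \<open>Source of fresh variables: bounding the indices alone makes \<open>(s, N)\<close> new in
  every sort \<open>s\<close>.\<close>

lemma finite_var_bound:
  assumes "finite (V :: 's var set)"
  obtains N where "\<And>v. v \<in> V \<Longrightarrow> snd v < N"
proof -
  have "finite (snd ` V)" using assms by simp
  then obtain N where "\<forall>i\<in>snd ` V. i < N" using finite_nat_set_iff_bounded by blast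
  then show ?thesis using that by auto
qed

lemma val_in_univ:
  assumes "is_struct L M"
  shows "wf_tm L t \<Longrightarrow> (\<And>v. v \<in> fv_tm t \<Longrightarrow> e v \<in> univ M (fst v)) \<Longrightarrow>
    val M e t \<in> univ M (sort_of L t)"
proof (induction t)
  case (App f ts)
  have "val M e t \<in> univ M (sort_of L t)" if "t \<in> set ts" for t
    by (rule App.IH) (use that App.prems in auto)
  then have "list_all2 (\<lambda>a s. a \<in> univ M s) (map (val M e) ts) (map (sort_of L) ts)"
    by (simp add: list_all2_conv_all_nth)
  moreover have "f \<in> fsyms L" "map (sort_of L) ts = fdom L f" using App.prems(1) by auto
  ultimately show ?case using assms by (simp add: is_struct_def del: map_eq_conv)
qed simp

fun subst_tm :: "('s var \<Rightarrow> ('f, 's) tm) \<Rightarrow> ('f, 's) tm \<Rightarrow> ('f, 's) tm" where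
  "subst_tm g (Var v) = g v"
| "subst_tm g (App f ts) = App f (map (subst_tm g) ts)"

lemma val_subst_tm: "val M e (subst_tm g t) = val M (\<lambda>v. val M e (g v)) t"
  by (induction t) (auto intro!: arg_cong[where f = "fint M _"])

lemma fv_subst_tm: "fv_tm (subst_tm g t) = (\<Union>v\<in>fv_tm t. fv_tm (g v))"
  by (induction t) auto

lemma sort_of_subst_tm:
  "(\<And>v. v \<in> fv_tm t \<Longrightarrow> sort_of L (g v) = fst v) \<Longrightarrow> sort_of L (subst_tm g t) = sort_of L t"
  by (cases t) auto

lemma wf_subst_tm:
  "wf_tm L t \<Longrightarrow> (\<And>v. v \<in> fv_tm t \<Longrightarrow> wf_tm L (g v) \<and> sort_of L (g v) = fst v) \<Longrightarrow>
    wf_tm L (subst_tm g t)"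
proof (induction t)
  case (App f ts)
  have "map (sort_of L) (map (subst_tm g) ts) = map (sort_of L) ts"
  proof -
    have "sort_of L (subst_tm g t) = sort_of L t" if "t \<in> set ts" for t
      by (rule sort_of_subst_tm) (use App.prems(2) that in auto)
    then show ?thesis by simp
  qed
  then have "map (sort_of L) (map (subst_tm g) ts) = fdom L f" using App.prems(1) by (metis wf_tm.simps(2))
  moreover have "\<forall>t\<in>set (map (subst_tm g) ts). wf_tm L t" using App by auto
  ultimately show ?case using App.prems(1) by (simp del: map_map)
qed simp

text \<open>
  Stating substitution existentially, for all \<open>g\<close> at once, lets the induction choose the name
  of each bound variable, so that no capture-avoiding substitution function is needed.
\<close>

lemma substitution:
  assumes "wf_fm L \<phi>" "\<And>v. v \<in> fv \<phi> \<Longrightarrow> wf_tm L (g v) \<and> sort_of L (g v) = fst v"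
  shows "\<exists>\<psi>. wf_fm L \<psi> \<and> fv \<psi> \<subseteq> (\<Union>v\<in>fv \<phi>. fv_tm (g v)) \<and>
    (\<forall>e. sat M e \<psi> \<longleftrightarrow> sat M (\<lambda>v. val M e (g v)) \<phi>)"
  using assms
proof (induction \<phi> arbitrary: g)
  case (FEq t u)
  then show ?case
    by (intro exI[of _ "FEq (subst_tm g t) (subst_tm g u)"])
      (auto simp: wf_subst_tm sort_of_subst_tm fv_subst_tm val_subst_tm)
next
  case (FRel r ts)
  have "map (sort_of L) (map (subst_tm g) ts) = map (sort_of L) ts"
  proof -
    have "sort_of L (subst_tm g t) = sort_of L t" if "t \<in> set ts" for t
      by (rule sort_of_subst_tm) (use FRel.prems(2) that in auto)
    then show ?thesis by simp
  qed
  then have "map (sort_of L) (map (subst_tm g) ts) = rdom L r" using FRel.prems(1) by (metis wf_fm.simps(2))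
  moreover have "wf_tm L (subst_tm g t)" if "t \<in> set ts" for t
    by (rule wf_subst_tm) (use FRel.prems that in auto)
  moreover have "map (val M e) (map (subst_tm g) ts) = map (val M (\<lambda>v. val M e (g v))) ts" for e
    by (simp add: val_subst_tm)
  ultimately show ?case using FRel
    by (intro exI[of _ "FRel r (map (subst_tm g) ts)"])
      (auto simp: fv_subst_tm simp del: map_map)
next
  case (FNeg \<phi>)
  then obtain \<psi> where "wf_fm L \<psi> \<and> fv \<psi> \<subseteq> (\<Union>v\<in>fv \<phi>. fv_tm (g v)) \<and>
    (\<forall>e. sat M e \<psi> \<longleftrightarrow> sat M (\<lambda>v. val M e (g v)) \<phi>)"
    by force
  then show ?case by (intro exI[of _ "FNeg \<psi>"]) auto
next
  case (FConj \<phi>1 \<phi>2)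
  obtain \<psi>1 where "wf_fm L \<psi>1 \<and> fv \<psi>1 \<subseteq> (\<Union>v\<in>fv \<phi>1. fv_tm (g v)) \<and>
      (\<forall>e. sat M e \<psi>1 \<longleftrightarrow> sat M (\<lambda>v. val M e (g v)) \<phi>1)"
    using FConj.IH(1)[of g] FConj.prems by auto
  moreover obtain \<psi>2 where "wf_fm L \<psi>2 \<and> fv \<psi>2 \<subseteq> (\<Union>v\<in>fv \<phi>2. fv_tm (g v)) \<and>
      (\<forall>e. sat M e \<psi>2 \<longleftrightarrow> sat M (\<lambda>v. val M e (g v)) \<phi>2)"
    using FConj.IH(2)[of g] FConj.prems by auto
  ultimately show ?case by (intro exI[of _ "FConj \<psi>1 \<psi>2"]) auto
next
  case (FEx x \<phi>)
  have "finite (\<Union>v\<in>fv \<phi> - {x}. fv_tm (g v))" by (simp add: finite_fv finite_fv_tm)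
  then obtain N where N: "\<And>w. w \<in> (\<Union>v\<in>fv \<phi> - {x}. fv_tm (g v)) \<Longrightarrow> snd w < N"
    using finite_var_bound by blast
  \<comment> \<open>The index exceeds all those in the terms put for the other free variables, so
    binding \<open>w\<close> captures nothing.\<close>
  define w where "w = (fst x, N)"
  have w: "w \<notin> fv_tm (g v)" if "v \<in> fv \<phi>" "v \<noteq> x" for v
    using N[of w] that by (auto simp: w_def)
  have "\<And>v. v \<in> fv \<phi> \<Longrightarrow> wf_tm L ((g(x := Var w)) v) \<and> sort_of L ((g(x := Var w)) v) = fst v"
    using FEx.prems by (auto simp: w_def)
  then obtain \<psi> where \<psi>: "wf_fm L \<psi>" "fv \<psi> \<subseteq> (\<Union>v\<in>fv \<phi>. fv_tm ((g(x := Var w)) v))"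
    "\<And>e. sat M e \<psi> \<longleftrightarrow> sat M (\<lambda>v. val M e ((g(x := Var w)) v)) \<phi>"
    using FEx.IH[of "g(x := Var w)"] FEx.prems(1) by auto
  have "sat M (e(w := a)) \<psi> \<longleftrightarrow> sat M ((\<lambda>v. val M e (g v))(x := a)) \<phi>" for e a
    unfolding \<psi>(3) by (intro sat_cong) (auto intro!: val_cong dest: w)
  moreover have "fst w = fst x" by (simp add: w_def)
  ultimately show ?case using FEx.prems(1) \<psi>(1,2)
    by (intro exI[of _ "FEx w \<psi>"]) (auto split: if_splits)
qed

section \<open>Blocks of variables and counting quantifiers\<close>

lemma assign_Cons:
  "y \<notin> set ys \<Longrightarrow> assign e (y # ys) (a # as) = assign (e(y := a)) ys as"
  by (rule ext) (auto simp: assign_def split: option.split dest: map_of_SomeD set_zip_leftD)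

lemma assign_notin: "v \<notin> set vs \<Longrightarrow> assign e vs as v = e v"
  by (auto simp: assign_def split: option.split dest: map_of_SomeD set_zip_leftD)

lemma assign_nth:
  "distinct vs \<Longrightarrow> length as = length vs \<Longrightarrow> i < length vs \<Longrightarrow> assign e vs as (vs ! i) = as ! i"
  by (simp add: assign_def map_of_zip_nth)

lemma instsI:
  "length as = length vs \<Longrightarrow> (\<And>i. i < length vs \<Longrightarrow> as ! i \<in> univ M (fst (vs ! i))) \<Longrightarrow> as \<in> insts M vs"
  by (simp add: insts_def list_all2_conv_all_nth)

lemma insts_length: "as \<in> insts M vs \<Longrightarrow> length as = length vs"
  by (auto simp: insts_def list_all2_conv_all_nth)

lemma insts_nth: "as \<in> insts M vs \<Longrightarrow> i < length vs \<Longrightarrow> as ! i \<in> univ M (fst (vs ! i))"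
  by (auto simp: insts_def list_all2_conv_all_nth)

text \<open>Serves to project a finite set of tuples to one coordinate, and to replace the
  quantifier over an imaginary by one over its representatives.\<close>

lemma exists_block:
  assumes "wf_fm L \<phi>" "distinct ys" "\<forall>y\<in>set ys. fst y \<in> sorts L"
  shows "\<exists>\<psi>. wf_fm L \<psi> \<and> fv \<psi> \<subseteq> fv \<phi> - set ys \<and>
    (\<forall>e. sat M e \<psi> \<longleftrightarrow> (\<exists>as\<in>insts M ys. sat M (assign e ys as) \<phi>))"
  using assms(2,3)
proof (induction ys)
  case Nil
  show ?case by (rule exI[of _ \<phi>]) (use assms(1) in \<open>auto simp: insts_def assign_def\<close>)
next
  case (Cons y ys)
  then obtain \<psi> where \<psi>: "wf_fm L \<psi>" "fv \<psi> \<subseteq> fv \<phi> - set ys"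
    "\<And>e. sat M e \<psi> \<longleftrightarrow> (\<exists>as\<in>insts M ys. sat M (assign e ys as) \<phi>)"
    by auto
  have "sat M e (FEx y \<psi>) \<longleftrightarrow> (\<exists>as\<in>insts M (y # ys). sat M (assign e (y # ys) as) \<phi>)" for e
  proof -
    have "insts M (y # ys) = (\<lambda>(a, as). a # as) ` (univ M (fst y) \<times> insts M ys)"
      by (auto simp: insts_def list_all2_Cons2)
    then show ?thesis using Cons.prems by (simp add: \<psi>(3) assign_Cons)
  qed
  then show ?case using \<psi>(1,2) Cons.prems
    by (intro exI[of _ "FEx y \<psi>"]) auto
qed

lemma card_le_0_iff: "finite X \<and> card X \<le> 0 \<longleftrightarrow> X = {}"
  by auto

text \<open>A set has at most n + 1 elements iff removing one suitable \<open>c\<close> leaves at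
  most n; the element \<open>c\<close> is quantified by a fresh variable \<open>y\<close>. If the
  set is empty, nonemptiness of the sort still supplies a value for \<open>y\<close>.\<close>

lemma at_most:
  assumes "wf_fm L \<phi>" "fst x \<in> sorts L" "univ M (fst x) \<noteq> {}"
  shows "\<exists>\<psi>. wf_fm L \<psi> \<and> fv \<psi> \<subseteq> fv \<phi> - {x} \<and>
    (\<forall>e. sat M e \<psi> \<longleftrightarrow> finite {b \<in> univ M (fst x). sat M (e(x := b)) \<phi>} \<and>
      card {b \<in> univ M (fst x). sat M (e(x := b)) \<phi>} \<le> n)"
  using assms(1)
proof (induction n arbitrary: \<phi>)
  case 0
  have "sat M e (FNeg (FEx x \<phi>)) \<longleftrightarrow> finite {b \<in> univ M (fst x). sat M (e(x := b)) \<phi>} \<and>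
      card {b \<in> univ M (fst x). sat M (e(x := b)) \<phi>} \<le> 0" (is "_ \<longleftrightarrow> finite ?X \<and> _") for e
  proof -
    have "sat M e (FNeg (FEx x \<phi>)) \<longleftrightarrow> ?X = {}" by auto
    also have "\<dots> \<longleftrightarrow> finite ?X \<and> card ?X \<le> 0" by (rule card_le_0_iff[symmetric])
    finally show ?thesis .
  qed
  then show ?case
    by (intro exI[of _ "FNeg (FEx x \<phi>)"] conjI allI) (simp_all only:, use assms 0 in auto)
next
  case (Suc n)
  obtain N where N: "\<And>v. v \<in> insert x (fv \<phi>) \<Longrightarrow> snd v < N"
    using finite_var_bound[of "insert x (fv \<phi>)"] finite_fv[of \<phi>] by auto
  define y where "y = (fst x, N)"
  have y: "y \<noteq> x" "y \<notin> fv \<phi>" "fst y = fst x" using N[of y] by (auto simp: y_def)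
  define \<chi> where "\<chi> = FConj \<phi> (FNeg (FEq (Var x) (Var y)))"
  have "wf_fm L \<chi>" using Suc.prems assms by (simp add: \<chi>_def y)
  from Suc.IH[OF this] obtain \<psi> where \<psi>: "wf_fm L \<psi>" "fv \<psi> \<subseteq> fv \<chi> - {x}"
    "\<And>e. sat M e \<psi> \<longleftrightarrow> finite {b \<in> univ M (fst x). sat M (e(x := b)) \<chi>} \<and>
      card {b \<in> univ M (fst x). sat M (e(x := b)) \<chi>} \<le> n"
    by blast
  have eq: "{b \<in> univ M (fst x). sat M (e(y := c, x := b)) \<chi>} =
      {b \<in> univ M (fst x). sat M (e(x := b)) \<phi>} - {c}" for e c
  proof -
    have "sat M (e(y := c, x := b)) \<phi> = sat M (e(x := b)) \<phi>" for b
      by (rule sat_cong) (use y in auto)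
    then show ?thesis using y by (auto simp: \<chi>_def)
  qed
  have "sat M e (FEx y \<psi>) \<longleftrightarrow> finite {b \<in> univ M (fst x). sat M (e(x := b)) \<phi>} \<and>
      card {b \<in> univ M (fst x). sat M (e(x := b)) \<phi>} \<le> Suc n" (is "_ \<longleftrightarrow> finite ?X \<and> card ?X \<le> _") for e
  proof
    assume "sat M e (FEx y \<psi>)"
    then obtain c where "finite (?X - {c})" "card (?X - {c}) \<le> n"
      by (auto simp: \<psi>(3) eq)
    then show "finite ?X \<and> card ?X \<le> Suc n"
      by (auto simp: card_Diff_singleton_if split: if_splits)
  next
    assume X: "finite ?X \<and> card ?X \<le> Suc n"
    obtain c where "c \<in> univ M (fst x)" "card (?X - {c}) \<le> n"
    proof (cases "?X = {}")
      case True
      with assms(3) that show ?thesis by (metis card.empty empty_Diff equals0I zero_le)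
    next
      case False
      then obtain c where "c \<in> ?X" by blast
      then have "c \<in> univ M (fst x)" "card (?X - {c}) \<le> n"
        using X card_Diff_singleton[of c ?X] by auto
      then show ?thesis by (rule that)
    qed
    then show "sat M e (FEx y \<psi>)" using X y by (auto simp: \<psi>(3) eq)
  qed
  then show ?case
    by (intro exI[of _ "FEx y \<psi>"] conjI allI)
      (simp_all only:, use \<psi>(1,2) y assms in \<open>auto simp: \<chi>_def\<close>)
qed

section \<open>Algebraic closure\<close>

lemma acl_mono: "A \<subseteq> B \<Longrightarrow> acl L M A \<subseteq> acl L M B"
  unfolding acl_def by blast

lemma acl_witness:
  assumes "fst x \<in> sorts L" "b \<in> univ M (fst x)" "wf_fm L \<phi>"
    "\<And>v. v \<in> fv \<phi> - {x} \<Longrightarrow> e v \<in> A \<inter> univ M (fst v)"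
    "sat M (e(x := b)) \<phi>" "finite {b' \<in> univ M (fst x). sat M (e(x := b')) \<phi>}"
  shows "b \<in> acl L M A"
  using assms unfolding acl_def by blast

lemma acl_refl:
  assumes "a \<in> A" "s \<in> sorts L" "a \<in> univ M s"
  shows "a \<in> acl L M A"
  by (rule acl_witness[where x = "(s, 0)" and \<phi> = "FEq (Var (s, 0)) (Var (s, 1))" and e = "\<lambda>_. a"])
    (use assms in auto)

text \<open>A coordinate of a tuple from a finite definable set lies in the projection of that set,
  which is finite and definable by quantifying the whole block.\<close>

lemma acl_block:
  assumes "wf_fm L \<phi>" "distinct ys" "\<forall>y\<in>set ys. fst y \<in> sorts L"
    "\<And>v. v \<in> fv \<phi> - set ys \<Longrightarrow> e v \<in> A \<inter> univ M (fst v)"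
    "finite {as \<in> insts M ys. sat M (assign e ys as) \<phi>}"
    "as \<in> insts M ys" "sat M (assign e ys as) \<phi>"
  shows "set as \<subseteq> acl L M A"
proof
  fix b assume "b \<in> set as"
  then obtain i where i: "i < length ys" "b = as ! i"
    using assms(6) by (auto simp: in_set_conv_nth insts_length)
  define y where "y = ys ! i"
  have y: "y \<in> set ys" using i by (simp add: y_def)
  obtain N where N: "\<And>v. v \<in> set ys \<union> fv \<phi> \<Longrightarrow> snd v < N"
    using finite_var_bound[of "set ys \<union> fv \<phi>"] finite_fv[of \<phi>] by auto
  \<comment> \<open>\<open>y\<close> itself disappears under the quantifiers; the fresh
    \<open>w\<close> keeps the value of the chosen coordinate.\<close>
  define w where "w = (fst y, N)"
  have w: "w \<notin> set ys" "w \<notin> fv \<phi>" "fst w = fst y" using N[of w] by (auto simp: w_def)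
  have "wf_fm L (FConj \<phi> (FEq (Var y) (Var w)))" using assms(1,3) y w by auto
  from exists_block[OF this assms(2,3), where M = M] obtain \<psi> where \<psi>: "wf_fm L \<psi>"
    "fv \<psi> \<subseteq> fv (FConj \<phi> (FEq (Var y) (Var w))) - set ys"
    "\<And>e. sat M e \<psi> \<longleftrightarrow> (\<exists>as\<in>insts M ys. sat M (assign e ys as) (FConj \<phi> (FEq (Var y) (Var w))))"
    by metis
  have sat_iff: "sat M (e(w := b')) \<psi> \<longleftrightarrow> (\<exists>as\<in>insts M ys. sat M (assign e ys as) \<phi> \<and> as ! i = b')" for b'
  proof -
    have "sat M (assign (e(w := b')) ys as) \<phi> \<longleftrightarrow> sat M (assign e ys as) \<phi>" for as
    proof (rule sat_cong)
      fix v assume "v \<in> fv \<phi>"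
      with w show "assign (e(w := b')) ys as v = assign e ys as v"
        by (auto simp: assign_def split: option.split)
    qed
    then show ?thesis using w i assms(2)
      by (auto simp: \<psi>(3) y_def assign_nth insts_length assign_notin)
  qed
  show "b \<in> acl L M A"
  proof (rule acl_witness[where x = w and \<phi> = \<psi> and e = e])
    show "fst w \<in> sorts L" using assms(3) y w by simp
    show "b \<in> univ M (fst w)" using insts_nth[OF assms(6) i(1)] i w by (simp add: y_def)
    show "e v \<in> A \<inter> univ M (fst v)" if "v \<in> fv \<psi> - {w}" for v
    proof -
      have "v \<in> fv \<phi> - set ys" using that \<psi>(2) y by auto
      then show ?thesis by (rule assms(4))
    qed
    show "sat M (e(w := b)) \<psi>" using assms(6,7) i by (auto simp: sat_iff)
    have "{b' \<in> univ M (fst w). sat M (e(w := b')) \<psi>} \<subseteq>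
        (\<lambda>as. as ! i) ` {as \<in> insts M ys. sat M (assign e ys as) \<phi>}"
      by (auto simp: sat_iff)
    then show "finite {b' \<in> univ M (fst w). sat M (e(w := b')) \<psi>}"
      using assms(5) finite_surj by blast
  qed (rule \<psi>(1))
qed

text \<open>\<open>acl\<close> leaves the sort of its witness variable open. Disjointness identifies
  it with the sort of the parameter that is to be eliminated, as transitivity of \<open>acl\<close>
  requires.\<close>

locale disjoint_sorts =
  fixes L :: "('f, 'r, 's) lang" and M :: "('f, 'r, 's, 'a) struct"
  assumes univ_nonempty: "s \<in> sorts L \<Longrightarrow> univ M s \<noteq> {}"
    and sort_unique: "\<lbrakk>s \<in> sorts L; t \<in> sorts L; a \<in> univ M s; a \<in> univ M t\<rbrakk> \<Longrightarrow> s = t"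
begin

text \<open>Induction on the number of parameter variables with values outside \<open>A\<close>.
  Such a value \<open>e y\<close> satisfies a formula \<open>\<psi>\<close> over \<open>A\<close>
  with finitely many solutions, so \<open>y\<close> can be quantified away: there is
  \<open>y\<close> with \<open>\<psi>\<close>, \<open>\<phi>\<close>, and the statement
  \<open>\<theta>\<close> that \<open>\<phi>\<close> has at most \<open>K\<close> solutions. The
  last conjunct keeps the solution set finite for the other solutions of \<open>\<psi>\<close> as
  well.\<close>

lemma acl_trans_aux:
  assumes "fst x \<in> sorts L" "b \<in> univ M (fst x)" "wf_fm L \<phi>"
    "\<And>v. v \<in> fv \<phi> - {x} \<Longrightarrow> e v \<in> acl L M A \<inter> univ M (fst v)"
    "sat M (e(x := b)) \<phi>" "finite {b' \<in> univ M (fst x). sat M (e(x := b')) \<phi>}"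
  shows "b \<in> acl L M A"
  using assms(3-6)
proof (induction "card {v \<in> fv \<phi> - {x}. e v \<notin> A}" arbitrary: \<phi> e rule: less_induct)
  case less
  show ?case
  proof (cases "{v \<in> fv \<phi> - {x}. e v \<notin> A} = {}")
    case True
    show ?thesis
      by (rule acl_witness[where x = x and \<phi> = \<phi> and e = e]) (use True less.prems assms in auto)
  next
    case False
    then obtain y where y: "y \<in> fv \<phi>" "y \<noteq> x" "e y \<notin> A" by blast
    then have "e y \<in> acl L M A" "e y \<in> univ M (fst y)" using less.prems by auto
    then obtain z \<psi> e2 where z: "fst z \<in> sorts L" "e y \<in> univ M (fst z)" "wf_fm L \<psi>"
      "\<And>v. v \<in> fv \<psi> - {z} \<Longrightarrow> e2 v \<in> A \<inter> univ M (fst v)"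
      "sat M (e2(z := e y)) \<psi>" "finite {c \<in> univ M (fst z). sat M (e2(z := c)) \<psi>}"
      unfolding acl_def by blast
    have "fst y \<in> sorts L" using less.prems(1) y(1) by (rule wf_fm_fv_sorts)
    then have zy: "fst z = fst y" using \<open>e y \<in> univ M (fst y)\<close> z(1,2) by (metis sort_unique)
    obtain N where N: "\<And>v. v \<in> insert x (fv \<phi>) \<Longrightarrow> snd v < N"
      using finite_var_bound[of "insert x (fv \<phi>)"] finite_fv[of \<phi>] by auto
    \<comment> \<open>Moves the parameter variables of \<open>\<psi>\<close> beyond those of
      \<open>\<phi>\<close>, so that a single assignment \<open>e'\<close> can serve both
      formulas.\<close>
    define sh where "sh v = (fst v, snd v + N)" for v :: "'s var"
    define g :: "'s var \<Rightarrow> ('f, 's) tm" where "g v = (if v = z then Var y else Var (sh v))" for v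
    have "wf_tm L (g v) \<and> sort_of L (g v) = fst v" if "v \<in> fv \<psi>" for v
      using wf_fm_fv_sorts[OF z(3) that] zy \<open>fst y \<in> sorts L\<close> by (auto simp: g_def sh_def)
    from substitution[OF z(3) this, where M = M] obtain \<psi>' where \<psi>': "wf_fm L \<psi>'"
      "fv \<psi>' \<subseteq> (\<Union>v\<in>fv \<psi>. fv_tm (g v))" "\<And>e. sat M e \<psi>' \<longleftrightarrow> sat M (\<lambda>v. val M e (g v)) \<psi>"
      by metis
    define K where "K = card {b' \<in> univ M (fst x). sat M (e(x := b')) \<phi>}"
    from at_most[OF less.prems(1) assms(1), of M K] univ_nonempty[OF assms(1)] obtain \<theta> where
      \<theta>: "wf_fm L \<theta>" "fv \<theta> \<subseteq> fv \<phi> - {x}"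
      "\<And>e. sat M e \<theta> \<longleftrightarrow> finite {b \<in> univ M (fst x). sat M (e(x := b)) \<phi>} \<and>
        card {b \<in> univ M (fst x). sat M (e(x := b)) \<phi>} \<le> K"
      by blast
    define e' where "e' v = (if N \<le> snd v then e2 (fst v, snd v - N) else e v)" for v
    define \<chi> where "\<chi> = FEx y (FConj \<psi>' (FConj \<phi> \<theta>))"
    have e'_sh: "e' (sh v) = e2 v" for v by (simp add: e'_def sh_def)
    have e'_\<phi>: "e' v = e v" if "v \<in> insert x (fv \<phi>)" for v
      using N[OF that] by (auto simp: e'_def)
    have sh_ne: "sh v \<noteq> x" "sh v \<noteq> y" "sh v \<notin> fv \<phi>" for v
      using N[of "sh v"] y(1) by (auto simp: sh_def)
    have fv_\<chi>: "fv \<chi> - {x} \<subseteq> sh ` (fv \<psi> - {z}) \<union> (fv \<phi> - {x, y})"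
      using \<psi>'(2) \<theta>(2) unfolding \<chi>_def by (auto simp: g_def split: if_splits)
    have s\<psi>: "sat M (e'(x := b', y := c)) \<psi>' \<longleftrightarrow> sat M (e2(z := c)) \<psi>" for b' c
      unfolding \<psi>'(3) by (rule sat_cong) (auto simp: g_def e'_sh sh_ne)
    have s\<phi>: "sat M (e'(x := b', y := c)) \<phi> \<longleftrightarrow> sat M (e(y := c, x := b')) \<phi>" for b' c
      by (rule sat_cong) (use y e'_\<phi> in auto)
    have s\<theta>: "sat M (e'(x := b', y := c)) \<theta> \<longleftrightarrow> sat M (e(y := c)) \<theta>" for b' c
      by (rule sat_cong) (use \<theta>(2) y e'_\<phi> in auto)
    have s\<chi>: "sat M (e'(x := b')) \<chi> \<longleftrightarrow> (\<exists>c\<in>univ M (fst y). sat M (e2(z := c)) \<psi> \<and>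
        sat M (e(y := c, x := b')) \<phi> \<and> sat M (e(y := c)) \<theta>)" for b'
      by (simp only: \<chi>_def sat.simps s\<psi> s\<phi> s\<theta>)
    show ?thesis
    proof (rule less.hyps[of \<chi> e'])
      have "{v \<in> fv \<chi> - {x}. e' v \<notin> A} \<subseteq> {v \<in> fv \<phi> - {x}. e v \<notin> A} - {y}"
      proof
        fix v assume v: "v \<in> {v \<in> fv \<chi> - {x}. e' v \<notin> A}"
        have "e' (sh u) \<in> A" if "u \<in> fv \<psi> - {z}" for u
          using z(4)[OF that] by (simp add: e'_sh)
        then have "v \<notin> sh ` (fv \<psi> - {z})" using v by blast
        with v fv_\<chi> have "v \<in> fv \<phi> - {x, y}" by blast
        with v e'_\<phi> show "v \<in> {v \<in> fv \<phi> - {x}. e v \<notin> A} - {y}" by auto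
      qed
      then show "card {v \<in> fv \<chi> - {x}. e' v \<notin> A} < card {v \<in> fv \<phi> - {x}. e v \<notin> A}"
        using y by (intro psubset_card_mono) (auto simp: finite_fv)
      show "wf_fm L \<chi>" using less.prems(1) \<psi>'(1) \<theta>(1) \<open>fst y \<in> sorts L\<close> by (simp add: \<chi>_def)
      show "e' v \<in> acl L M A \<inter> univ M (fst v)" if v: "v \<in> fv \<chi> - {x}" for v
      proof -
        consider u where "v = sh u" "u \<in> fv \<psi> - {z}" | "v \<in> fv \<phi> - {x, y}" using v fv_\<chi> by blast
        then show ?thesis
        proof cases
          case 1
          moreover have "e2 u \<in> A \<inter> univ M (fst u)" "fst u \<in> sorts L"
            using z(4)[of u] wf_fm_fv_sorts[OF z(3)] 1(2) by blast+
          ultimately show ?thesis by (auto simp: e'_sh acl_refl) (simp add: sh_def)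
        next
          case 2
          then show ?thesis using less.prems(2)[of v] by (auto simp: e'_\<phi>)
        qed
      qed
      show "sat M (e'(x := b)) \<chi>"
        unfolding s\<chi> using z(5) less.prems(3,4) \<open>e y \<in> univ M (fst y)\<close>
        by (intro bexI[of _ "e y"]) (auto simp: \<theta>(3) K_def)
      have "{b' \<in> univ M (fst x). sat M (e'(x := b')) \<chi>} \<subseteq>
          (\<Union>c\<in>{c \<in> univ M (fst z). sat M (e2(z := c)) \<psi>}.
            {b' \<in> univ M (fst x). sat M (e(y := c)) \<theta> \<and> sat M (e(y := c, x := b')) \<phi>})"
        by (auto simp: s\<chi> zy)
      moreover have fin: "finite {b' \<in> univ M (fst x). sat M (e(y := c)) \<theta> \<and> sat M (e(y := c, x := b')) \<phi>}" for c
        by (cases "sat M (e(y := c)) \<theta>") (auto simp: \<theta>(3))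
      ultimately show "finite {b' \<in> univ M (fst x). sat M (e'(x := b')) \<chi>}"
        by (auto elim!: finite_subset simp: z(6))
    qed
  qed
qed

lemma acl_trans:
  assumes "B \<subseteq> acl L M A"
  shows "acl L M B \<subseteq> acl L M A"
proof
  fix b assume "b \<in> acl L M B"
  then obtain x \<phi> e where x: "fst x \<in> sorts L" "b \<in> univ M (fst x)" "wf_fm L \<phi>"
    "\<forall>v\<in>fv \<phi> - {x}. e v \<in> B \<inter> univ M (fst v)"
    "sat M (e(x := b)) \<phi>" "finite {b' \<in> univ M (fst x). sat M (e(x := b')) \<phi>}"
    unfolding acl_def by blast
  show "b \<in> acl L M A"
    by (rule acl_trans_aux[OF x(1-3) _ x(5,6)]) (use x(4) assms in auto)
qed

end

section \<open>Omitting types\<close>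

text \<open>The semantic counterpart of a formula all of whose free variables have index below
  \<open>n\<close>.\<close>

definition supported :: "'a set \<Rightarrow> nat \<Rightarrow> (nat \<Rightarrow> 'a) set \<Rightarrow> bool" where
  "supported U n S \<longleftrightarrow> (\<forall>\<epsilon>\<in>S. \<forall>\<epsilon>'. range \<epsilon>' \<subseteq> U \<longrightarrow> (\<forall>i<n. \<epsilon> i = \<epsilon>' i) \<longrightarrow> \<epsilon>' \<in> S)"

lemma supportedD:
  "\<lbrakk>supported U n S; \<epsilon> \<in> S; range \<epsilon>' \<subseteq> U; \<And>i. i < n \<Longrightarrow> \<epsilon> i = \<epsilon>' i\<rbrakk> \<Longrightarrow> \<epsilon>' \<in> S"
  unfolding supported_def by blast

lemma supported_mono: "supported U m S \<Longrightarrow> m \<le> n \<Longrightarrow> supported U n S"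
  unfolding supported_def by (meson less_le_trans)

lemma range_upd_subset: "range \<epsilon> \<subseteq> U \<Longrightarrow> b \<in> U \<Longrightarrow> range (\<epsilon>(i := b)) \<subseteq> U"
  by auto

text \<open>
  The sets of assignments defined by formulas form a countable, locally finite-dimensional
  cylindric set algebra \<open>DS\<close>; the last assumption is what \<open>\<aleph>\<^sub>0\<close>-saturation gives for
  descending sequences.
\<close>

locale cylindric_algebra =
  fixes U :: "'a set" and DS :: "(nat \<Rightarrow> 'a) set set"
  assumes nonempty: "U \<noteq> {}"
    and sub: "S \<in> DS \<Longrightarrow> \<epsilon> \<in> S \<Longrightarrow> range \<epsilon> \<subseteq> U"
    and finite_support: "S \<in> DS \<Longrightarrow> \<exists>n. supported U n S"
    and DS_compl: "S \<in> DS \<Longrightarrow> {\<epsilon>. range \<epsilon> \<subseteq> U \<and> \<epsilon> \<notin> S} \<in> DS"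
    and DS_Int: "S \<in> DS \<Longrightarrow> S' \<in> DS \<Longrightarrow> S \<inter> S' \<in> DS"
    and DS_ex: "S \<in> DS \<Longrightarrow> {\<epsilon>. range \<epsilon> \<subseteq> U \<and> (\<exists>b\<in>U. \<epsilon>(i := b) \<in> S)} \<in> DS"
    and DS_diag: "{\<epsilon>. range \<epsilon> \<subseteq> U \<and> \<epsilon> i = \<epsilon> j} \<in> DS"
    and DS_subst: "S \<in> DS \<Longrightarrow> {\<epsilon>. range \<epsilon> \<subseteq> U \<and> \<epsilon> \<circ> g \<in> S} \<in> DS"
    and countable_DS: "countable DS"
    and saturated_chain: "\<lbrakk>range \<epsilon> \<subseteq> U; \<And>n. C n \<in> DS; \<And>n. C (Suc n) \<subseteq> C n;
      \<And>n. supported U (Suc m) (C n); \<And>n. \<exists>b\<in>U. \<epsilon>(m := b) \<in> C n\<rbrakk>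
      \<Longrightarrow> \<exists>b\<in>U. \<forall>n. \<epsilon>(m := b) \<in> C n"
begin

section \<open>Compactness for descending chains of definable sets\<close>

definition proj :: "nat \<Rightarrow> (nat \<Rightarrow> 'a) set \<Rightarrow> (nat \<Rightarrow> 'a) set" where
  "proj m S = {\<epsilon>. range \<epsilon> \<subseteq> U \<and> (\<exists>\<epsilon>'\<in>S. \<forall>i<m. \<epsilon>' i = \<epsilon> i)}"

lemma DS_Env: "{\<epsilon>. range \<epsilon> \<subseteq> U} \<in> DS"
  using DS_diag[of 0 0] by simp

text \<open>Beyond its support a set is unaffected by projection, so eliminating infinitely many
  coordinates takes only finitely many single quantifiers. The induction descends from
  \<open>m + n\<close>, where \<open>proj\<close> does nothing.\<close>

lemma DS_proj:
  assumes "S \<in> DS"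
  shows "proj m S \<in> DS"
proof -
  obtain n where n: "supported U n S" using finite_support[OF assms] by blast
  have S: "supported U (m + n) S" by (rule supported_mono[OF n]) simp
  have "proj (m + n - k) S \<in> DS" if "k \<le> n" for k
    using that
  proof (induction k)
    case 0
    have "proj (m + n) S = S"
    proof
      show "proj (m + n) S \<subseteq> S"
        unfolding proj_def using S by (auto intro: supportedD)
      show "S \<subseteq> proj (m + n) S"
        unfolding proj_def using sub[OF assms] by blast
    qed
    then show ?case using assms by simp
  next
    case (Suc k)
    define l where "l = m + n - Suc k"
    have l: "m + n - k = Suc l" using Suc.prems by (simp add: l_def)
    have "proj l S = {\<epsilon>. range \<epsilon> \<subseteq> U \<and> (\<exists>b\<in>U. \<epsilon>(l := b) \<in> proj (Suc l) S)}"
    proof (intro subset_antisym subsetI)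
      fix \<epsilon> assume "\<epsilon> \<in> proj l S"
      then obtain \<epsilon>' where e: "range \<epsilon> \<subseteq> U" "\<epsilon>' \<in> S" "\<forall>i<l. \<epsilon>' i = \<epsilon> i" by (auto simp: proj_def)
      moreover have "\<epsilon>' l \<in> U" using sub[OF assms e(2)] by blast
      moreover have "\<forall>i<Suc l. \<epsilon>' i = (\<epsilon>(l := \<epsilon>' l)) i" using e(3) by (auto simp: less_Suc_eq)
      ultimately show "\<epsilon> \<in> {\<epsilon>. range \<epsilon> \<subseteq> U \<and> (\<exists>b\<in>U. \<epsilon>(l := b) \<in> proj (Suc l) S)}"
        using range_upd_subset[of \<epsilon> U "\<epsilon>' l" l] unfolding proj_def by blast
    next
      fix \<epsilon> assume "\<epsilon> \<in> {\<epsilon>. range \<epsilon> \<subseteq> U \<and> (\<exists>b\<in>U. \<epsilon>(l := b) \<in> proj (Suc l) S)}"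
      then obtain b \<epsilon>' where e: "range \<epsilon> \<subseteq> U" "\<epsilon>' \<in> S" "\<forall>i<Suc l. \<epsilon>' i = (\<epsilon>(l := b)) i"
        unfolding proj_def by blast
      have "\<forall>i<l. \<epsilon>' i = \<epsilon> i"
      proof (intro allI impI)
        fix i assume "i < l"
        then show "\<epsilon>' i = \<epsilon> i" using e(3)[rule_format, of i] by simp
      qed
      with e show "\<epsilon> \<in> proj l S" unfolding proj_def by blast
    qed
    moreover have "proj (Suc l) S \<in> DS" using Suc l by simp
    ultimately show ?case unfolding l_def[symmetric] using DS_ex[of "proj (Suc l) S" l] by simp
  qed
  from this[of n] show ?thesis by simp
qed

lemma supported_proj: "supported U m (proj m S)"
  unfolding supported_def proj_def by (auto, metis)

text \<open>Saturation handles one coordinate at a time. The coordinates are chosen successively so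
  that each finite prefix extends into every \<open>S n\<close>; since each \<open>S n\<close>
  depends on finitely many coordinates, the limit assignment lies in all of them.\<close>

lemma chain_realized:
  assumes S: "\<And>n. S n \<in> DS" "\<And>n. S (Suc n) \<subseteq> S n" "\<And>n. S n \<noteq> {}"
  shows "\<exists>\<epsilon>. \<forall>n. \<epsilon> \<in> S n"
proof -
  \<comment> \<open>The invariant: the first \<open>m\<close> entries of the assignment extend to a
    member of each set of the chain.\<close>
  define P where "P m \<epsilon> \<longleftrightarrow> (\<forall>n. \<epsilon> \<in> proj m (S n))" for m \<epsilon>
  obtain u where u: "u \<in> U" using nonempty by blast
  have start: "P 0 (\<lambda>_. u)" using S(3) u by (auto simp: P_def proj_def)
  have step: "\<exists>\<epsilon>'. P (Suc m) \<epsilon>' \<and> (\<exists>b. \<epsilon>' = \<epsilon>(m := b))" if "P m \<epsilon>" for m \<epsilon>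
  proof -
    have \<epsilon>: "range \<epsilon> \<subseteq> U" and Pm: "P m \<epsilon>" using that by (auto simp: P_def proj_def)
    have "\<exists>b\<in>U. \<forall>n. \<epsilon>(m := b) \<in> proj (Suc m) (S n)"
    proof (rule saturated_chain[OF \<epsilon>])
      fix n
      show "proj (Suc m) (S n) \<in> DS" by (rule DS_proj) (rule S)
      show "proj (Suc m) (S (Suc n)) \<subseteq> proj (Suc m) (S n)" using S(2)[of n] by (auto simp: proj_def)
      show "supported U (Suc m) (proj (Suc m) (S n))" by (rule supported_proj)
      obtain \<epsilon>' where e: "\<epsilon>' \<in> S n" "\<forall>i<m. \<epsilon>' i = \<epsilon> i"
        using Pm unfolding P_def proj_def by blast
      have "\<epsilon>' m \<in> U" using sub[OF S(1) e(1)] by blast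
      moreover have "\<forall>i<Suc m. \<epsilon>' i = (\<epsilon>(m := \<epsilon>' m)) i" using e(2) by (auto simp: less_Suc_eq)
      ultimately show "\<exists>b\<in>U. \<epsilon>(m := b) \<in> proj (Suc m) (S n)"
        using e(1) range_upd_subset[OF \<epsilon>, of "\<epsilon>' m" m] unfolding proj_def by blast
    qed
    then show ?thesis unfolding P_def by blast
  qed
  obtain f where f: "\<And>m. P m (f m)" "\<And>m. \<exists>b. f (Suc m) = (f m)(m := b)"
    using dependent_nat_choice[of P "\<lambda>m \<epsilon> \<epsilon>'. \<exists>b. \<epsilon>' = \<epsilon>(m := b)", OF exI[of "P 0", OF start] step]
    by blast
  \<comment> \<open>Entry \<open>i\<close> is chosen at stage \<open>Suc i\<close> and never changed
    afterwards.\<close>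
  define \<epsilon> where "\<epsilon> i = f (Suc i) i" for i
  have stable: "f m i = \<epsilon> i" if "i < m" for m i
    using that
  proof (induction m)
    case (Suc m)
    show ?case
    proof (cases "i = m")
      case False
      obtain b where "f (Suc m) = (f m)(m := b)" using f(2) by blast
      then show ?thesis using Suc False by simp
    qed (simp add: \<epsilon>_def)
  qed simp
  have rf: "range (f m) \<subseteq> U" for m using f(1)[of m] by (auto simp: P_def proj_def)
  then have \<epsilon>: "range \<epsilon> \<subseteq> U" by (auto simp: \<epsilon>_def)
  have "\<epsilon> \<in> S n" for n
  proof -
    obtain m where m: "supported U m (S n)" using finite_support[OF S(1)] by blast
    obtain \<epsilon>' where \<epsilon>': "\<epsilon>' \<in> S n" "\<forall>i<m. \<epsilon>' i = f m i"
      using f(1)[of m] unfolding P_def proj_def by blast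
    show ?thesis by (rule supportedD[OF m \<epsilon>'(1) \<epsilon>]) (simp add: \<epsilon>'(2) stable)
  qed
  then show ?thesis by blast
qed

text \<open>A Baire category argument: the requirements are met one after another by shrinking a
  nonempty definable set, and compactness gives a point of all the sets.\<close>

lemma generic_exists:
  assumes "countable R"
    and dense: "\<And>q P. \<lbrakk>q \<in> R; P \<in> DS; P \<noteq> {}\<rbrakk> \<Longrightarrow> \<exists>P'\<in>DS. P' \<noteq> {} \<and> P' \<subseteq> P \<and> (\<forall>\<epsilon>\<in>P'. q \<epsilon>)"
  shows "\<exists>\<epsilon>. range \<epsilon> \<subseteq> U \<and> (\<forall>q\<in>R. q \<epsilon>)"
proof -
  obtain u where u: "u \<in> U" using nonempty by blast
  \<comment> \<open>The trivial requirement makes the set nonempty, so that it can be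
    enumerated.\<close>
  define R' where "R' = insert (\<lambda>\<epsilon>. True) R"
  have R': "countable R'" "R' \<noteq> {}" using assms(1) by (auto simp: R'_def)
  have dense': "\<exists>P'\<in>DS. P' \<noteq> {} \<and> P' \<subseteq> P \<and> (\<forall>\<epsilon>\<in>P'. q \<epsilon>)" if "q \<in> R'" "P \<in> DS" "P \<noteq> {}" for q P
    using that dense by (auto simp: R'_def)
  define q where "q = from_nat_into R'"
  have q: "q n \<in> R'" for n using R'(2) by (simp add: q_def from_nat_into)
  have "\<exists>S. \<forall>n. (S n \<in> DS \<and> S n \<noteq> {}) \<and> (S (Suc n) \<subseteq> S n \<and> (\<forall>\<epsilon>\<in>S (Suc n). q n \<epsilon>))"
  proof (rule dependent_nat_choice)
    show "\<exists>S. S \<in> DS \<and> S \<noteq> {}"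
      by (rule exI[of _ "{\<epsilon>. range \<epsilon> \<subseteq> U}"]) (use DS_Env u in auto)
    show "\<exists>S'. (S' \<in> DS \<and> S' \<noteq> {}) \<and> S' \<subseteq> S \<and> (\<forall>\<epsilon>\<in>S'. q n \<epsilon>)" if "S \<in> DS \<and> S \<noteq> {}" for S n
      using dense'[OF q, of S n] that by blast
  qed
  then obtain S where S: "\<And>n. S n \<in> DS" "\<And>n. S n \<noteq> {}" "\<And>n. S (Suc n) \<subseteq> S n"
    "\<And>n \<epsilon>. \<epsilon> \<in> S (Suc n) \<Longrightarrow> q n \<epsilon>" by blast
  obtain \<epsilon> where \<epsilon>: "\<And>n. \<epsilon> \<in> S n" using chain_realized[of S, OF S(1,3,2)] by blast
  have "r \<epsilon>" if "r \<in> R" for r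
  proof -
    have "r \<in> R'" using that by (simp add: R'_def)
    then obtain n where "q n = r" using from_nat_into_surj[OF R'(1)] by (auto simp: q_def)
    then show ?thesis using S(4)[OF \<epsilon>] by blast
  qed
  moreover have "range \<epsilon> \<subseteq> U" using sub[OF S(1) \<epsilon>] .
  ultimately show ?thesis by blast
qed

text \<open>The realisations of an isolated \<open>k\<close>-type.\<close>

definition atom :: "nat \<Rightarrow> (nat \<Rightarrow> 'a) set \<Rightarrow> bool" where
  "atom k S \<longleftrightarrow> S \<in> DS \<and> supported U k S \<and> S \<noteq> {} \<and>
    (\<forall>S'\<in>DS. supported U k S' \<longrightarrow> S \<subseteq> S' \<or> S \<inter> S' = {})"

text \<open>If the atoms covered all assignments, compactness would leave finitely many that already
  do. Each definable set in the first \<open>k\<close> coordinates would be a union of these, so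
  there would be only finitely many such sets.\<close>

lemma nonatomic_exists:
  assumes inf: "infinite {S \<in> DS. supported U k S}"
  shows "\<exists>c. range c \<subseteq> U \<and> (\<forall>S. atom k S \<longrightarrow> c \<notin> S)"
proof (rule ccontr)
  assume "\<not> ?thesis"
  then have cover: "\<And>c. range c \<subseteq> U \<Longrightarrow> \<exists>S. atom k S \<and> c \<in> S" by blast
  define At where "At = {S. atom k S}"
  have cAt: "countable At"
    by (rule countable_subset[OF _ countable_DS]) (auto simp: At_def atom_def)
  have "At \<noteq> {}"
  proof -
    obtain u where "u \<in> U" using nonempty by blast
    then have "range (\<lambda>_::nat. u) \<subseteq> U" by auto
    from cover[OF this] show ?thesis by (auto simp: At_def)
  qed
  define t where "t = from_nat_into At"
  have t: "t n \<in> At" for n using \<open>At \<noteq> {}\<close> by (simp add: t_def from_nat_into)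
  then have tDS: "t n \<in> DS" for n by (auto simp: At_def atom_def)
  \<comment> \<open>What the first \<open>n\<close> atoms leave uncovered.\<close>
  define S where "S n = {\<epsilon>. range \<epsilon> \<subseteq> U \<and> (\<forall>i<n. \<epsilon> \<notin> t i)}" for n
  have SDS: "S n \<in> DS" for n
  proof (induction n)
    case 0
    then show ?case using DS_Env by (simp add: S_def)
  next
    case (Suc n)
    have "S (Suc n) = S n \<inter> {\<epsilon>. range \<epsilon> \<subseteq> U \<and> \<epsilon> \<notin> t n}"
      by (auto simp: S_def less_Suc_eq)
    then show ?case using DS_Int[OF Suc DS_compl[OF tDS[of n]]] by simp
  qed
  have "\<exists>n. S n = {}"
  proof (rule ccontr)
    assume "\<not> ?thesis"
    then have "\<exists>\<epsilon>. \<forall>n. \<epsilon> \<in> S n"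
      by (intro chain_realized) (auto simp: SDS, auto simp: S_def)
    then obtain \<epsilon> where \<epsilon>: "\<And>n. \<epsilon> \<in> S n" by blast
    then have "range \<epsilon> \<subseteq> U" using sub[OF SDS] by blast
    then obtain A where A: "A \<in> At" "\<epsilon> \<in> A" using cover by (auto simp: At_def)
    obtain n where "t n = A" using from_nat_into_surj[OF cAt A(1)] by (auto simp: t_def)
    with \<epsilon>[of "Suc n"] A(2) show False by (auto simp: S_def)
  qed
  then obtain n where n: "S n = {}" by blast
  have "{S \<in> DS. supported U k S} \<subseteq> (\<lambda>I. \<Union>i\<in>I. t i) ` Pow {..<n}"
  proof
    fix Y assume "Y \<in> {S \<in> DS. supported U k S}"
    then have Y: "Y \<in> DS" "supported U k Y" by auto
    define I where "I = {i. i < n \<and> t i \<subseteq> Y}"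
    have "Y = (\<Union>i\<in>I. t i)"
    proof
      show "Y \<subseteq> (\<Union>i\<in>I. t i)"
      proof
        fix \<epsilon> assume \<epsilon>: "\<epsilon> \<in> Y"
        then have "range \<epsilon> \<subseteq> U" using sub[OF Y(1)] by blast
        then obtain i where i: "i < n" "\<epsilon> \<in> t i" using n by (auto simp: S_def)
        then have "t i \<subseteq> Y" using t[of i] Y \<epsilon> unfolding At_def atom_def by blast
        with i show "\<epsilon> \<in> (\<Union>i\<in>I. t i)" by (auto simp: I_def)
      qed
    qed (auto simp: I_def)
    moreover have "I \<in> Pow {..<n}" by (auto simp: I_def)
    ultimately show "Y \<in> (\<lambda>I. \<Union>i\<in>I. t i) ` Pow {..<n}" by blast
  qed
  then have "finite {S \<in> DS. supported U k S}" by (rule finite_subset) simp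
  with inf show False by simp
qed

text \<open>The Henkin step: if some member of \<open>P\<close> asks for a witness, a coordinate
  that neither \<open>P\<close> nor \<open>S\<close> depends on is set to that witness, and
  \<open>P\<close> is shrunk to the assignments for which this coordinate works.\<close>

lemma witness_dense:
  assumes "S \<in> DS" "P \<in> DS" "P \<noteq> {}"
  shows "\<exists>P'\<in>DS. P' \<noteq> {} \<and> P' \<subseteq> P \<and>
    (\<forall>\<epsilon>\<in>P'. (\<exists>b\<in>U. \<epsilon>(w := b) \<in> S) \<longrightarrow> (\<exists>j. \<epsilon>(w := \<epsilon> j) \<in> S))" (is "\<exists>P'\<in>DS. ?Q P'")
proof (cases "\<exists>\<epsilon>\<in>P. \<exists>b\<in>U. \<epsilon>(w := b) \<in> S")
  case False
  then have "?Q P" using assms(3) by blast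
  then show ?thesis using assms(2) by (rule bexI)
next
  case True
  then obtain \<epsilon> b where \<epsilon>: "\<epsilon> \<in> P" "b \<in> U" "\<epsilon>(w := b) \<in> S" by blast
  obtain m where m: "supported U m S" using finite_support[OF assms(1)] by blast
  obtain n where n: "supported U n P" using finite_support[OF assms(2)] by blast
  \<comment> \<open>Beyond both supports and different from \<open>w\<close>.\<close>
  define j where "j = Suc (w + m + n)"
  define P' where "P' = P \<inter> {\<epsilon>. range \<epsilon> \<subseteq> U \<and> \<epsilon> \<circ> (id(w := j)) \<in> S}"
  have upd: "\<eta> \<circ> (id(w := j)) = \<eta>(w := \<eta> j)" for \<eta> :: "nat \<Rightarrow> 'a" by auto
  have r: "range \<epsilon> \<subseteq> U" using sub[OF assms(2) \<epsilon>(1)] .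
  have r': "range (\<epsilon>(j := b)) \<subseteq> U" by (rule range_upd_subset[OF r \<epsilon>(2)])
  have "\<epsilon>(j := b) \<in> P" by (rule supportedD[OF n \<epsilon>(1) r']) (simp add: j_def)
  moreover have "(\<epsilon>(j := b))(w := b) \<in> S"
    by (rule supportedD[OF m \<epsilon>(3) range_upd_subset[OF r' \<epsilon>(2)]]) (simp add: j_def)
  ultimately have "\<epsilon>(j := b) \<in> P'" using r' by (simp add: P'_def upd)
  moreover have "P' \<in> DS" unfolding P'_def by (intro DS_Int DS_subst assms)
  moreover have "\<forall>\<eta>\<in>P'. \<exists>j. \<eta>(w := \<eta> j) \<in> S" by (auto simp: P'_def upd)
  moreover have "P' \<subseteq> P" by (simp add: P'_def)
  ultimately have "?Q P'" by blast
  then show ?thesis using \<open>P' \<in> DS\<close> by (rule bexI)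
qed

text \<open>As \<open>g\<close> need not be injective, renaming coordinates is not enough. A copy of
  \<open>P\<close> is placed on the coordinates from \<open>k\<close> on, coordinate
  \<open>i\<close> is equated with \<open>g i + k\<close> for each \<open>i < k\<close>, and
  everything from \<open>k\<close> on is projected away.\<close>

lemma image_type:
  assumes "P \<in> DS"
  shows "{\<eta>. range \<eta> \<subseteq> U \<and> (\<exists>\<epsilon>\<in>P. \<forall>i<k. \<epsilon> (g i) = \<eta> i)} \<in> DS" (is "?X \<in> DS")
proof -
  define Q where "Q m = {\<eta>. range \<eta> \<subseteq> U \<and> \<eta> \<circ> (\<lambda>i. i + k) \<in> P \<and> (\<forall>i<m. \<eta> (g i + k) = \<eta> i)}" for m
  have "Q m \<in> DS" for m
  proof (induction m)
    case 0
    then show ?case using DS_subst[OF assms, of "\<lambda>i. i + k"] by (simp add: Q_def)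
  next
    case (Suc m)
    have "Q (Suc m) = Q m \<inter> {\<epsilon>. range \<epsilon> \<subseteq> U \<and> \<epsilon> (g m + k) = \<epsilon> m}"
      by (auto simp: Q_def less_Suc_eq)
    then show ?case using DS_Int[OF Suc DS_diag] by simp
  qed
  then have "proj k (Q k) \<in> DS" by (rule DS_proj)
  also have "proj k (Q k) = ?X"
  proof (intro subset_antisym subsetI)
    fix \<eta> assume "\<eta> \<in> proj k (Q k)"
    then obtain \<eta>' where h: "range \<eta> \<subseteq> U" "\<eta>' \<in> Q k" "\<forall>i<k. \<eta>' i = \<eta> i" by (auto simp: proj_def)
    then have "\<forall>i<k. (\<eta>' \<circ> (\<lambda>i. i + k)) (g i) = \<eta> i" by (auto simp: Q_def)
    with h show "\<eta> \<in> ?X" unfolding Q_def by blast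
  next
    fix \<eta> assume "\<eta> \<in> ?X"
    then obtain \<epsilon> where h: "range \<eta> \<subseteq> U" "\<epsilon> \<in> P" "\<forall>i<k. \<epsilon> (g i) = \<eta> i" by blast
    define \<eta>' where "\<eta>' i = (if i < k then \<eta> i else \<epsilon> (i - k))" for i
    have "\<eta>' \<circ> (\<lambda>i. i + k) = \<epsilon>" by (auto simp: \<eta>'_def)
    moreover have "range \<eta>' \<subseteq> U" using h(1) sub[OF assms h(2)] by (auto simp: \<eta>'_def)
    ultimately have "\<eta>' \<in> Q k" using h by (simp add: Q_def) (simp add: \<eta>'_def)
    then show "\<eta> \<in> proj k (Q k)" using h(1) unfolding proj_def by (auto simp: \<eta>'_def intro!: bexI[of _ \<eta>'])
  qed
  finally show ?thesis .
qed

text \<open>If no refinement of \<open>P\<close> keeps the tuple selected by \<open>g\<close> away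
  from the type of \<open>c\<close>, then the set \<open>X\<close> of \<open>k\<close>-tuples that
  \<open>g\<close> selects from \<open>P\<close> lies in every definable set of that type. This
  makes \<open>X\<close> an atom containing \<open>c\<close>, against the choice of
  \<open>c\<close>.\<close>

lemma omit_dense:
  assumes c: "range c \<subseteq> U" "\<And>S. atom k S \<Longrightarrow> c \<notin> S" and P: "P \<in> DS" "P \<noteq> {}"
  shows "\<exists>P'\<in>DS. P' \<noteq> {} \<and> P' \<subseteq> P \<and>
    (\<forall>\<epsilon>\<in>P'. \<exists>S\<in>DS. supported U k S \<and> c \<in> S \<and> \<epsilon> \<circ> g \<notin> S)"
proof (rule ccontr)
  assume neg: "\<not> ?thesis"
  define X where "X = {\<eta>. range \<eta> \<subseteq> U \<and> (\<exists>\<epsilon>\<in>P. \<forall>i<k. \<epsilon> (g i) = \<eta> i)}"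
  have X: "X \<in> DS" "supported U k X"
    unfolding X_def by (rule image_type[OF P(1)]) (unfold supported_def, auto, metis)
  have ne: "X \<noteq> {}"
  proof -
    obtain \<epsilon> where "\<epsilon> \<in> P" using P(2) by blast
    then have "\<epsilon> \<circ> g \<in> X" using sub[OF P(1)] by (auto simp: X_def)
    then show ?thesis by blast
  qed
  have le: "X \<subseteq> S" if S: "S \<in> DS" "supported U k S" "c \<in> S" for S
  proof
    fix \<eta> assume "\<eta> \<in> X"
    then obtain \<epsilon> where h: "range \<eta> \<subseteq> U" "\<epsilon> \<in> P" "\<forall>i<k. \<epsilon> (g i) = \<eta> i" by (auto simp: X_def)
    define P' where "P' = P \<inter> {\<epsilon>. range \<epsilon> \<subseteq> U \<and> \<epsilon> \<circ> g \<in> {\<epsilon>. range \<epsilon> \<subseteq> U \<and> \<epsilon> \<notin> S}}"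
    have "P' \<in> DS" unfolding P'_def by (intro DS_Int DS_subst DS_compl P S)
    moreover have "\<forall>\<epsilon>\<in>P'. \<exists>S\<in>DS. supported U k S \<and> c \<in> S \<and> \<epsilon> \<circ> g \<notin> S"
      using S by (auto simp: P'_def)
    moreover have "P' \<subseteq> P" by (auto simp: P'_def)
    ultimately have "P' = {}" using neg by blast
    moreover have "range \<epsilon> \<subseteq> U" using sub[OF P(1) h(2)] .
    ultimately have "\<epsilon> \<circ> g \<in> S" using h(2) by (auto simp: P'_def)
    then show "\<eta> \<in> S" by (rule supportedD[OF S(2) _ h(1)]) (use h(3) in simp)
  qed
  have "atom k X" unfolding atom_def
  proof (intro conjI ballI impI X ne)
    fix S assume S: "S \<in> DS" "supported U k S"
    show "X \<subseteq> S \<or> X \<inter> S = {}"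
    proof (cases "c \<in> S")
      \<comment> \<open>The complement of \<open>S\<close> then belongs to the type of
        \<open>c\<close>, so \<open>le\<close> applies to it.\<close>
      case False
      have "supported U k {\<epsilon>. range \<epsilon> \<subseteq> U \<and> \<epsilon> \<notin> S}"
        using S(2) unfolding supported_def by (metis (no_types, lifting) mem_Collect_eq)
      then have "X \<subseteq> {\<epsilon>. range \<epsilon> \<subseteq> U \<and> \<epsilon> \<notin> S}"
        using le[OF DS_compl[OF S(1)]] False c(1) by blast
      then show ?thesis by blast
    qed (use le S in blast)
  qed
  \<comment> \<open>Otherwise \<open>le\<close>, applied to the complement of \<open>X\<close>,
    makes \<open>X\<close> disjoint from itself.\<close>
  moreover have "c \<in> X"
  proof (rule ccontr)
    assume "c \<notin> X"
    have "supported U k {\<epsilon>. range \<epsilon> \<subseteq> U \<and> \<epsilon> \<notin> X}"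
      using X(2) unfolding supported_def by (metis (no_types, lifting) mem_Collect_eq)
    then have "X \<subseteq> {\<epsilon>. range \<epsilon> \<subseteq> U \<and> \<epsilon> \<notin> X}"
      using le[OF DS_compl[OF X(1)]] \<open>c \<notin> X\<close> c(1) by blast
    with ne show False by blast
  qed
  ultimately show False using c(2) by blast
qed

text \<open>Two countable families of requirements: those of the first make the range of
  \<open>\<epsilon>\<close> an elementary subset, those of the second make every
  \<open>k\<close>-tuple from this range differ in type from \<open>c\<close>.\<close>

theorem omitting_types:
  assumes "infinite {S \<in> DS. supported U k S}"
  shows "\<exists>c \<epsilon>. range c \<subseteq> U \<and> range \<epsilon> \<subseteq> U \<and>
    (\<forall>S\<in>DS. \<forall>w. (\<exists>b\<in>U. \<epsilon>(w := b) \<in> S) \<longrightarrow> (\<exists>j. \<epsilon>(w := \<epsilon> j) \<in> S)) \<and>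
    (\<forall>g. \<exists>S\<in>DS. supported U k S \<and> c \<in> S \<and> \<epsilon> \<circ> g \<notin> S)"
proof -
  obtain c where c: "range c \<subseteq> U" "\<And>S. atom k S \<Longrightarrow> c \<notin> S" using nonatomic_exists[OF assms] by blast
  \<comment> \<open>Only the first \<open>k\<close> values of \<open>g\<close> matter, so finite
    lists code all maps \<open>g\<close> and the second family is countable.\<close>
  define ix :: "nat list \<Rightarrow> nat \<Rightarrow> nat" where "ix l i = (if i < k then l ! i else 0)" for l i
  define R1 where "R1 = (\<lambda>(S, w) \<epsilon>. (\<exists>b\<in>U. \<epsilon>(w := b) \<in> S) \<longrightarrow> (\<exists>j. \<epsilon>(w := \<epsilon> j) \<in> S)) ` (DS \<times> (UNIV :: nat set))"
  define R2 where "R2 = range (\<lambda>l \<epsilon>. \<exists>S\<in>DS. supported U k S \<and> c \<in> S \<and> \<epsilon> \<circ> ix l \<notin> S)"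
  have "\<exists>\<epsilon>. range \<epsilon> \<subseteq> U \<and> (\<forall>q\<in>R1 \<union> R2. q \<epsilon>)"
  proof (rule generic_exists)
    show "countable (R1 \<union> R2)" using countable_DS by (auto simp: R1_def R2_def)
  next
    fix q P assume q: "q \<in> R1 \<union> R2" and P: "P \<in> DS" "P \<noteq> {}"
    from q show "\<exists>P'\<in>DS. P' \<noteq> {} \<and> P' \<subseteq> P \<and> (\<forall>\<epsilon>\<in>P'. q \<epsilon>)"
    proof
      assume "q \<in> R1"
      then obtain S w where "S \<in> DS" "q = (\<lambda>\<epsilon>. (\<exists>b\<in>U. \<epsilon>(w := b) \<in> S) \<longrightarrow> (\<exists>j. \<epsilon>(w := \<epsilon> j) \<in> S))"
        by (auto simp: R1_def)
      then show ?thesis using witness_dense[of S P w] P by simp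
    next
      assume "q \<in> R2"
      then obtain l where "q = (\<lambda>\<epsilon>. \<exists>S\<in>DS. supported U k S \<and> c \<in> S \<and> \<epsilon> \<circ> ix l \<notin> S)"
        by (auto simp: R2_def)
      then show ?thesis using omit_dense[OF c P, where g = "ix l"] by simp
    qed
  qed
  then obtain \<epsilon> where \<epsilon>: "range \<epsilon> \<subseteq> U" "\<And>q. q \<in> R1 \<Longrightarrow> q \<epsilon>" "\<And>q. q \<in> R2 \<Longrightarrow> q \<epsilon>" by blast
  have "(\<exists>b\<in>U. \<epsilon>(w := b) \<in> S) \<longrightarrow> (\<exists>j. \<epsilon>(w := \<epsilon> j) \<in> S)" if "S \<in> DS" for S w
    using \<epsilon>(2)[of "\<lambda>\<epsilon>. (\<exists>b\<in>U. \<epsilon>(w := b) \<in> S) \<longrightarrow> (\<exists>j. \<epsilon>(w := \<epsilon> j) \<in> S)"] that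
    by (force simp: R1_def)
  moreover have "\<exists>S\<in>DS. supported U k S \<and> c \<in> S \<and> \<epsilon> \<circ> g \<notin> S" for g
  proof -
    define l where "l = map g [0..<k]"
    obtain S where S: "S \<in> DS" "supported U k S" "c \<in> S" "\<epsilon> \<circ> ix l \<notin> S"
      using \<epsilon>(3)[of "\<lambda>\<epsilon>. \<exists>S\<in>DS. supported U k S \<and> c \<in> S \<and> \<epsilon> \<circ> ix l \<notin> S"] by (auto simp: R2_def)
    have "\<epsilon> \<circ> g \<notin> S"
    proof
      assume "\<epsilon> \<circ> g \<in> S"
      then have "\<epsilon> \<circ> ix l \<in> S"
        by (rule supportedD[OF S(2)]) (use \<epsilon>(1) in \<open>auto simp: ix_def l_def\<close>)
      with S(4) show False by simp
    qed
    with S show ?thesis by blast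
  qed
  ultimately show ?thesis using c(1) \<epsilon>(1) by blast
qed

end

section \<open>The Ryll-Nardzewski theorem\<close>

instance tm :: (countable, countable) countable
  by countable_datatype

instance fm :: (countable, countable, countable) countable
  by countable_datatype

lemma wf_tm_symbols: "wf_tm L t \<Longrightarrow> set1_tm t \<subseteq> fsyms L"
  by (induction t) auto

lemma wf_fm_symbols: "wf_fm L \<phi> \<Longrightarrow> set1_fm \<phi> \<subseteq> fsyms L \<and> set2_fm \<phi> \<subseteq> rsyms L"
  by (induction \<phi>) (auto dest: wf_tm_symbols)

text \<open>The types of symbols may be uncountable, but a well-formed formula contains symbols of
  \<open>L\<close> only; numbering these embeds the formulas into a countable type.\<close>

lemma countable_formulas:
  fixes L :: "('f, 'r, unit) lang"
  assumes "countable_lang L"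
  shows "countable {\<phi>. wf_fm L \<phi>}"
proof -
  let ?m = "map_fm (to_nat_on (fsyms L)) (to_nat_on (rsyms L)) id :: ('f, 'r, unit) fm \<Rightarrow> (nat, nat, unit) fm"
  have c: "inj_on (to_nat_on (fsyms L)) (fsyms L)" "inj_on (to_nat_on (rsyms L)) (rsyms L)"
    using assms by (auto simp: countable_lang_def)
  have "inj_on ?m {\<phi>. wf_fm L \<phi>}"
  proof (rule inj_onI)
    fix \<phi> \<psi> assume "\<phi> \<in> {\<phi>. wf_fm L \<phi>}" "\<psi> \<in> {\<phi>. wf_fm L \<phi>}" and eq: "?m \<phi> = ?m \<psi>"
    then have s: "set1_fm \<phi> \<subseteq> fsyms L" "set2_fm \<phi> \<subseteq> rsyms L" "set1_fm \<psi> \<subseteq> fsyms L" "set2_fm \<psi> \<subseteq> rsyms L"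
      using wf_fm_symbols by blast+
    show "\<phi> = \<psi>"
      by (rule fm.inj_map_strong[OF _ _ _ eq]) (use s c in \<open>auto dest: inj_onD\<close>)
  qed
  moreover have "countable (?m ` {\<phi>. wf_fm L \<phi>})" by simp
  ultimately show ?thesis using countable_image_inj_on by blast
qed

section \<open>The algebra of definable sets of assignments\<close>

definition defset :: "('f, 'r, unit, 'a) struct \<Rightarrow> ('f, 'r, unit) fm \<Rightarrow> (nat \<Rightarrow> 'a) set" where
  "defset M \<phi> = {\<epsilon>. range \<epsilon> \<subseteq> univ M () \<and> sat M (\<lambda>v. \<epsilon> (snd v)) \<phi>}"

definition defsets :: "('f, 'r, unit) lang \<Rightarrow> ('f, 'r, unit, 'a) struct \<Rightarrow> (nat \<Rightarrow> 'a) set set" where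
  "defsets L M = defset M ` {\<phi>. wf_fm L \<phi>}"

lemma defset_in_defsets: "wf_fm L \<phi> \<Longrightarrow> defset M \<phi> \<in> defsets L M"
  by (simp add: defsets_def)

lemma env_upd: "(\<lambda>v :: unit var. \<epsilon> (snd v))(((), i) := b) = (\<lambda>v. (\<epsilon>(i := b)) (snd v))"
  by (rule ext) auto

lemma supported_defset:
  fixes \<phi> :: "('f, 'r, unit) fm"
  assumes "\<And>v. v \<in> fv \<phi> \<Longrightarrow> snd v < n"
  shows "supported (univ M ()) n (defset M \<phi>)"
proof -
  have "sat M (\<lambda>v. \<epsilon> (snd v)) \<phi> = sat M (\<lambda>v. \<epsilon>' (snd v)) \<phi>" if "\<forall>i<n. \<epsilon> i = \<epsilon>' i" for \<epsilon> \<epsilon>'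
    by (rule sat_cong) (use that assms in blast)
  then show ?thesis unfolding supported_def defset_def by blast
qed

lemma finite_ordLess_cinfinite:
  assumes "Card_order \<kappa>" "cinfinite \<kappa>" "finite A"
  shows "|A| <o \<kappa>"
proof (rule finite_ordLess_infinite)
  show "Well_order \<kappa>" using assms(1) by (simp add: card_order_on_def)
  show "Well_order |A|" by (rule card_of_Well_order)
  show "infinite (Field \<kappa>)" using assms(2) by (simp add: cinfinite_def)
qed (use assms(3) in \<open>simp add: Field_card_of\<close>)

text \<open>The chain is read as a 1-type in variable \<open>m\<close> over the finitely many
  entries of \<open>\<epsilon>\<close> up to \<open>m\<close>; being descending, it is finitely
  satisfiable as soon as each member is.\<close>

lemma saturated_realizes_chain:
  fixes L :: "('f, 'r, unit) lang" and M :: "('f, 'r, unit, 'a) struct" and \<kappa> :: "'k rel"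
  assumes \<kappa>: "Card_order \<kappa>" "cinfinite \<kappa>" "saturated \<kappa> L M"
    and \<epsilon>: "range \<epsilon> \<subseteq> univ M ()" and C: "\<And>n. C n \<in> defsets L M" "\<And>n. C (Suc n) \<subseteq> C n"
    and supp: "\<And>n. supported (univ M ()) (Suc m) (C n)" and ex: "\<And>n. \<exists>b\<in>univ M (). \<epsilon>(m := b) \<in> C n"
  shows "\<exists>b\<in>univ M (). \<forall>n. \<epsilon>(m := b) \<in> C n"
proof -
  have "\<forall>n. \<exists>\<phi>. wf_fm L \<phi> \<and> C n = defset M \<phi>" using C(1) unfolding defsets_def by blast
  then obtain \<phi> where \<phi>: "\<And>n. wf_fm L (\<phi> n)" "\<And>n. C n = defset M (\<phi> n)" by metis
  \<comment> \<open>A formula defining \<open>C n\<close> may mention variables beyond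
    \<open>m\<close> although the set does not depend on them. Giving them the value
    \<open>\<epsilon> 0\<close> keeps all parameters in the finite set of the first entries.\<close>
  define \<eta> where "\<eta> i = (if i \<le> m then \<epsilon> i else \<epsilon> 0)" for i
  define e where "e v = \<eta> (snd v)" for v :: "unit var"
  have \<eta>: "range \<eta> \<subseteq> univ M ()" using \<epsilon> by (auto simp: \<eta>_def)
  have iff: "sat M (e(((), m) := b)) (\<phi> n) \<longleftrightarrow> \<epsilon>(m := b) \<in> C n" if b: "b \<in> univ M ()" for b n
  proof -
    have r: "range (\<eta>(m := b)) \<subseteq> univ M ()" "range (\<epsilon>(m := b)) \<subseteq> univ M ()"
      using range_upd_subset[OF \<eta> b] range_upd_subset[OF \<epsilon> b] by blast+
    have "sat M (e(((), m) := b)) (\<phi> n) \<longleftrightarrow> \<eta>(m := b) \<in> C n"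
      using r(1) by (simp only: e_def[abs_def] env_upd \<phi>(2) defset_def mem_Collect_eq simp_thms)
    also have "\<dots> \<longleftrightarrow> \<epsilon>(m := b) \<in> C n"
      using supportedD[OF supp _ r(2), of "\<eta>(m := b)" n] supportedD[OF supp _ r(1), of "\<epsilon>(m := b)" n]
      by (auto simp: \<eta>_def)
    finally show ?thesis .
  qed
  have mono: "C n \<subseteq> C k" if "k \<le> n" for k n
    using that C(2) by (rule lift_Suc_antimono_le[rotated])
  define p where "p = range (\<lambda>n. (\<phi> n, e))"
  have "\<exists>b\<in>univ M (). \<forall>(\<phi>, e)\<in>p. sat M (e(((), m) := b)) \<phi>"
  proof (rule \<kappa>(3)[unfolded saturated_def, rule_format, of "\<epsilon> ` {..m}"], intro conjI)
    show "\<epsilon> ` {..m} \<subseteq> univ M ()" using \<epsilon> by blast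
    show "|\<epsilon> ` {..m}| <o \<kappa>" by (rule finite_ordLess_cinfinite[OF \<kappa>(1,2)]) simp
    show "\<forall>(\<phi>, e)\<in>p. wf_fm L \<phi> \<and> e ` (fv \<phi> - {((), m)}) \<subseteq> \<epsilon> ` {..m}"
      by (auto simp: p_def \<phi>(1) e_def \<eta>_def)
    show "\<forall>q\<subseteq>p. finite q \<longrightarrow> (\<exists>a\<in>univ M (). \<forall>(\<phi>, e)\<in>q. sat M (e(((), m) := a)) \<phi>)"
    proof (intro allI impI)
      fix q assume q: "q \<subseteq> p" "finite q"
      then obtain I where I: "finite I" "q = (\<lambda>n. (\<phi> n, e)) ` I"
        unfolding p_def by (meson finite_subset_image)
      obtain N where N: "\<forall>n\<in>I. n \<le> N" using I(1) finite_nat_set_iff_bounded_le by blast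
      obtain b where b: "b \<in> univ M ()" "\<epsilon>(m := b) \<in> C N" using ex by blast
      then show "\<exists>a\<in>univ M (). \<forall>(\<phi>, e)\<in>q. sat M (e(((), m) := a)) \<phi>"
        using mono N by (intro bexI[of _ b]) (auto simp: I(2) iff)
    qed
  qed
  then show ?thesis by (auto simp: p_def iff)
qed

lemma cylindric_algebra_defsets:
  fixes L :: "('f, 'r, unit) lang" and M :: "('f, 'r, unit, 'a) struct" and \<kappa> :: "'k rel"
  assumes L: "one_sorted L" "countable_lang L" and M: "is_struct L M"
    and \<kappa>: "Card_order \<kappa>" "cinfinite \<kappa>" "saturated \<kappa> L M"
  shows "cylindric_algebra (univ M ()) (defsets L M)"
proof
  have sorts: "sorts L = {()}" using L(1) by (simp add: one_sorted_def)
  show "univ M () \<noteq> {}" using M sorts by (simp add: is_struct_def)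
  show "range \<epsilon> \<subseteq> univ M ()" if "S \<in> defsets L M" "\<epsilon> \<in> S" for S \<epsilon>
    using that by (auto simp: defsets_def defset_def)
  show "\<exists>n. supported (univ M ()) n S" if S: "S \<in> defsets L M" for S
  proof -
    obtain \<phi> where \<phi>: "S = defset M \<phi>" using S by (auto simp: defsets_def)
    obtain n where "\<And>v. v \<in> fv \<phi> \<Longrightarrow> snd v < n" using finite_var_bound[OF finite_fv] by blast
    then show ?thesis unfolding \<phi> by (intro exI supported_defset)
  qed
  show "{\<epsilon>. range \<epsilon> \<subseteq> univ M () \<and> \<epsilon> \<notin> S} \<in> defsets L M" if S: "S \<in> defsets L M" for S
  proof -
    obtain \<phi> where \<phi>: "wf_fm L \<phi>" "S = defset M \<phi>" using S by (auto simp: defsets_def)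
    have "{\<epsilon>. range \<epsilon> \<subseteq> univ M () \<and> \<epsilon> \<notin> S} = defset M (FNeg \<phi>)" by (auto simp: \<phi>(2) defset_def)
    then show ?thesis using \<phi>(1) by (simp add: defset_in_defsets)
  qed
  show "S \<inter> S' \<in> defsets L M" if S: "S \<in> defsets L M" "S' \<in> defsets L M" for S S'
  proof -
    obtain \<phi> \<psi> where \<phi>: "wf_fm L \<phi>" "S = defset M \<phi>" "wf_fm L \<psi>" "S' = defset M \<psi>"
      using S by (auto simp: defsets_def)
    have "S \<inter> S' = defset M (FConj \<phi> \<psi>)" by (auto simp: \<phi>(2,4) defset_def)
    then show ?thesis using \<phi>(1,3) by (simp add: defset_in_defsets)
  qed
  show "{\<epsilon>. range \<epsilon> \<subseteq> univ M () \<and> (\<exists>b\<in>univ M (). \<epsilon>(i := b) \<in> S)} \<in> defsets L M"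
    if S: "S \<in> defsets L M" for S i
  proof -
    obtain \<phi> where \<phi>: "wf_fm L \<phi>" "S = defset M \<phi>" using S by (auto simp: defsets_def)
    have "\<epsilon>(i := b) \<in> S \<longleftrightarrow> sat M (\<lambda>v. (\<epsilon>(i := b)) (snd v)) \<phi>"
      if "range \<epsilon> \<subseteq> univ M ()" "b \<in> univ M ()" for \<epsilon> b
      using range_upd_subset[OF that] by (simp only: \<phi>(2) defset_def mem_Collect_eq simp_thms)
    then have "{\<epsilon>. range \<epsilon> \<subseteq> univ M () \<and> (\<exists>b\<in>univ M (). \<epsilon>(i := b) \<in> S)} = defset M (FEx ((), i) \<phi>)"
      by (auto simp only: defset_def sat.simps env_upd fst_conv mem_Collect_eq)
    then show ?thesis using \<phi>(1) sorts by (simp add: defset_in_defsets)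
  qed
  show "{\<epsilon>. range \<epsilon> \<subseteq> univ M () \<and> \<epsilon> i = \<epsilon> j} \<in> defsets L M" for i j
  proof -
    have "{\<epsilon>. range \<epsilon> \<subseteq> univ M () \<and> \<epsilon> i = \<epsilon> j} = defset M (FEq (Var ((), i)) (Var ((), j)))"
      by (auto simp: defset_def)
    then show ?thesis using sorts by (simp add: defset_in_defsets)
  qed
  show "{\<epsilon>. range \<epsilon> \<subseteq> univ M () \<and> \<epsilon> \<circ> g \<in> S} \<in> defsets L M" if S: "S \<in> defsets L M" for S g
  proof -
    obtain \<phi> where \<phi>: "wf_fm L \<phi>" "S = defset M \<phi>" using S by (auto simp: defsets_def)
    have "wf_tm L (Var ((), g (snd v))) \<and> sort_of L (Var ((), g (snd v))) = fst v"
      if "v \<in> fv \<phi>" for v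
      using sorts by simp
    from substitution[OF \<phi>(1) this, where M = M] obtain \<psi> where \<psi>: "wf_fm L \<psi>"
      "\<forall>e. sat M e \<psi> \<longleftrightarrow> sat M (\<lambda>v. val M e (Var ((), g (snd v)))) \<phi>" by blast
    have "{\<epsilon>. range \<epsilon> \<subseteq> univ M () \<and> \<epsilon> \<circ> g \<in> S} = defset M \<psi>"
      using \<psi>(2) by (auto simp: \<phi>(2) defset_def)
    then show ?thesis using \<psi>(1) by (simp add: defset_in_defsets)
  qed
  show "countable (defsets L M)"
    unfolding defsets_def using countable_formulas[OF L(2)] by simp
  show "\<exists>b\<in>univ M (). \<forall>n. \<epsilon>(m := b) \<in> C n"
    if C: "range \<epsilon> \<subseteq> univ M ()" "\<And>n. C n \<in> defsets L M" "\<And>n. C (Suc n) \<subseteq> C n"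
      "\<And>n. supported (univ M ()) (Suc m) (C n)" "\<And>n. \<exists>b\<in>univ M (). \<epsilon>(m := b) \<in> C n" for \<epsilon> C m
    using saturated_realizes_chain[where C = C and \<epsilon> = \<epsilon> and m = m, OF \<kappa>] C by blast
qed

text \<open>The Tarski-Vaught test.\<close>

definition elementary_subset :: "('f, 'r, unit) lang \<Rightarrow> ('f, 'r, unit, 'a) struct \<Rightarrow> 'a set \<Rightarrow> bool" where
  "elementary_subset L M B \<longleftrightarrow> B \<subseteq> univ M () \<and>
    (\<forall>S\<in>defsets L M. \<forall>\<epsilon> i. range \<epsilon> \<subseteq> B \<longrightarrow> (\<exists>b\<in>univ M (). \<epsilon>(i := b) \<in> S) \<longrightarrow> (\<exists>b\<in>B. \<epsilon>(i := b) \<in> S))"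

text \<open>The substructure on \<open>range a\<close>, transported to the natural numbers because
  \<open>omega_categorical\<close> compares models there.\<close>

definition nat_copy :: "('f, 'r, unit, 'a) struct \<Rightarrow> (nat \<Rightarrow> 'a) \<Rightarrow> ('f, 'r, unit, nat) struct" where
  "nat_copy M a = \<lparr> univ = (\<lambda>_. UNIV), fint = (\<lambda>f as. inv a (fint M f (map a as))),
    rint = (\<lambda>r as. rint M r (map a as)) \<rparr>"

context
  fixes L :: "('f, 'r, unit) lang" and M :: "('f, 'r, unit, 'a) struct"
  assumes one_sorted: "one_sorted L" and struct: "is_struct L M"
begin

lemma elementary_subset_witness:
  assumes B: "elementary_subset L M B" and \<phi>: "wf_fm L \<phi>" and \<epsilon>: "range \<epsilon> \<subseteq> B"
    and b: "b \<in> univ M ()" "sat M (\<lambda>v. (\<epsilon>(i := b)) (snd v)) \<phi>"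
  shows "\<exists>b\<in>B. sat M (\<lambda>v. (\<epsilon>(i := b)) (snd v)) \<phi>"
proof -
  have "range \<epsilon> \<subseteq> univ M ()" using B \<epsilon> by (auto simp: elementary_subset_def)
  then have "\<epsilon>(i := b) \<in> defset M \<phi>" using range_upd_subset[OF _ b(1)] b(2) by (simp only: defset_def mem_Collect_eq simp_thms)
  then obtain b' where "b' \<in> B" "\<epsilon>(i := b') \<in> defset M \<phi>"
    using B \<epsilon> b(1) defset_in_defsets[OF \<phi>, of M] unfolding elementary_subset_def by meson
  then show ?thesis unfolding defset_def by blast
qed

text \<open>The value is the only solution of the equation between variable 0 and the term, so a
  witness found in \<open>B\<close> must be the value itself.\<close>

lemma elementary_subset_closed:
  assumes B: "elementary_subset L M B" and f: "f \<in> fsyms L" "length bs = length (fdom L f)" "set bs \<subseteq> B"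
    and "B \<noteq> {}"
  shows "fint M f bs \<in> B"
proof -
  obtain u where u: "u \<in> B" using \<open>B \<noteq> {}\<close> by blast
  \<comment> \<open>Coordinate 0 is kept free for the value, so the arguments are shifted by
    one.\<close>
  define \<epsilon> where "\<epsilon> i = (if 0 < i \<and> i \<le> length bs then bs ! (i - 1) else u)" for i
  have \<epsilon>: "range \<epsilon> \<subseteq> B" using u f(3) by (force simp: \<epsilon>_def)
  define ts where "ts = map (\<lambda>i. Var ((), Suc i) :: ('f, unit) tm) [0..<length bs]"
  have vals: "map (val M (\<lambda>v. (\<epsilon>(0 := b)) (snd v))) ts = bs" for b
    by (rule nth_equalityI) (auto simp: ts_def \<epsilon>_def)
  have sorts: "sorts L = {()}" using one_sorted by (simp add: one_sorted_def)
  have "map (sort_of L) ts = fdom L f"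
    by (rule nth_equalityI) (auto simp: ts_def f(2))
  then have wf: "wf_fm L (FEq (Var ((), 0)) (App f ts))" using f(1) sorts by (auto simp: ts_def)
  have "set bs \<subseteq> univ M ()" using f(3) B by (auto simp: elementary_subset_def)
  then have "list_all2 (\<lambda>a s. a \<in> univ M s) bs (fdom L f)"
    by (simp add: list_all2_conv_all_nth f(2) subset_iff)
  then have "fint M f bs \<in> univ M (fcod L f)" using struct f(1) unfolding is_struct_def by blast
  then have "fint M f bs \<in> univ M ()" by simp
  then have "\<exists>b\<in>B. sat M (\<lambda>v. (\<epsilon>(0 := b)) (snd v)) (FEq (Var ((), 0)) (App f ts))"
    by (rule elementary_subset_witness[OF B wf \<epsilon>]) (simp only: sat.simps val.simps vals snd_conv fun_upd_same)
  then obtain b where "b \<in> B" "sat M (\<lambda>v. (\<epsilon>(0 := b)) (snd v)) (FEq (Var ((), 0)) (App f ts))" by blast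
  moreover from this(2) have "b = fint M f bs" by (simp only: sat.simps val.simps vals) simp
  ultimately show ?thesis by simp
qed

lemma nat_copy_val:
  assumes B: "elementary_subset L M (range a)" and "inj a"
  shows "wf_tm L t \<Longrightarrow> a (val (nat_copy M a) e t) = val M (\<lambda>v. a (e v)) t"
proof (induction t)
  case (App f ts)
  have eq: "map a (map (val (nat_copy M a) e) ts) = map (val M (\<lambda>v. a (e v))) ts"
    using App by auto
  have "fint M f (map a (map (val (nat_copy M a) e) ts)) \<in> range a"
  proof (rule elementary_subset_closed[OF B])
    show "length (map a (map (val (nat_copy M a) e) ts)) = length (fdom L f)"
      using App.prems by (metis length_map wf_tm.simps(2))
  qed (use App.prems in auto)
  then have "a (fint (nat_copy M a) f (map (val (nat_copy M a) e) ts)) =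
      fint M f (map a (map (val (nat_copy M a) e) ts))"
    by (simp add: nat_copy_def f_inv_into_f del: map_map)
  then show ?case by (simp only: val.simps eq)
qed simp

text \<open>In the quantifier step, the test replaces a witness in the universe of \<open>M\<close>
  by one in \<open>range a\<close>; equality is preserved because \<open>a\<close> is
  injective.\<close>

lemma nat_copy_sat:
  assumes B: "elementary_subset L M (range a)" and a: "inj a"
  shows "wf_fm L \<phi> \<Longrightarrow> sat (nat_copy M a) e \<phi> = sat M (\<lambda>v. a (e v)) \<phi>"
proof (induction \<phi> arbitrary: e)
  case (FEq t u)
  then have "a (val (nat_copy M a) e t) = val M (\<lambda>v. a (e v)) t" "a (val (nat_copy M a) e u) = val M (\<lambda>v. a (e v)) u"
    using nat_copy_val[OF B a] by auto
  then show ?case using a by (metis inj_eq sat.simps(1))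
next
  case (FRel r ts)
  then have "map a (map (val (nat_copy M a) e) ts) = map (val M (\<lambda>v. a (e v))) ts"
    using nat_copy_val[OF B a] by auto
  then show ?case by (simp add: nat_copy_def del: map_map)
next
  case (FEx x \<phi>)
  obtain i where i: "x = ((), i)" by (cases x) auto
  have upd: "(\<lambda>v. a ((e(x := n)) v)) = (\<lambda>v. a (e v))(x := a n)" for n by auto
  define \<epsilon> where "\<epsilon> j = a (e ((), j))" for j
  have \<epsilon>: "(\<lambda>v. a (e v))(x := b) = (\<lambda>v. (\<epsilon>(i := b)) (snd v))" for b by (rule ext) (auto simp: i \<epsilon>_def)
  have "(\<exists>b\<in>univ M (). sat M ((\<lambda>v. a (e v))(x := b)) \<phi>) \<longleftrightarrow> (\<exists>b\<in>range a. sat M ((\<lambda>v. a (e v))(x := b)) \<phi>)"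
  proof
    assume "\<exists>b\<in>univ M (). sat M ((\<lambda>v. a (e v))(x := b)) \<phi>"
    then show "\<exists>b\<in>range a. sat M ((\<lambda>v. a (e v))(x := b)) \<phi>" unfolding \<epsilon>
      using FEx.prems elementary_subset_witness[OF B, of \<phi> \<epsilon> _ i] by (auto simp: \<epsilon>_def simp del: fun_upd_apply)
  next
    assume "\<exists>b\<in>range a. sat M ((\<lambda>v. a (e v))(x := b)) \<phi>"
    then show "\<exists>b\<in>univ M (). sat M ((\<lambda>v. a (e v))(x := b)) \<phi>"
      using B unfolding elementary_subset_def by blast
  qed
  moreover have "sat (nat_copy M a) (e(x := n)) \<phi> = sat M ((\<lambda>v. a (e v))(x := a n)) \<phi>" for n
    unfolding upd[symmetric] by (rule FEx.IH) (use FEx.prems in simp)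
  moreover have "univ (nat_copy M a) (fst x) = UNIV" by (simp add: nat_copy_def)
  ultimately show ?case by (simp add: i del: fun_upd_apply)
qed auto

lemma nat_copy_model:
  assumes "elementary_subset L M (range a)" "inj a" "is_model L M T" "complete_theory L T"
  shows "is_model L (nat_copy M a) T"
proof -
  have "is_struct L (nat_copy M a)" by (simp add: is_struct_def nat_copy_def)
  then show ?thesis
    using assms(3,4) nat_copy_sat[OF assms(1,2)]
    by (auto simp: is_model_def complete_theory_def is_sentence_def)
qed

end

lemma isomorphic_sat:
  fixes N1 :: "('f, 'r, unit, 'a) struct" and N2 :: "('f, 'r, unit, 'b) struct"
  assumes "isomorphic L N1 N2" "univ N1 () = UNIV"
  shows "\<exists>h. range h \<subseteq> univ N2 () \<and> (\<forall>\<phi> e. wf_fm L \<phi> \<longrightarrow> sat N1 e \<phi> = sat N2 (\<lambda>v. h (e v)) \<phi>)"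
proof -
  obtain h where h: "bij_betw h UNIV (univ N2 ())"
    "\<And>f as. f \<in> fsyms L \<Longrightarrow> length as = length (fdom L f) \<Longrightarrow> h (fint N1 f as) = fint N2 f (map h as)"
    "\<And>r as. r \<in> rsyms L \<Longrightarrow> length as = length (rdom L r) \<Longrightarrow> rint N1 r as = rint N2 r (map h as)"
    using assms by (auto simp: isomorphic_def)
  have val: "h (val N1 e t) = val N2 (\<lambda>v. h (e v)) t" if "wf_tm L t" for e t
    using that
  proof (induction t)
    case (App f ts)
    have "map h (map (val N1 e) ts) = map (val N2 (\<lambda>v. h (e v))) ts" using App by auto
    moreover have "length (map (val N1 e) ts) = length (fdom L f)"
      using App.prems by (metis length_map wf_tm.simps(2))
    ultimately show ?case using App.prems by (simp add: h(2) del: map_map)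
  qed simp
  have "sat N1 e \<phi> = sat N2 (\<lambda>v. h (e v)) \<phi>" if "wf_fm L \<phi>" for \<phi> e
    using that
  proof (induction \<phi> arbitrary: e)
    case (FEq t u)
    then have "h (val N1 e t) = val N2 (\<lambda>v. h (e v)) t" "h (val N1 e u) = val N2 (\<lambda>v. h (e v)) u"
      using val by auto
    moreover have "inj h" using h(1) by (simp add: bij_betw_def)
    ultimately show ?case by (metis inj_eq sat.simps(1))
  next
    case (FRel r ts)
    then have "map h (map (val N1 e) ts) = map (val N2 (\<lambda>v. h (e v))) ts" using val by auto
    moreover have "length (map (val N1 e) ts) = length (rdom L r)"
      using FRel by (metis length_map wf_fm.simps(2))
    ultimately show ?case using FRel by (simp add: h(3) del: map_map)
  next
    case (FEx x \<phi>)
    have upd: "(\<lambda>v. h ((e(x := n)) v)) = (\<lambda>v. h (e v))(x := h n)" for n by auto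
    have "univ N2 () = range h" using h(1) by (simp add: bij_betw_def)
    moreover have "sat N1 (e(x := n)) \<phi> = sat N2 ((\<lambda>v. h (e v))(x := h n)) \<phi>" for n
      unfolding upd[symmetric] by (rule FEx.IH) (use FEx.prems in simp)
    ultimately show ?case using assms(2) by (simp del: fun_upd_apply)
  qed auto
  moreover have "range h \<subseteq> univ N2 ()" using h(1) by (simp add: bij_betw_def)
  ultimately show ?thesis by blast
qed

text \<open>If \<open>B\<close> were a finite list, the condition of differing from all its entries
  would be definable and satisfied in \<open>M\<close>, hence also satisfied in
  \<open>B\<close>.\<close>

lemma elementary_subset_infinite:
  assumes "cylindric_algebra (univ M ()) (defsets L M)"
    and B: "elementary_subset L M B" "B \<noteq> {}" and inf: "infinite (univ M ())"
  shows "infinite B"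
proof
  assume "finite B"
  interpret cylindric_algebra "univ M ()" "defsets L M" by fact
  obtain bs where bs: "set bs = B" using finite_list[OF \<open>finite B\<close>] by blast
  have D: "{\<epsilon>. range \<epsilon> \<subseteq> univ M () \<and> (\<forall>i<n. \<epsilon> 0 \<noteq> \<epsilon> (Suc i))} \<in> defsets L M" (is "?D n \<in> _") for n
  proof (induction n)
    case 0
    then show ?case using DS_Env by simp
  next
    case (Suc n)
    have "?D (Suc n) = ?D n \<inter> {\<epsilon>. range \<epsilon> \<subseteq> univ M () \<and> \<epsilon> \<notin> {\<epsilon>. range \<epsilon> \<subseteq> univ M () \<and> \<epsilon> 0 = \<epsilon> (Suc n)}}"
      by (auto simp: less_Suc_eq)
    then show ?case using DS_Int[OF Suc DS_compl[OF DS_diag]] by simp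
  qed
  obtain u where u: "u \<in> B" using B(2) by blast
  define \<epsilon> where "\<epsilon> i = (if 0 < i \<and> i \<le> length bs then bs ! (i - 1) else u)" for i
  have \<epsilon>: "range \<epsilon> \<subseteq> B" using u bs by (force simp: \<epsilon>_def)
  obtain b where b: "b \<in> univ M ()" "b \<notin> B"
    using inf \<open>finite B\<close> by (meson finite_subset subsetI)
  have "range (\<epsilon>(0 := b)) \<subseteq> univ M ()"
    by (rule range_upd_subset) (use \<epsilon> B(1) b(1) in \<open>auto simp: elementary_subset_def\<close>)
  moreover have "\<forall>i<length bs. b \<noteq> \<epsilon> (Suc i)" using b(2) \<epsilon> by auto
  ultimately have "\<epsilon>(0 := b) \<in> ?D (length bs)" by auto
  then obtain b' where b': "b' \<in> B" "\<epsilon>(0 := b') \<in> ?D (length bs)"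
    using B(1) D[of "length bs"] \<epsilon> b(1) unfolding elementary_subset_def by meson
  then obtain i where "i < length bs" "b' = bs ! i" using bs by (auto simp: in_set_conv_nth)
  with b'(2) show False by (auto simp: \<epsilon>_def)
qed

text \<open>Downward Loewenheim-Skolem: \<open>A\<close> is closed in countably many rounds under a
  choice of witnesses.\<close>

lemma countable_elementary_superset:
  fixes L :: "('f, 'r, unit) lang" and M :: "('f, 'r, unit, 'a) struct"
  assumes "cylindric_algebra (univ M ()) (defsets L M)"
    and A: "countable A" "A \<noteq> {}" "A \<subseteq> univ M ()"
  shows "\<exists>B. A \<subseteq> B \<and> countable B \<and> elementary_subset L M B"
proof -
  interpret cylindric_algebra "univ M ()" "defsets L M" by fact
  obtain u where u: "u \<in> A" using A(2) by blast
  \<comment> \<open>By finite support a finite list of parameters suffices. Padding with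
    \<open>u\<close> makes it an assignment, and there are only countably many lists over a
    countable set.\<close>
  define env where "env l i = (if i < length l then l ! i else u)" for l i
  define wit where "wit = (\<lambda>(S, i, l). if \<exists>b\<in>univ M (). (env l)(i := b) \<in> S
    then SOME b. b \<in> univ M () \<and> (env l)(i := b) \<in> S else u)"
  have wit: "wit (S, i, l) \<in> univ M ()" for S i l
  proof (cases "\<exists>b\<in>univ M (). (env l)(i := b) \<in> S")
    case True
    then have "\<exists>b. b \<in> univ M () \<and> (env l)(i := b) \<in> S" by blast
    from someI_ex[OF this] True show ?thesis by (simp add: wit_def)
  qed (use u A(3) in \<open>auto simp: wit_def\<close>)
  define B where "B = rec_nat A (\<lambda>_ B. B \<union> wit ` (defsets L M \<times> UNIV \<times> lists B))"
  have B0: "B 0 = A" and BS: "B (Suc n) = B n \<union> wit ` (defsets L M \<times> UNIV \<times> lists (B n))" for n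
    by (simp_all add: B_def)
  have "countable (B n)" for n
    by (induction n) (use A(1) countable_DS in \<open>auto simp: B0 BS\<close>)
  then have "countable (\<Union>n. B n)" by simp
  have sub_U: "B n \<subseteq> univ M ()" for n
    by (induction n) (use A(3) wit in \<open>auto simp: B0 BS\<close>)
  have mono: "B m \<subseteq> B n" if "m \<le> n" for m n
    using that by (rule lift_Suc_mono_le[rotated]) (auto simp: BS)
  have "elementary_subset L M (\<Union>n. B n)"
    unfolding elementary_subset_def
  proof (intro conjI ballI allI impI)
    show "(\<Union>n. B n) \<subseteq> univ M ()" using sub_U by blast
    fix S \<epsilon> i
    assume S: "S \<in> defsets L M" and \<epsilon>: "range \<epsilon> \<subseteq> (\<Union>n. B n)" and ex: "\<exists>b\<in>univ M (). \<epsilon>(i := b) \<in> S"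
    obtain N where N: "supported (univ M ()) N S" using finite_support[OF S] by blast
    have "\<forall>j. \<exists>n. \<epsilon> j \<in> B n" using \<epsilon> by blast
    then obtain f where f: "\<And>j. \<epsilon> j \<in> B (f j)" by metis
    \<comment> \<open>A round by which the relevant entries of \<open>\<epsilon>\<close> are all
      present.\<close>
    define n where "n = Max (f ` {..N})"
    define l where "l = map \<epsilon> [0..<N]"
    have "\<epsilon> j \<in> B n" if "j < N" for j
    proof -
      have "f j \<le> n" unfolding n_def using that by (intro Max_ge) auto
      then show ?thesis using f[of j] mono by blast
    qed
    then have l: "l \<in> lists (B n)" by (auto simp: l_def)
    have \<epsilon>U: "range \<epsilon> \<subseteq> univ M ()" using \<epsilon> sub_U by blast
    have "range (env l) \<subseteq> univ M ()" using \<epsilon>U u A(3) by (auto simp: env_def l_def)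
    then have sw: "(env l)(i := b) \<in> S \<longleftrightarrow> \<epsilon>(i := b) \<in> S" if b: "b \<in> univ M ()" for b
      using supportedD[OF N _ range_upd_subset[OF \<epsilon>U b, of i], of "(env l)(i := b)"]
        supportedD[OF N _ range_upd_subset[OF _ b, of "env l" i], of "\<epsilon>(i := b)"]
      by (auto simp: env_def l_def)
    have "\<exists>b. b \<in> univ M () \<and> (env l)(i := b) \<in> S" using ex sw by blast
    from someI_ex[OF this] have "wit (S, i, l) \<in> univ M () \<and> (env l)(i := wit (S, i, l)) \<in> S"
      using ex sw by (auto simp: wit_def)
    then have "\<epsilon>(i := wit (S, i, l)) \<in> S" using sw by blast
    moreover have "wit (S, i, l) \<in> B (Suc n)" using S l by (auto simp: BS)
    ultimately show "\<exists>b\<in>(\<Union>n. B n). \<epsilon>(i := b) \<in> S" by blast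
  qed
  moreover have "A \<subseteq> (\<Union>n. B n)" using B0 by blast
  ultimately show ?thesis using \<open>countable (\<Union>n. B n)\<close> by blast
qed

text \<open>The hypothesis provides witnesses only for changes of \<open>\<epsilon>\<close> itself.
  An arbitrary assignment \<open>\<eta>\<close> into the range is a renaming of
  \<open>\<epsilon>\<close> by some \<open>g\<close>, and definable sets are closed under
  renaming.\<close>

lemma elementary_range:
  fixes L :: "('f, 'r, unit) lang" and M :: "('f, 'r, unit, 'a) struct"
  assumes "cylindric_algebra (univ M ()) (defsets L M)" and \<epsilon>: "range \<epsilon> \<subseteq> univ M ()"
    and wit: "\<forall>S\<in>defsets L M. \<forall>w. (\<exists>b\<in>univ M (). \<epsilon>(w := b) \<in> S) \<longrightarrow> (\<exists>j. \<epsilon>(w := \<epsilon> j) \<in> S)"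
  shows "elementary_subset L M (range \<epsilon>)"
  unfolding elementary_subset_def
proof (intro conjI ballI allI impI \<epsilon>)
  interpret cylindric_algebra "univ M ()" "defsets L M" by fact
  fix S \<eta> i
  assume S: "S \<in> defsets L M" and \<eta>: "range \<eta> \<subseteq> range \<epsilon>" and ex: "\<exists>b\<in>univ M (). \<eta>(i := b) \<in> S"
  obtain N where N: "supported (univ M ()) N S" using finite_support[OF S] by blast
  have "\<forall>j. \<exists>n. \<eta> j = \<epsilon> n" using \<eta> by blast
  then obtain g where g: "\<And>j. \<eta> j = \<epsilon> (g j)" by metis
  \<comment> \<open>Above \<open>g j\<close> for all relevant \<open>j\<close>, so that resetting
    coordinate \<open>w\<close> of \<open>\<epsilon>\<close> disturbs no parameter.\<close>
  define w where "w = Suc (Max (g ` {..N}))"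
  have w: "g j \<noteq> w" if "j < N" for j
  proof -
    have "g j \<le> Max (g ` {..N})" using that by (intro Max_ge) auto
    then show ?thesis by (simp add: w_def)
  qed
  define S' where "S' = {\<epsilon>. range \<epsilon> \<subseteq> univ M () \<and> \<epsilon> \<circ> (g(i := w)) \<in> S}"
  have S': "S' \<in> defsets L M" unfolding S'_def by (rule DS_subst[OF S])
  have iff: "\<epsilon>(w := b) \<in> S' \<longleftrightarrow> \<eta>(i := b) \<in> S" if b: "b \<in> univ M ()" for b
  proof -
    have r: "range (\<epsilon>(w := b)) \<subseteq> univ M ()" by (rule range_upd_subset[OF \<epsilon> b])
    have r2: "range (\<eta>(i := b)) \<subseteq> univ M ()" by (rule range_upd_subset[OF _ b]) (use \<eta> \<epsilon> in blast)
    have r3: "range (\<epsilon>(w := b) \<circ> g(i := w)) \<subseteq> univ M ()" using r by auto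
    have eq: "(\<epsilon>(w := b) \<circ> g(i := w)) j = (\<eta>(i := b)) j" if "j < N" for j
      using w[OF that] g by simp
    have "\<epsilon>(w := b) \<circ> g(i := w) \<in> S \<longleftrightarrow> \<eta>(i := b) \<in> S"
      using supportedD[OF N _ r2 eq] supportedD[OF N _ r3 eq[symmetric]] by blast
    then show ?thesis using r by (simp add: S'_def)
  qed
  obtain j where "\<epsilon>(w := \<epsilon> j) \<in> S'" using wit S' ex iff by blast
  then show "\<exists>b\<in>range \<epsilon>. \<eta>(i := b) \<in> S" using iff[of "\<epsilon> j"] \<epsilon> by blast
qed

text \<open>With infinitely many definable sets there are two countable elementary subsets: the
  range of \<open>\<epsilon>\<close>, which omits the type of \<open>c\<close>, and
  \<open>B\<close>, which contains \<open>c\<close>. An isomorphism between their copies would carry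
  \<open>c\<close> to a realisation of its type in the range of \<open>\<epsilon>\<close>.\<close>

lemma finite_defsets:
  fixes L :: "('f, 'r, unit) lang" and M :: "('f, 'r, unit, 'a) struct"
  assumes L: "one_sorted L" and M: "is_model L M T" "infinite (univ M ())"
    and T: "complete_theory L T" "omega_categorical L T"
    and alg: "cylindric_algebra (univ M ()) (defsets L M)"
  shows "finite {S \<in> defsets L M. supported (univ M ()) k S}"
proof (rule ccontr)
  assume inf: "infinite {S \<in> defsets L M. supported (univ M ()) k S}"
  interpret cylindric_algebra "univ M ()" "defsets L M" by fact
  have struct: "is_struct L M" using M(1) by (simp add: is_model_def)
  obtain c \<epsilon> where c: "range c \<subseteq> univ M ()" and \<epsilon>: "range \<epsilon> \<subseteq> univ M ()"
    "\<forall>S\<in>defsets L M. \<forall>w. (\<exists>b\<in>univ M (). \<epsilon>(w := b) \<in> S) \<longrightarrow> (\<exists>j. \<epsilon>(w := \<epsilon> j) \<in> S)"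
    "\<And>g. \<exists>S\<in>defsets L M. supported (univ M ()) k S \<and> c \<in> S \<and> \<epsilon> \<circ> g \<notin> S"
    using omitting_types[OF inf] by blast
  have nat_model: "\<exists>a. inj a \<and> range a = B \<and> is_model L (nat_copy M a) T"
    if B: "countable B" "B \<noteq> {}" "elementary_subset L M B" for B
  proof -
    have "infinite B" by (rule elementary_subset_infinite[OF alg B(3,2) M(2)])
    then have a: "bij_betw (from_nat_into B) UNIV B" using B(1) by (simp add: bij_betw_from_nat_into)
    then have "inj (from_nat_into B)" "range (from_nat_into B) = B" by (auto simp: bij_betw_def)
    then show ?thesis using nat_copy_model[OF L struct _ _ M(1) T(1)] B(3) by metis
  qed
  have "elementary_subset L M (range \<epsilon>)" by (rule elementary_range[OF alg \<epsilon>(1,2)])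
  moreover obtain a1 where a1: "inj a1" "range a1 = range \<epsilon>" "is_model L (nat_copy M a1) T"
    using nat_model[of "range \<epsilon>"] calculation by auto
  moreover obtain B where B: "range c \<subseteq> B" "countable B" "elementary_subset L M B"
    using countable_elementary_superset[OF alg _ _ c] by auto
  moreover obtain a2 where a2: "inj a2" "range a2 = B" "is_model L (nat_copy M a2) T"
    using nat_model[OF B(2) _ B(3)] B(1) by auto
  moreover have "univ (nat_copy M a1) () = UNIV" "univ (nat_copy M a2) () = UNIV"
    by (simp_all add: nat_copy_def)
  ultimately have E: "elementary_subset L M (range a1)" "elementary_subset L M (range a2)"
    and "isomorphic L (nat_copy M a2) (nat_copy M a1)"
    using T(2) unfolding omega_categorical_def by auto
  then obtain h where h: "\<And>\<phi> e. wf_fm L \<phi> \<Longrightarrow> sat (nat_copy M a2) e \<phi> = sat (nat_copy M a1) (\<lambda>v. h (e v)) \<phi>"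
    using isomorphic_sat[of L "nat_copy M a2" "nat_copy M a1"] \<open>univ (nat_copy M a2) () = UNIV\<close> by blast
  \<comment> \<open>\<open>d\<close> codes \<open>c\<close> in the copy of \<open>B\<close>,
    \<open>h\<close> moves the codes to the other copy, and \<open>g\<close> finds the positions of
    the images in \<open>\<epsilon>\<close>.\<close>
  have "\<forall>i. \<exists>n. c i = a2 n" using B(1) a2(2) by blast
  then obtain d where d: "\<And>i. c i = a2 (d i)" by metis
  have "\<forall>i. \<exists>n. a1 (h (d i)) = \<epsilon> n" using a1(2) by blast
  then obtain g where g: "\<And>i. a1 (h (d i)) = \<epsilon> (g i)" by metis
  obtain S where S: "S \<in> defsets L M" "c \<in> S" "\<epsilon> \<circ> g \<notin> S" using \<epsilon>(3) by blast
  then obtain \<phi> where \<phi>: "wf_fm L \<phi>" "S = defset M \<phi>" by (auto simp: defsets_def)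
  have "sat M (\<lambda>v. a2 (d (snd v))) \<phi>" using S(2) by (simp add: \<phi>(2) defset_def d)
  then have "sat M (\<lambda>v. a1 (h (d (snd v)))) \<phi>"
    by (simp only: nat_copy_sat[OF L struct E(1) a1(1) \<phi>(1), symmetric]
        nat_copy_sat[OF L struct E(2) a2(1) \<phi>(1), symmetric] h[OF \<phi>(1)])
  then have "\<epsilon> \<circ> g \<in> S" using \<epsilon>(1) by (auto simp: \<phi>(2) defset_def g)
  with S(3) show False by simp
qed

text \<open>A finite universe has finitely many sets of \<open>k\<close>-tuples at all. Otherwise
  the result for sets of infinite assignments is transferred to sets of tuples.\<close>

theorem ryll_nardzewski:
  fixes L :: "('f, 'r, unit) lang" and M :: "('f, 'r, unit, 'a) struct" and \<kappa> :: "'k rel"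
  assumes "one_sorted L" "countable_lang L" "complete_theory L T" "omega_categorical L T"
    "Card_order \<kappa>" "cinfinite \<kappa>" "is_model L M T" "saturated \<kappa> L M"
  shows "finite {D. definable L M k D}"
proof (cases "finite (univ M ())")
  case True
  then have "finite (tuples M k)"
    using finite_lists_length_eq[OF True, of k] by (simp add: tuples_def conj_commute)
  moreover have "{D. definable L M k D} \<subseteq> Pow (tuples M k)" by (auto simp: definable_def)
  ultimately show ?thesis by (meson finite_Pow_iff finite_subset)
next
  case False
  have struct: "is_struct L M" using assms(7) by (simp add: is_model_def)
  have alg: "cylindric_algebra (univ M ()) (defsets L M)"
    by (rule cylindric_algebra_defsets[OF assms(1,2) struct assms(5,6,8)])
  \<comment> \<open>The cylinder over \<open>D\<close>; it determines \<open>D\<close>, because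
    every tuple extends to an assignment.\<close>
  define F where "F D = {\<epsilon>. range \<epsilon> \<subseteq> univ M () \<and> map \<epsilon> [0..<k] \<in> D}" for D
  obtain u where u: "u \<in> univ M ()" using False by (metis equals0I finite.emptyI)
  have "inj_on F {D. definable L M k D}"
  proof (rule inj_onI)
    fix D D' assume D: "D \<in> {D. definable L M k D}" "D' \<in> {D. definable L M k D}" and eq: "F D = F D'"
    have "as \<in> D \<longleftrightarrow> as \<in> D'" if as: "as \<in> tuples M k" for as
    proof -
      define \<epsilon> where "\<epsilon> i = (if i < k then as ! i else u)" for i
      have "map \<epsilon> [0..<k] = as" using as by (intro nth_equalityI) (auto simp: \<epsilon>_def tuples_def)
      moreover have "range \<epsilon> \<subseteq> univ M ()" using as u by (auto simp: \<epsilon>_def tuples_def)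
      ultimately have "as \<in> D \<longleftrightarrow> \<epsilon> \<in> F D" "as \<in> D' \<longleftrightarrow> \<epsilon> \<in> F D'" by (auto simp: F_def)
      with eq show ?thesis by simp
    qed
    moreover have "D \<subseteq> tuples M k" "D' \<subseteq> tuples M k" using D by (auto simp: definable_def)
    ultimately show "D = D'" by blast
  qed
  moreover have "F ` {D. definable L M k D} \<subseteq> {S \<in> defsets L M. supported (univ M ()) k S}"
  proof
    fix S assume "S \<in> F ` {D. definable L M k D}"
    then obtain \<phi> where \<phi>: "wf_fm L \<phi>" "fv \<phi> \<subseteq> {((), i) | i. i < k}"
      "S = F {as \<in> tuples M k. sat M (\<lambda>(_, i). as ! i) \<phi>}"
      by (auto simp: definable_def)
    have "sat M (\<lambda>(_, i). map \<epsilon> [0..<k] ! i) \<phi> = sat M (\<lambda>v. \<epsilon> (snd v)) \<phi>" for \<epsilon>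
      by (rule sat_cong) (use \<phi>(2) in auto)
    then have "S = defset M \<phi>" by (auto simp: \<phi>(3) F_def defset_def tuples_def)
    moreover have "supported (univ M ()) k (defset M \<phi>)"
      by (rule supported_defset) (use \<phi>(2) in auto)
    ultimately show "S \<in> {S \<in> defsets L M. supported (univ M ()) k S}"
      using \<phi>(1) by (simp add: defset_in_defsets)
  qed
  ultimately show ?thesis
    using finite_defsets[OF assms(1,7) False assms(3,4) alg] by (meson finite_imageD finite_subset)
qed

section \<open>Imaginaries in an omega-categorical structure\<close>

fun arity :: "'a eq_sort \<Rightarrow> nat" where
  "arity Home_sort = 1"
| "arity (Quot k E) = k"

text \<open>Treats all sorts alike: an element is given by a home tuple of length
  \<open>arity s\<close>, the home sort counting as a sort with representatives of length 1.\<close>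

fun rep :: "'a eq_sort \<Rightarrow> 'a list \<Rightarrow> 'a eq_elem" where
  "rep Home_sort as = Home (as ! 0)"
| "rep (Quot k E) as = Imag E (E `` {as})"

text \<open>Meant for terms of home sort. Their variables are of home sort too, so
  \<open>\<rho> v\<close> has a single entry, and \<open>projl\<close> recovers the symbol of
  \<open>L\<close>.\<close>

fun home_tm :: "('a eq_sort var \<Rightarrow> nat list) \<Rightarrow> ('f + nat \<times> 'a list rel, 'a eq_sort) tm \<Rightarrow> ('f, unit) tm" where
  "home_tm \<rho> (Var v) = Var ((), \<rho> v ! 0)"
| "home_tm \<rho> (App g ts) = App (projl g) (map (home_tm \<rho>) ts)"

lemma sorts_eq_lang_iff:
  "s \<in> sorts (eq_lang L M) \<longleftrightarrow> s = Home_sort \<or> (\<exists>k E. s = Quot k E \<and> 1 \<le> k \<and> definable_equiv L M k E)"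
  by (auto simp: eq_lang_def)

lemma fsyms_eq_lang_iff:
  "g \<in> fsyms (eq_lang L M) \<longleftrightarrow>
    (\<exists>f. g = Inl f \<and> f \<in> fsyms L) \<or> (\<exists>k E. g = Inr (k, E) \<and> 1 \<le> k \<and> definable_equiv L M k E)"
  by (auto simp: eq_lang_def)

lemma eq_lang_simps [simp]:
  "rsyms (eq_lang L M) = rsyms L"
  "fdom (eq_lang L M) (Inl f) = map (\<lambda>_. Home_sort) (fdom L f)"
  "fdom (eq_lang L M) (Inr (k, E)) = replicate k Home_sort"
  "fcod (eq_lang L M) (Inl f) = Home_sort"
  "fcod (eq_lang L M) (Inr (k, E)) = Quot k E"
  "rdom (eq_lang L M) r = map (\<lambda>_. Home_sort) (rdom L r)"
  by (simp_all add: eq_lang_def)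

lemma eq_struct_simps [simp]:
  "univ (eq_struct M) Home_sort = Home ` univ M ()"
  "univ (eq_struct M) (Quot k E) = Imag E ` (tuples M k // E)"
  "fint (eq_struct M) (Inl f) as = Home (fint M f (map home_val as))"
  "fint (eq_struct M) (Inr (k, E)) as = Imag E (E `` {map home_val as})"
  "rint (eq_struct M) r as = rint M r (map home_val as)"
  by (simp_all add: eq_struct_def)

lemma univ_eq_struct: "univ (eq_struct M) s = rep s ` tuples M (arity s)"
proof (cases s)
  case Home_sort
  have "univ M () = (\<lambda>as. as ! 0) ` tuples M 1"
    by (force simp: tuples_def length_Suc_conv image_iff)
  then show ?thesis by (auto simp: Home_sort)
next
  case (Quot k E)
  then show ?thesis by (auto simp: quotient_def)
qed

text \<open>\<open>finite_definable\<close> is the form in which omega-categoricity enters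
  everything about imaginaries.\<close>

locale imaginaries =
  fixes L :: "('f, 'r, unit) lang" and M :: "('f, 'r, unit, 'a) struct"
  assumes sorts: "sorts L = {()}" and struct: "is_struct L M"
    and finite_definable: "finite {D. definable L M k D}"
begin

abbreviation Leq where "Leq \<equiv> eq_lang L M"

abbreviation Meq where "Meq \<equiv> eq_struct M"

lemma univ_ne: "univ M () \<noteq> {}"
  using struct sorts by (simp add: is_struct_def)

lemma tuples_ne: "tuples M k \<noteq> {}"
proof -
  obtain u where "u \<in> univ M ()" using univ_ne by blast
  then have "replicate k u \<in> tuples M k" by (auto simp: tuples_def)
  then show ?thesis by blast
qed

sublocale disjoint_sorts Leq Meq
proof
  show "univ Meq s \<noteq> {}" for s using tuples_ne by (simp add: univ_eq_struct)
  show "s = t" if "s \<in> sorts Leq" "t \<in> sorts Leq" "a \<in> univ Meq s" "a \<in> univ Meq t" for s t a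
  proof -
    \<comment> \<open>\<open>Imag\<close> records \<open>E\<close> but not \<open>k\<close>; the
      tuples related by \<open>E\<close> reveal their length.\<close>
    have *: "k = k'" if E: "definable_equiv L M k E" "definable_equiv L M k' E" for k k' and E :: "'a list rel"
    proof -
      obtain a where a: "a \<in> tuples M k" using tuples_ne by blast
      then have "(a, a) \<in> E" using E(1) by (auto simp: definable_equiv_def dest: equiv_class_self)
      then have "a \<in> tuples M k'" using E(2) equiv_type unfolding definable_equiv_def by blast
      with a show ?thesis by (simp add: tuples_def)
    qed
    show ?thesis using that * by (auto simp: sorts_eq_lang_iff)
  qed
qed

text \<open>Function symbols take arguments of home sort only, and projections yield quotient sorts.
  Hence no projection occurs in a term of home sort, and the term is one of \<open>L\<close> up to
  renaming its variables.\<close>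

lemma home_tm:
  assumes \<rho>: "\<And>v. v \<in> fv_tm t \<Longrightarrow> length (\<rho> v) = arity (fst v)"
    and t: "wf_tm Leq t" "sort_of Leq t = Home_sort"
  shows "wf_tm L (home_tm \<rho> t)"
    and "fv_tm (home_tm \<rho> t) \<subseteq> {((), i) | i. \<exists>v\<in>fv_tm t. i \<in> set (\<rho> v)}"
    and "val Meq (\<lambda>v. rep (fst v) (map \<epsilon> (\<rho> v))) t = Home (val M (\<lambda>v. \<epsilon> (snd v)) (home_tm \<rho> t))"
proof -
  have "wf_tm L (home_tm \<rho> t) \<and>
    fv_tm (home_tm \<rho> t) \<subseteq> {((), i) | i. \<exists>v\<in>fv_tm t. i \<in> set (\<rho> v)} \<and>
    val Meq (\<lambda>v. rep (fst v) (map \<epsilon> (\<rho> v))) t = Home (val M (\<lambda>v. \<epsilon> (snd v)) (home_tm \<rho> t))"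
    using \<rho> t
  proof (induction t)
    case (Var v)
    then have "fst v = Home_sort" "length (\<rho> v) = 1" by auto
    then show ?case using sorts by auto
  next
    case (App g ts)
    then obtain f where f: "g = Inl f" "f \<in> fsyms L"
      by (auto simp: fsyms_eq_lang_iff)
    have srt: "map (sort_of Leq) ts = map (\<lambda>_. Home_sort) (fdom L f)" using App.prems(2) f(1) by simp
    have ts: "sort_of Leq t = Home_sort" if "t \<in> set ts" for t
    proof -
      have "sort_of Leq t \<in> set (map (sort_of Leq) ts)" using that by simp
      then show ?thesis unfolding srt by auto
    qed
    have IH: "wf_tm L (home_tm \<rho> t)" "fv_tm (home_tm \<rho> t) \<subseteq> {((), i) | i. \<exists>v\<in>fv_tm t. i \<in> set (\<rho> v)}"
      "val Meq (\<lambda>v. rep (fst v) (map \<epsilon> (\<rho> v))) t = Home (val M (\<lambda>v. \<epsilon> (snd v)) (home_tm \<rho> t))"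
      if "t \<in> set ts" for t
    proof -
      have "wf_tm Leq t" "\<And>v. v \<in> fv_tm t \<Longrightarrow> length (\<rho> v) = arity (fst v)" using App.prems(1,2) that by auto
      with App.IH[OF that _ _ ts[OF that]] show "wf_tm L (home_tm \<rho> t)"
        "fv_tm (home_tm \<rho> t) \<subseteq> {((), i) | i. \<exists>v\<in>fv_tm t. i \<in> set (\<rho> v)}"
        "val Meq (\<lambda>v. rep (fst v) (map \<epsilon> (\<rho> v))) t = Home (val M (\<lambda>v. \<epsilon> (snd v)) (home_tm \<rho> t))" by blast+
    qed
    have "length ts = length (fdom L f)" using arg_cong[OF srt, of length] by simp
    then have "map (sort_of L) (map (home_tm \<rho>) ts) = fdom L f"
      by (intro nth_equalityI) auto
    then have "wf_tm L (home_tm \<rho> (App g ts))" using IH(1) f by simp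
    moreover have "fv_tm (home_tm \<rho> (App g ts)) \<subseteq> {((), i) | i. \<exists>v\<in>fv_tm (App g ts). i \<in> set (\<rho> v)}"
      using IH(2) by fastforce
    moreover have "map home_val (map (val Meq (\<lambda>v. rep (fst v) (map \<epsilon> (\<rho> v)))) ts) =
        map (val M (\<lambda>v. \<epsilon> (snd v))) (map (home_tm \<rho>) ts)"
      using IH(3) by simp
    then have "val Meq (\<lambda>v. rep (fst v) (map \<epsilon> (\<rho> v))) (App g ts) =
        Home (val M (\<lambda>v. \<epsilon> (snd v)) (home_tm \<rho> (App g ts)))"
      by (simp only: val.simps f eq_struct_simps home_tm.simps sum.sel)
    ultimately show ?case by blast
  qed
  then show "wf_tm L (home_tm \<rho> t)"
    "fv_tm (home_tm \<rho> t) \<subseteq> {((), i) | i. \<exists>v\<in>fv_tm t. i \<in> set (\<rho> v)}"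
    "val Meq (\<lambda>v. rep (fst v) (map \<epsilon> (\<rho> v))) t = Home (val M (\<lambda>v. \<epsilon> (snd v)) (home_tm \<rho> t))"
    by blast+
qed

text \<open>A term of quotient sort is a variable, represented by its tuple of home variables, or a
  projection at the root, represented by the tuple of its arguments.\<close>

lemma term_reps:
  assumes \<rho>: "\<And>v. v \<in> fv_tm t \<Longrightarrow> length (\<rho> v) = arity (fst v)" and t: "wf_tm Leq t"
  shows "\<exists>us. length us = arity (sort_of Leq t) \<and>
    (\<forall>u\<in>set us. wf_tm L u \<and> fv_tm u \<subseteq> {((), i) | i. \<exists>v\<in>fv_tm t. i \<in> set (\<rho> v)}) \<and>
    (\<forall>\<epsilon>. val Meq (\<lambda>v. rep (fst v) (map \<epsilon> (\<rho> v))) t =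
      rep (sort_of Leq t) (map (val M (\<lambda>v. \<epsilon> (snd v))) us))"
proof (cases "sort_of Leq t = Home_sort")
  case True
  then show ?thesis using home_tm[OF \<rho> t True]
    by (intro exI[of _ "[home_tm \<rho> t]"]) simp
next
  case False
  show ?thesis
  proof (cases t)
    case (Var v)
    have "map (val M (\<lambda>v. \<epsilon> (snd v))) (map (\<lambda>i. Var ((), i)) (\<rho> v)) = map \<epsilon> (\<rho> v)" for \<epsilon>
      by simp
    then show ?thesis using \<rho> sorts Var
      by (intro exI[of _ "map (\<lambda>i. Var ((), i)) (\<rho> v)"]) (auto simp: o_def)
  next
    case (App g ts)
    then obtain k E where g: "g = Inr (k, E)" using t False by (auto simp: fsyms_eq_lang_iff)
    have srt: "map (sort_of Leq) ts = replicate k Home_sort" using t App g by simp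
    have ts: "sort_of Leq t' = Home_sort" if "t' \<in> set ts" for t'
    proof -
      have "sort_of Leq t' \<in> set (map (sort_of Leq) ts)" using that by simp
      then show ?thesis unfolding srt by simp
    qed
    have IH: "wf_tm L (home_tm \<rho> t')" "fv_tm (home_tm \<rho> t') \<subseteq> {((), i) | i. \<exists>v\<in>fv_tm t'. i \<in> set (\<rho> v)}"
      "val Meq (\<lambda>v. rep (fst v) (map \<epsilon> (\<rho> v))) t' = Home (val M (\<lambda>v. \<epsilon> (snd v)) (home_tm \<rho> t'))"
      if "t' \<in> set ts" for t' \<epsilon>
    proof -
      have "\<And>v. v \<in> fv_tm t' \<Longrightarrow> length (\<rho> v) = arity (fst v)" "wf_tm Leq t'" using \<rho> t App that by auto
      from home_tm[OF this ts[OF that]] show "wf_tm L (home_tm \<rho> t')"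
        "fv_tm (home_tm \<rho> t') \<subseteq> {((), i) | i. \<exists>v\<in>fv_tm t'. i \<in> set (\<rho> v)}"
        "val Meq (\<lambda>v. rep (fst v) (map \<epsilon> (\<rho> v))) t' = Home (val M (\<lambda>v. \<epsilon> (snd v)) (home_tm \<rho> t'))" by blast+
    qed
    have "map home_val (map (val Meq (\<lambda>v. rep (fst v) (map \<epsilon> (\<rho> v)))) ts) =
        map (val M (\<lambda>v. \<epsilon> (snd v))) (map (home_tm \<rho>) ts)" for \<epsilon>
      using IH(3) by simp
    then have "val Meq (\<lambda>v. rep (fst v) (map \<epsilon> (\<rho> v))) t =
        rep (sort_of Leq t) (map (val M (\<lambda>v. \<epsilon> (snd v))) (map (home_tm \<rho>) ts))" for \<epsilon>
      by (simp only: val.simps App g eq_struct_simps rep.simps sort_of.simps eq_lang_simps)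
    moreover have "length ts = k" using arg_cong[OF srt, of length] by simp
    moreover have "fv_tm u \<subseteq> {((), i) | i. \<exists>v\<in>fv_tm t. i \<in> set (\<rho> v)}" if "u \<in> set (map (home_tm \<rho>) ts)" for u
      using that IH(2) App by fastforce
    moreover have "wf_tm L u" if "u \<in> set (map (home_tm \<rho>) ts)" for u
      using that IH(1) by auto
    moreover have "arity (sort_of Leq t) = k" using App g by simp
    ultimately show ?thesis by (intro exI[of _ "map (home_tm \<rho>) ts"] conjI ballI allI) (simp_all del: map_map)
  qed
qed

text \<open>Two classes are equal iff their representatives are related, so the formula is the
  definition of \<open>E\<close> with the given terms substituted.\<close>

lemma quotient_equality:
  assumes E: "definable_equiv L M k E" and us: "length us = k" "length us' = k"
    "\<And>u. u \<in> set us \<union> set us' \<Longrightarrow> wf_tm L u \<and> fv_tm u \<subseteq> V"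
  shows "\<exists>\<chi>. wf_fm L \<chi> \<and> fv \<chi> \<subseteq> V \<and> (\<forall>\<epsilon>. range \<epsilon> \<subseteq> univ M () \<longrightarrow>
    sat M (\<lambda>v. \<epsilon> (snd v)) \<chi> =
      (rep (Quot k E) (map (val M (\<lambda>v. \<epsilon> (snd v))) us) = rep (Quot k E) (map (val M (\<lambda>v. \<epsilon> (snd v))) us')))"
proof -
  obtain \<sigma> where \<sigma>: "wf_fm L \<sigma>" "fv \<sigma> \<subseteq> {((), i) | i. i < 2 * k}"
    "{as @ bs | as bs. (as, bs) \<in> E} = {as \<in> tuples M (2 * k). sat M (\<lambda>(_, i). as ! i) \<sigma>}"
    using E unfolding definable_equiv_def definable_def by blast
  have eqv: "equiv (tuples M k) E" using E by (simp add: definable_equiv_def)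
  define g where "g v = (us @ us') ! snd v" for v :: "unit var"
  have g: "g v \<in> set us \<union> set us'" if v: "v \<in> fv \<sigma>" for v
  proof -
    have "snd v < length (us @ us')" using \<sigma>(2) v us by auto
    then show ?thesis unfolding g_def by (metis nth_mem set_append)
  qed
  have "wf_tm L (g v) \<and> sort_of L (g v) = fst v" if "v \<in> fv \<sigma>" for v
    using us(3)[OF g[OF that]] by simp
  from substitution[OF \<sigma>(1) this, where M = M] obtain \<chi> where \<chi>: "wf_fm L \<chi>"
    "fv \<chi> \<subseteq> (\<Union>v\<in>fv \<sigma>. fv_tm (g v))" "\<forall>e. sat M e \<chi> \<longleftrightarrow> sat M (\<lambda>v. val M e (g v)) \<sigma>" by blast
  have "fv \<chi> \<subseteq> V" using \<chi>(2) us(3) g by blast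
  moreover have "sat M (\<lambda>v. \<epsilon> (snd v)) \<chi> = (rep (Quot k E) (map (val M (\<lambda>v. \<epsilon> (snd v))) us) =
      rep (Quot k E) (map (val M (\<lambda>v. \<epsilon> (snd v))) us'))" (is "_ = (rep _ ?as = rep _ ?bs)")
    if \<epsilon>: "range \<epsilon> \<subseteq> univ M ()" for \<epsilon>
  proof -
    have "val M (\<lambda>v. \<epsilon> (snd v)) u \<in> univ M ()" if "u \<in> set us \<union> set us'" for u
      using val_in_univ[OF struct, of u "\<lambda>v. \<epsilon> (snd v)"] us(3)[OF that] \<epsilon> by auto
    then have t: "?as \<in> tuples M k" "?bs \<in> tuples M k" using us(1,2) by (auto simp: tuples_def)
    have "sat M (\<lambda>v. \<epsilon> (snd v)) \<chi> \<longleftrightarrow> sat M (\<lambda>v. val M (\<lambda>v. \<epsilon> (snd v)) (g v)) \<sigma>" using \<chi>(3) by blast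
    also have "\<dots> \<longleftrightarrow> sat M (\<lambda>(_, i). (?as @ ?bs) ! i) \<sigma>"
    proof (rule sat_cong)
      fix v assume "v \<in> fv \<sigma>"
      then obtain i where i: "v = ((), i)" "i < length (us @ us')" using \<sigma>(2) us by auto
      have "(?as @ ?bs) ! i = map (val M (\<lambda>v. \<epsilon> (snd v))) (us @ us') ! i" by simp
      also have "\<dots> = val M (\<lambda>v. \<epsilon> (snd v)) ((us @ us') ! i)" by (rule nth_map[OF i(2)])
      finally show "val M (\<lambda>v. \<epsilon> (snd v)) (g v) = (case v of (_, i) \<Rightarrow> (?as @ ?bs) ! i)"
        by (simp add: g_def i(1))
    qed
    also have "\<dots> \<longleftrightarrow> ?as @ ?bs \<in> {as \<in> tuples M (2 * k). sat M (\<lambda>(_, i). as ! i) \<sigma>}"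
      using t by (auto simp: tuples_def)
    also have "\<dots> \<longleftrightarrow> (?as, ?bs) \<in> E"
    proof -
      \<comment> \<open>A pair is coded by concatenation; the length \<open>k\<close> of its first
        half makes the decoding unique.\<close>
      have "(?as, ?bs) \<in> E" if "?as @ ?bs = as @ bs" "(as, bs) \<in> E" for as bs
      proof -
        have "as \<in> tuples M k" using equiv_type[OF eqv] that(2) by blast
        then have "length as = length ?as" using t(1) by (simp only: tuples_def mem_Collect_eq)
        then show ?thesis using that by (metis append_eq_append_conv)
      qed
      then show ?thesis unfolding \<sigma>(3)[symmetric] by blast
    qed
    also have "\<dots> \<longleftrightarrow> rep (Quot k E) ?as = rep (Quot k E) ?bs"
      using eq_equiv_class_iff[OF eqv t] by simp
    finally show ?thesis .
  qed
  ultimately show ?thesis using \<chi>(1) by blast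
qed

text \<open>
  \<open>\<rho>\<close> assigns to each variable of a quotient sort the home variables that range over
  representatives.
\<close>

lemma eq_translation:
  assumes "wf_fm Leq \<phi>" "\<And>v. v \<in> fv \<phi> \<Longrightarrow> length (\<rho> v) = arity (fst v)"
  shows "\<exists>\<chi>. wf_fm L \<chi> \<and> fv \<chi> \<subseteq> {((), i) | i. \<exists>v\<in>fv \<phi>. i \<in> set (\<rho> v)} \<and>
    (\<forall>\<epsilon>. range \<epsilon> \<subseteq> univ M () \<longrightarrow>
      sat M (\<lambda>v. \<epsilon> (snd v)) \<chi> = sat Meq (\<lambda>v. rep (fst v) (map \<epsilon> (\<rho> v))) \<phi>)"
  using assms
proof (induction \<phi> arbitrary: \<rho>)
  case (FEq t u)
  have wf: "wf_tm Leq t" "wf_tm Leq u" and srt: "sort_of Leq u = sort_of Leq t" using FEq.prems(1) by auto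
  have len: "\<And>v. v \<in> fv_tm t \<Longrightarrow> length (\<rho> v) = arity (fst v)" "\<And>v. v \<in> fv_tm u \<Longrightarrow> length (\<rho> v) = arity (fst v)"
    using FEq.prems(2) by auto
  show ?case
  proof (cases "sort_of Leq t")
    case Home_sort
    then have "sort_of Leq u = Home_sort" using srt by simp
    note hu = home_tm[OF len(2) wf(2) this]
    note ht = home_tm[OF len(1) wf(1) Home_sort]
    have "fv (FEq (home_tm \<rho> t) (home_tm \<rho> u)) \<subseteq> {((), i) | i. \<exists>v\<in>fv (FEq t u). i \<in> set (\<rho> v)}"
      unfolding fv.simps using hu(2) ht(2) by blast
    moreover have "wf_fm L (FEq (home_tm \<rho> t) (home_tm \<rho> u))" using hu(1) ht(1) by simp
    moreover have "sat M (\<lambda>v. \<epsilon> (snd v)) (FEq (home_tm \<rho> t) (home_tm \<rho> u)) =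
        sat Meq (\<lambda>v. rep (fst v) (map \<epsilon> (\<rho> v))) (FEq t u)" for \<epsilon>
      by (simp only: sat.simps ht(3) hu(3) eq_elem.inject)
    ultimately show ?thesis by blast
  next
    case (Quot k E)
    have "sort_of Leq t \<in> sorts Leq"
      using wf(1) by (cases t) (auto simp: fsyms_eq_lang_iff sorts_eq_lang_iff)
    then have E: "definable_equiv L M k E" using Quot by (auto simp: sorts_eq_lang_iff)
    define V where "V = {((), i) | i. \<exists>v\<in>fv_tm t \<union> fv_tm u. i \<in> set (\<rho> v)}"
    obtain us where us: "length us = k"
      "\<And>w. w \<in> set us \<Longrightarrow> wf_tm L w \<and> fv_tm w \<subseteq> {((), i) | i. \<exists>v\<in>fv_tm t. i \<in> set (\<rho> v)}"
      "\<And>\<epsilon>. val Meq (\<lambda>v. rep (fst v) (map \<epsilon> (\<rho> v))) t = rep (Quot k E) (map (val M (\<lambda>v. \<epsilon> (snd v))) us)"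
      using term_reps[where \<rho> = \<rho>, OF len(1) wf(1)] Quot by auto
    obtain us' where us': "length us' = k"
      "\<And>w. w \<in> set us' \<Longrightarrow> wf_tm L w \<and> fv_tm w \<subseteq> {((), i) | i. \<exists>v\<in>fv_tm u. i \<in> set (\<rho> v)}"
      "\<And>\<epsilon>. val Meq (\<lambda>v. rep (fst v) (map \<epsilon> (\<rho> v))) u = rep (Quot k E) (map (val M (\<lambda>v. \<epsilon> (snd v))) us')"
      using term_reps[where \<rho> = \<rho>, OF len(2) wf(2)] Quot srt by auto
    have us_V: "wf_tm L w \<and> fv_tm w \<subseteq> V" if "w \<in> set us \<union> set us'" for w
      using that us(2)[of w] us'(2)[of w] by (auto simp: V_def)
    show ?thesis unfolding sat.simps fv.simps us(3) us'(3) V_def[symmetric]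
      by (rule quotient_equality[OF E us(1) us'(1)]) (rule us_V)
  qed
next
  case (FRel r ts)
  have srt: "map (sort_of Leq) ts = map (\<lambda>_. Home_sort) (rdom L r)" using FRel.prems(1) by simp
  have ts: "sort_of Leq t = Home_sort" if "t \<in> set ts" for t
  proof -
    have "sort_of Leq t \<in> set (map (sort_of Leq) ts)" using that by simp
    then show ?thesis unfolding srt by auto
  qed
  have IH: "wf_tm L (home_tm \<rho> t)" "fv_tm (home_tm \<rho> t) \<subseteq> {((), i) | i. \<exists>v\<in>fv_tm t. i \<in> set (\<rho> v)}"
    "val Meq (\<lambda>v. rep (fst v) (map \<epsilon> (\<rho> v))) t = Home (val M (\<lambda>v. \<epsilon> (snd v)) (home_tm \<rho> t))"
    if "t \<in> set ts" for t \<epsilon>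
  proof -
    have "\<And>v. v \<in> fv_tm t \<Longrightarrow> length (\<rho> v) = arity (fst v)" "wf_tm Leq t" using FRel.prems that by auto
    from home_tm[OF this ts[OF that]] show "wf_tm L (home_tm \<rho> t)"
      "fv_tm (home_tm \<rho> t) \<subseteq> {((), i) | i. \<exists>v\<in>fv_tm t. i \<in> set (\<rho> v)}"
      "val Meq (\<lambda>v. rep (fst v) (map \<epsilon> (\<rho> v))) t = Home (val M (\<lambda>v. \<epsilon> (snd v)) (home_tm \<rho> t))" by blast+
  qed
  have vals: "map home_val (map (val Meq (\<lambda>v. rep (fst v) (map \<epsilon> (\<rho> v)))) ts) =
      map (val M (\<lambda>v. \<epsilon> (snd v))) (map (home_tm \<rho>) ts)" for \<epsilon>
    using IH(3) by simp
  have "length ts = length (rdom L r)" using arg_cong[OF srt, of length] by simp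
  then have "map (sort_of L) (map (home_tm \<rho>) ts) = rdom L r"
    by (intro nth_equalityI) auto
  then have "wf_fm L (FRel r (map (home_tm \<rho>) ts))" using IH(1) FRel.prems(1) by simp
  moreover have "fv (FRel r (map (home_tm \<rho>) ts)) \<subseteq> {((), i) | i. \<exists>v\<in>fv (FRel r ts). i \<in> set (\<rho> v)}"
    using IH(2) by fastforce
  moreover have "sat M (\<lambda>v. \<epsilon> (snd v)) (FRel r (map (home_tm \<rho>) ts)) =
      sat Meq (\<lambda>v. rep (fst v) (map \<epsilon> (\<rho> v))) (FRel r ts)" for \<epsilon>
    by (simp only: sat.simps eq_struct_simps vals)
  ultimately show ?case by blast
next
  case (FNeg \<phi>)
  obtain \<chi> where "wf_fm L \<chi>" "fv \<chi> \<subseteq> {((), i) | i. \<exists>v\<in>fv \<phi>. i \<in> set (\<rho> v)}"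
    "\<forall>\<epsilon>. range \<epsilon> \<subseteq> univ M () \<longrightarrow>
      sat M (\<lambda>v. \<epsilon> (snd v)) \<chi> = sat Meq (\<lambda>v. rep (fst v) (map \<epsilon> (\<rho> v))) \<phi>"
    using FNeg.IH[of \<rho>] FNeg.prems by auto
  then show ?case by (intro exI[of _ "FNeg \<chi>"]) auto
next
  case (FConj \<phi>1 \<phi>2)
  obtain \<chi>1 where c1: "wf_fm L \<chi>1" "fv \<chi>1 \<subseteq> {((), i) | i. \<exists>v\<in>fv \<phi>1. i \<in> set (\<rho> v)}"
    "\<forall>\<epsilon>. range \<epsilon> \<subseteq> univ M () \<longrightarrow>
      sat M (\<lambda>v. \<epsilon> (snd v)) \<chi>1 = sat Meq (\<lambda>v. rep (fst v) (map \<epsilon> (\<rho> v))) \<phi>1"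
    using FConj.IH(1)[of \<rho>] FConj.prems by auto
  obtain \<chi>2 where c2: "wf_fm L \<chi>2" "fv \<chi>2 \<subseteq> {((), i) | i. \<exists>v\<in>fv \<phi>2. i \<in> set (\<rho> v)}"
    "\<forall>\<epsilon>. range \<epsilon> \<subseteq> univ M () \<longrightarrow>
      sat M (\<lambda>v. \<epsilon> (snd v)) \<chi>2 = sat Meq (\<lambda>v. rep (fst v) (map \<epsilon> (\<rho> v))) \<phi>2"
    using FConj.IH(2)[of \<rho>] FConj.prems by auto
  have "fv (FConj \<chi>1 \<chi>2) \<subseteq> {((), i) | i. \<exists>v\<in>fv (FConj \<phi>1 \<phi>2). i \<in> set (\<rho> v)}"
    unfolding fv.simps using c1(2) c2(2) by blast
  then show ?case using c1(1,3) c2(1,3)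
    by (intro exI[of _ "FConj \<chi>1 \<chi>2"] conjI) simp_all
next
  case (FEx x \<phi>)
  define n where "n = arity (fst x)"
  have "finite (\<Union>v\<in>fv \<phi>. set (\<rho> v))" by (simp add: finite_fv)
  then obtain N where N: "\<And>i v. v \<in> fv \<phi> \<Longrightarrow> i \<in> set (\<rho> v) \<Longrightarrow> i < N"
    unfolding finite_nat_set_iff_bounded by blast
  \<comment> \<open>The bound variable is represented by as many fresh home variables as its sort
    has arity, and its quantifier becomes a block of home quantifiers.\<close>
  define \<rho>' where "\<rho>' = \<rho>(x := [N..<N + n])"
  have "wf_fm Leq \<phi>" using FEx.prems by simp
  moreover have "length (\<rho>' v) = arity (fst v)" if "v \<in> fv \<phi>" for v
    using FEx.prems(2)[of v] that by (auto simp: \<rho>'_def n_def)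
  ultimately obtain \<chi> where \<chi>: "wf_fm L \<chi>" "fv \<chi> \<subseteq> {((), i) | i. \<exists>v\<in>fv \<phi>. i \<in> set (\<rho>' v)}"
    "\<And>\<epsilon>. range \<epsilon> \<subseteq> univ M () \<Longrightarrow>
      sat M (\<lambda>v. \<epsilon> (snd v)) \<chi> = sat Meq (\<lambda>v. rep (fst v) (map \<epsilon> (\<rho>' v))) \<phi>"
    using FEx.IH[of \<rho>'] by blast
  define ys where "ys = map (\<lambda>i. ((), i)) [N..<N + n]"
  have ys: "distinct ys" "length ys = n" by (auto simp: ys_def distinct_map inj_on_def)
  obtain \<psi> where \<psi>: "wf_fm L \<psi>" "fv \<psi> \<subseteq> fv \<chi> - set ys"
    "\<And>e. sat M e \<psi> \<longleftrightarrow> (\<exists>as\<in>insts M ys. sat M (assign e ys as) \<chi>)"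
    using exists_block[OF \<chi>(1) ys(1), of M] sorts by auto
  have insts: "insts M ys = tuples M n"
    using ys by (auto simp: insts_def tuples_def list_all2_conv_all_nth in_set_conv_nth subset_iff)
  have sat_as: "sat M (assign (\<lambda>v. \<epsilon> (snd v)) ys as) \<chi> \<longleftrightarrow>
      sat Meq ((\<lambda>v. rep (fst v) (map \<epsilon> (\<rho> v)))(x := rep (fst x) as)) \<phi>"
    if \<epsilon>: "range \<epsilon> \<subseteq> univ M ()" and as: "as \<in> tuples M n" for \<epsilon> as
  proof -
    define \<epsilon>' where "\<epsilon>' i = (if N \<le> i \<and> i < N + n then as ! (i - N) else \<epsilon> i)" for i
    have len: "length as = n" using as by (simp add: tuples_def)
    have \<epsilon>': "range \<epsilon>' \<subseteq> univ M ()" using \<epsilon> as by (auto simp: \<epsilon>'_def tuples_def)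
    have "assign (\<lambda>v. \<epsilon> (snd v)) ys as v = \<epsilon>' (snd v)" for v
    proof (cases "v \<in> set ys")
      case True
      then have "v = ys ! (snd v - N)" "snd v - N < n" "N \<le> snd v" "snd v < N + n" by (auto simp: ys_def)
      then show ?thesis using assign_nth[OF ys(1), of as "snd v - N"] len ys(2) by (simp add: \<epsilon>'_def)
    next
      case False
      then have "\<not> (N \<le> snd v \<and> snd v < N + n)" by (cases v) (auto simp: ys_def)
      then have "\<epsilon>' (snd v) = \<epsilon> (snd v)" unfolding \<epsilon>'_def by (rule if_not_P)
      then show ?thesis by (simp only: assign_notin[OF False])
    qed
    then have "sat M (assign (\<lambda>v. \<epsilon> (snd v)) ys as) \<chi> \<longleftrightarrow> sat M (\<lambda>v. \<epsilon>' (snd v)) \<chi>"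
      by (intro sat_cong)
    also have "\<dots> \<longleftrightarrow> sat Meq (\<lambda>v. rep (fst v) (map \<epsilon>' (\<rho>' v))) \<phi>" by (rule \<chi>(3)[OF \<epsilon>'])
    also have "\<dots> \<longleftrightarrow> sat Meq ((\<lambda>v. rep (fst v) (map \<epsilon> (\<rho> v)))(x := rep (fst x) as)) \<phi>"
    proof (rule sat_cong)
      fix v assume v: "v \<in> fv \<phi>"
      show "rep (fst v) (map \<epsilon>' (\<rho>' v)) = ((\<lambda>v. rep (fst v) (map \<epsilon> (\<rho> v)))(x := rep (fst x) as)) v"
      proof (cases "v = x")
        case True
        have "map \<epsilon>' [N..<N + n] = as"
          by (rule nth_equalityI) (auto simp: len \<epsilon>'_def)
        then show ?thesis by (simp add: True \<rho>'_def)
      next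
        case False
        have "\<epsilon>' i = \<epsilon> i" if "i \<in> set (\<rho> v)" for i
          using N[OF v that] by (simp add: \<epsilon>'_def)
        then have "map \<epsilon>' (\<rho> v) = map \<epsilon> (\<rho> v)" by simp
        moreover have "\<rho>' v = \<rho> v" by (simp add: False \<rho>'_def)
        ultimately show ?thesis by (simp only: fun_upd_other[OF False])
      qed
    qed
    finally show ?thesis .
  qed
  have "fv \<psi> \<subseteq> {((), i) | i. \<exists>v\<in>fv (FEx x \<phi>). i \<in> set (\<rho> v)}"
  proof
    fix w assume w: "w \<in> fv \<psi>"
    then obtain i v where v: "w = ((), i)" "v \<in> fv \<phi>" "i \<in> set (\<rho>' v)" using \<psi>(2) \<chi>(2) by blast
    have "v \<noteq> x"
    proof
      assume "v = x"
      then have "w \<in> set ys" using v by (auto simp: \<rho>'_def ys_def)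
      with w \<psi>(2) show False by blast
    qed
    with v show "w \<in> {((), i) | i. \<exists>v\<in>fv (FEx x \<phi>). i \<in> set (\<rho> v)}" by (auto simp: \<rho>'_def)
  qed
  moreover have "sat M (\<lambda>v. \<epsilon> (snd v)) \<psi> = sat Meq (\<lambda>v. rep (fst v) (map \<epsilon> (\<rho> v))) (FEx x \<phi>)"
    if "range \<epsilon> \<subseteq> univ M ()" for \<epsilon>
    using sat_as[OF that] by (simp add: \<psi>(3) insts univ_eq_struct n_def del: fun_upd_apply)
  ultimately show ?case using \<psi>(1) by blast
qed

end

context imaginaries
begin

section \<open>Uniform finiteness of algebraic closure\<close>

text \<open>The element variable of sort \<open>s\<close> is \<open>(s, 0)\<close>; the parameters are home variables \<open>Suc i\<close>.\<close>

definition param_env :: "'a eq_sort \<Rightarrow> 'a eq_elem \<Rightarrow> 'a list \<Rightarrow> 'a eq_sort var \<Rightarrow> 'a eq_elem" where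
  "param_env s b r = (\<lambda>v. if v = (s, 0) then b else Home (r ! (snd v - 1)))"

definition param_vars :: "'a eq_sort \<Rightarrow> nat \<Rightarrow> 'a eq_sort var set" where
  "param_vars s l = insert (s, 0) {(Home_sort, Suc i) | i. i < l}"

definition param_rel :: "'a eq_sort \<Rightarrow> nat \<Rightarrow> ('f + nat \<times> 'a list rel, 'r, 'a eq_sort) fm \<Rightarrow>
    ('a eq_elem \<times> 'a list) set" where
  "param_rel s l \<phi> = {(b, r). b \<in> univ Meq s \<and> r \<in> tuples M l \<and> sat Meq (param_env s b r) \<phi>}"

definition param_rels :: "'a eq_sort \<Rightarrow> nat \<Rightarrow> ('a eq_elem \<times> 'a list) set set" where
  "param_rels s l = param_rel s l ` {\<phi>. wf_fm Leq \<phi> \<and> fv \<phi> \<subseteq> param_vars s l}"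

text \<open>Every such relation is the image, under one fixed map \<open>F\<close>, of a definable
  set of home tuples that list a representative of the element and then the parameters.\<close>

lemma finite_param_rels: "finite (param_rels s l)"
proof -
  define n where "n = arity s"
  define F where "F D = (\<lambda>t. (rep s (take n t), drop n t)) ` D" for D :: "'a list set"
  obtain u where u: "u \<in> univ M ()" using univ_ne by blast
  have "param_rels s l \<subseteq> F ` {D. definable L M (n + l) D}"
  proof
    fix G assume "G \<in> param_rels s l"
    then obtain \<phi> where \<phi>: "wf_fm Leq \<phi>" "fv \<phi> \<subseteq> param_vars s l" "G = param_rel s l \<phi>"
      by (auto simp: param_rels_def)
    \<comment> \<open>The representative occupies the home variables below \<open>n\<close>; the
      parameter variable with index \<open>Suc i\<close> goes to \<open>n + i\<close>.\<close>
    define \<rho> where "\<rho> v = (if v = (s, 0) then [0..<n] else [n + (snd v - 1)])" for v :: "'a eq_sort var"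
    have "length (\<rho> v) = arity (fst v)" if "v \<in> fv \<phi>" for v
      using that \<phi>(2) by (auto simp: \<rho>_def n_def param_vars_def)
    from eq_translation[OF \<phi>(1) this] obtain \<chi> where \<chi>: "wf_fm L \<chi>"
      "fv \<chi> \<subseteq> {((), i) | i. \<exists>v\<in>fv \<phi>. i \<in> set (\<rho> v)}"
      "\<And>\<epsilon>. range \<epsilon> \<subseteq> univ M () \<Longrightarrow>
        sat M (\<lambda>v. \<epsilon> (snd v)) \<chi> = sat Meq (\<lambda>v. rep (fst v) (map \<epsilon> (\<rho> v))) \<phi>" by blast
    have "i < n + l" if v: "v \<in> fv \<phi>" "i \<in> set (\<rho> v)" for v i
      using v \<phi>(2) by (auto simp: \<rho>_def param_vars_def split: if_splits)
    then have fv_\<chi>: "fv \<chi> \<subseteq> {((), i) | i. i < n + l}" using \<chi>(2) by blast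
    define D where "D = {t \<in> tuples M (n + l). sat M (\<lambda>(_, i). t ! i) \<chi>}"
    have "definable L M (n + l) D" unfolding definable_def D_def using \<chi>(1) fv_\<chi> by blast
    moreover have D_iff: "as @ r \<in> D \<longleftrightarrow> (rep s as, r) \<in> G" if t: "as \<in> tuples M n" "r \<in> tuples M l" for as r
    proof -
      define \<epsilon> where "\<epsilon> i = (if i < n + l then (as @ r) ! i else u)" for i
      have len: "length as = n" "length r = l" using t by (auto simp: tuples_def)
      have tup: "as @ r \<in> tuples M (n + l)" using t by (auto simp: tuples_def)
      have "\<epsilon> i \<in> univ M ()" for i
      proof (cases "i < n + l")
        case True
        then have "(as @ r) ! i \<in> set (as @ r)" by (intro nth_mem) (simp add: len)
        then show ?thesis using t True by (auto simp: \<epsilon>_def tuples_def)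
      qed (simp add: \<epsilon>_def u)
      then have \<epsilon>: "range \<epsilon> \<subseteq> univ M ()" by blast
      have "sat M (\<lambda>(_, i). (as @ r) ! i) \<chi> \<longleftrightarrow> sat M (\<lambda>v. \<epsilon> (snd v)) \<chi>"
        by (rule sat_cong) (use fv_\<chi> in \<open>auto simp: \<epsilon>_def\<close>)
      also have "\<dots> \<longleftrightarrow> sat Meq (\<lambda>v. rep (fst v) (map \<epsilon> (\<rho> v))) \<phi>" by (rule \<chi>(3)[OF \<epsilon>])
      also have "\<dots> \<longleftrightarrow> sat Meq (param_env s (rep s as) r) \<phi>"
      proof (rule sat_cong)
        fix v assume v: "v \<in> fv \<phi>"
        show "rep (fst v) (map \<epsilon> (\<rho> v)) = param_env s (rep s as) r v"
        proof (cases "v = (s, 0)")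
          case True
          have "map \<epsilon> [0..<n] = as" by (rule nth_equalityI) (auto simp: len \<epsilon>_def nth_append)
          then show ?thesis by (simp add: True \<rho>_def param_env_def)
        next
          case False
          then obtain i where "v = (Home_sort, Suc i)" "i < l" using v \<phi>(2) by (auto simp: param_vars_def)
          then show ?thesis using False by (auto simp: \<rho>_def param_env_def \<epsilon>_def nth_append len)
        qed
      qed
      finally show ?thesis using tup t by (auto simp: D_def \<phi>(3) param_rel_def univ_eq_struct n_def)
    qed
    have "G = F D"
    proof (intro subset_antisym subsetI)
      fix p assume p: "p \<in> G"
      then obtain as r where p_eq: "p = (rep s as, r)" "as \<in> tuples M n" "r \<in> tuples M l"
        by (auto simp: \<phi>(3) param_rel_def univ_eq_struct n_def)
      then have "as @ r \<in> D" using p D_iff by blast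
      moreover have "p = (rep s (take n (as @ r)), drop n (as @ r))" using p_eq by (simp add: tuples_def)
      ultimately show "p \<in> F D" unfolding F_def by (rule rev_image_eqI)
    next
      fix p assume "p \<in> F D"
      then obtain t where t: "t \<in> D" "p = (rep s (take n t), drop n t)" by (auto simp: F_def)
      then have "take n t \<in> tuples M n" "drop n t \<in> tuples M l"
        by (auto simp: D_def tuples_def dest: in_set_takeD in_set_dropD)
      from D_iff[OF this] t show "p \<in> G" by simp
    qed
    then show "G \<in> F ` {D. definable L M (n + l) D}" using calculation by blast
  qed
  then show ?thesis using finite_definable[of "n + l"] finite_surj by blast
qed

text \<open>For fixed \<open>G\<close>, let \<open>A j\<close> consist of the parameters whose fibre
  has at most \<open>j\<close> elements. Saying so is a formula without the element variable, so
  \<open>A j\<close> is the projection of a member of the finite set \<open>param_rels s l\<close>.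
  Thus only finitely many \<open>A j\<close> are distinct, which bounds the finite fibres of
  \<open>G\<close>; a maximum over the finitely many \<open>G\<close> concludes.\<close>

lemma finite_fibres_bounded:
  assumes s: "s \<in> sorts Leq"
  shows "\<exists>J. \<forall>G\<in>param_rels s l. \<forall>r. finite {b. (b, r) \<in> G} \<longrightarrow> card {b. (b, r) \<in> G} \<le> J"
proof -
  have "\<exists>J. \<forall>r. finite {b. (b, r) \<in> G} \<longrightarrow> card {b. (b, r) \<in> G} \<le> J" if G: "G \<in> param_rels s l" for G
  proof -
    obtain \<phi> where \<phi>: "wf_fm Leq \<phi>" "fv \<phi> \<subseteq> param_vars s l" "G = param_rel s l \<phi>"
      using G by (auto simp: param_rels_def)
    define A where "A j = {r \<in> tuples M l. finite {b. (b, r) \<in> G} \<and> card {b. (b, r) \<in> G} \<le> j}" for j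
    have "A j \<in> (\<lambda>G. snd ` G) ` param_rels s l" for j
    proof -
      have "fst (s, 0::nat) \<in> sorts Leq" "univ Meq (fst (s, 0::nat)) \<noteq> {}" using s univ_nonempty by auto
      from at_most[OF \<phi>(1) this, of j] obtain \<theta> where \<theta>: "wf_fm Leq \<theta>" "fv \<theta> \<subseteq> fv \<phi> - {(s, 0)}"
        "\<And>e. sat Meq e \<theta> \<longleftrightarrow> finite {b \<in> univ Meq s. sat Meq (e((s, 0) := b)) \<phi>} \<and>
          card {b \<in> univ Meq s. sat Meq (e((s, 0) := b)) \<phi>} \<le> j"
        unfolding fst_conv by blast
      have upd: "(param_env s b r)((s, 0) := b') = param_env s b' r" for b b' r
        by (rule ext) (auto simp: param_env_def)
      have fibre: "{b' \<in> univ Meq s. sat Meq (param_env s b' r) \<phi>} = {b. (b, r) \<in> G}"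
        if "r \<in> tuples M l" for r
        using that by (auto simp: \<phi>(3) param_rel_def)
      have "sat Meq (param_env s b r) \<theta> \<longleftrightarrow> r \<in> A j" if "r \<in> tuples M l" for b r
        unfolding \<theta>(3) upd fibre[OF that] A_def using that by blast
      then have "param_rel s l \<theta> = univ Meq s \<times> A j"
        by (auto simp: param_rel_def A_def)
      moreover have "snd ` (univ Meq s \<times> A j) = A j" using univ_nonempty[OF s] by simp
      moreover have "param_rel s l \<theta> \<in> param_rels s l"
        unfolding param_rels_def using \<theta>(1,2) \<phi>(2) by blast
      ultimately show ?thesis by (intro image_eqI[of _ _ "param_rel s l \<theta>"]) simp_all
    qed
    then have "range A \<subseteq> (\<lambda>G. snd ` G) ` param_rels s l" by blast
    then have "finite (range A)" by (rule finite_subset) (rule finite_imageI[OF finite_param_rels])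
    \<comment> \<open>Finitely many indices already produce every \<open>A j\<close>, so the largest
      of them bounds each finite fibre.\<close>
    then obtain I where I: "finite I" "range A = A ` I" 
      using finite_subset_image[of "range A" A UNIV] by blast
    obtain J where J: "\<forall>i\<in>I. i \<le> J" using I(1) finite_nat_set_iff_bounded_le by blast
    have "card {b. (b, r) \<in> G} \<le> J" if fin: "finite {b. (b, r) \<in> G}" for r
    proof (cases "{b. (b, r) \<in> G} = {}")
      case False
      then have "r \<in> tuples M l" by (auto simp: \<phi>(3) param_rel_def)
      then have "r \<in> A (card {b. (b, r) \<in> G})" using fin by (simp add: A_def)
      then obtain i where "i \<in> I" "r \<in> A i" using I(2) by (metis imageE rangeI)
      then show ?thesis using J by (auto simp: A_def)
    qed (metis card.empty le0)
    then show ?thesis by blast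
  qed
  then obtain f where f: "\<And>G r. G \<in> param_rels s l \<Longrightarrow> finite {b. (b, r) \<in> G} \<Longrightarrow> card {b. (b, r) \<in> G} \<le> f G"
    by metis
  have "f G \<le> Max (f ` param_rels s l)" if "G \<in> param_rels s l" for G
    using that finite_param_rels by (intro Max_ge) auto
  with f show ?thesis by (meson order_trans)
qed

text \<open>A witness of algebraicity is brought into the normal form of \<open>param_rel\<close> by
  renaming. Its parameters are home elements, so disjointness of sorts forces their variables into
  the home sort.\<close>

lemma acl_home_fibre:
  assumes s: "s \<in> sorts Leq" and r: "r \<in> tuples M l" and b: "b \<in> acl Leq Meq (Home ` set r)" "b \<in> univ Meq s"
  shows "\<exists>G\<in>param_rels s l. finite {b. (b, r) \<in> G} \<and> (b, r) \<in> G"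
proof -
  obtain x \<phi> e where x: "fst x \<in> sorts Leq" "b \<in> univ Meq (fst x)" "wf_fm Leq \<phi>"
    "\<forall>v\<in>fv \<phi> - {x}. e v \<in> Home ` set r \<inter> univ Meq (fst v)"
    "sat Meq (e(x := b)) \<phi>" "finite {b' \<in> univ Meq (fst x). sat Meq (e(x := b')) \<phi>}"
    using b(1) unfolding acl_def by blast
  have xs: "fst x = s" using sort_unique x(1,2) s b(2) by blast
  have "\<exists>i<l. e v = Home (r ! i)" if "v \<in> fv \<phi> - {x}" for v
    using x(4) that r unfolding tuples_def by (force simp: in_set_conv_nth)
  then obtain ix where ix: "\<And>v. v \<in> fv \<phi> - {x} \<Longrightarrow> ix v < l \<and> e v = Home (r ! ix v)" by metis
  have home: "fst v = Home_sort" if v: "v \<in> fv \<phi> - {x}" for v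
  proof -
    have "e v \<in> univ Meq (fst v)" "e v \<in> univ Meq Home_sort"
      using x(4) v r by (auto simp: tuples_def)
    moreover have "fst v \<in> sorts Leq" using wf_fm_fv_sorts[OF x(3)] v by blast
    ultimately show ?thesis using sort_unique[of "fst v" Home_sort] by (simp add: sorts_eq_lang_iff)
  qed
  define g where "g v = (if v = x then Var (s, 0) else Var (Home_sort, Suc (ix v)) ::
    ('f + nat \<times> 'a list rel, 'a eq_sort) tm)" for v
  have g: "wf_tm Leq (g v) \<and> sort_of Leq (g v) = fst v" if "v \<in> fv \<phi>" for v
    using that home[of v] s xs by (auto simp: g_def sorts_eq_lang_iff)
  from substitution[OF x(3) g, where M = Meq] obtain \<psi> where \<psi>: "wf_fm Leq \<psi>"
    "fv \<psi> \<subseteq> (\<Union>v\<in>fv \<phi>. fv_tm (g v))" "\<And>e. sat Meq e \<psi> \<longleftrightarrow> sat Meq (\<lambda>v. val Meq e (g v)) \<phi>"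
    by blast
  have "fv \<psi> \<subseteq> param_vars s l"
  proof
    fix w assume "w \<in> fv \<psi>"
    then obtain v where v: "v \<in> fv \<phi>" "w \<in> fv_tm (g v)" using \<psi>(2) by blast
    then show "w \<in> param_vars s l" using ix[of v] by (auto simp: g_def param_vars_def split: if_splits)
  qed
  then have mem: "param_rel s l \<psi> \<in> param_rels s l" using \<psi>(1) by (simp add: param_rels_def)
  have "sat Meq (param_env s b' r) \<psi> \<longleftrightarrow> sat Meq (e(x := b')) \<phi>" for b'
    unfolding \<psi>(3)
  proof (rule sat_cong)
    fix v assume v: "v \<in> fv \<phi>"
    show "val Meq (param_env s b' r) (g v) = (e(x := b')) v"
      using ix[of v] v by (cases "v = x") (auto simp: g_def param_env_def)
  qed
  then have iff: "(b', r) \<in> param_rel s l \<psi> \<longleftrightarrow> b' \<in> univ Meq (fst x) \<and> sat Meq (e(x := b')) \<phi>" for b'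
    using r by (simp add: param_rel_def xs)
  then show ?thesis using mem x(2,5,6) by (intro bexI[of _ "param_rel s l \<psi>"]) (simp_all del: fun_upd_apply)
qed

text \<open>The closure within one sort is covered by the finite fibres over \<open>r\<close>: a
  bounded number of sets of bounded size.\<close>

lemma acl_home_bounded:
  assumes s: "s \<in> sorts Leq"
  shows "\<exists>K. \<forall>r\<in>tuples M l. finite (acl Leq Meq (Home ` set r) \<inter> univ Meq s) \<and>
    card (acl Leq Meq (Home ` set r) \<inter> univ Meq s) \<le> K"
proof -
  obtain J where J: "\<And>G r. G \<in> param_rels s l \<Longrightarrow> finite {b. (b, r) \<in> G} \<Longrightarrow> card {b. (b, r) \<in> G} \<le> J"
    using finite_fibres_bounded[OF s] by meson
  have "finite (acl Leq Meq (Home ` set r) \<inter> univ Meq s) \<and>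
      card (acl Leq Meq (Home ` set r) \<inter> univ Meq s) \<le> card (param_rels s l) * J" if r: "r \<in> tuples M l" for r
  proof -
    define R where "R = {G \<in> param_rels s l. finite {b. (b, r) \<in> G}}"
    have R: "finite R" "card R \<le> card (param_rels s l)"
      using finite_param_rels[of s l] by (auto simp: R_def intro: card_mono)
    have sub: "acl Leq Meq (Home ` set r) \<inter> univ Meq s \<subseteq> (\<Union>G\<in>R. {b. (b, r) \<in> G})"
      using acl_home_fibre[OF s r] unfolding R_def by blast
    have fin: "finite (\<Union>G\<in>R. {b. (b, r) \<in> G})" using R(1) by (auto simp: R_def)
    have "card (acl Leq Meq (Home ` set r) \<inter> univ Meq s) \<le> card (\<Union>G\<in>R. {b. (b, r) \<in> G})"
      by (rule card_mono[OF fin sub])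
    also have "\<dots> \<le> (\<Sum>G\<in>R. card {b. (b, r) \<in> G})" by (rule card_UN_le[OF R(1)])
    also have "\<dots> \<le> card R * J"
      using sum_bounded_above[of R "\<lambda>G. card {b. (b, r) \<in> G}" J] J by (auto simp: R_def)
    also have "\<dots> \<le> card (param_rels s l) * J" using R(2) by simp
    finally show ?thesis using finite_subset[OF sub fin] by blast
  qed
  then show ?thesis by blast
qed

section \<open>Levels and closures of tuples of imaginaries\<close>

lemma finite_definable_equivs: "finite {E. definable_equiv L M k E}"
proof -
  define F where "F E = {as @ bs | as bs. (as, bs) \<in> E}" for E :: "'a list rel"
  have "E \<subseteq> E'" if E: "definable_equiv L M k E" "definable_equiv L M k E'" "F E = F E'" for E E'
  proof (rule subrelI)
    fix as bs assume ab: "(as, bs) \<in> E"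
    then have "as @ bs \<in> F E'" using E(3) unfolding F_def by blast
    then obtain as' bs' where ab': "as @ bs = as' @ bs'" "(as', bs') \<in> E'" unfolding F_def by blast
    have "as \<in> tuples M k" "as' \<in> tuples M k"
      using ab ab'(2) E(1,2) equiv_type unfolding definable_equiv_def by blast+
    then have "length as = length as'" by (simp add: tuples_def)
    then show "(as, bs) \<in> E'" using ab' by simp
  qed
  then have "inj_on F {E. definable_equiv L M k E}" by (intro inj_onI) blast
  moreover have "F ` {E. definable_equiv L M k E} \<subseteq> {D. definable L M (2 * k) D}"
    by (auto simp: definable_equiv_def F_def)
  ultimately show ?thesis using finite_definable by (meson finite_imageD finite_subset)
qed

text \<open>Turns the finiteness of closures in each sort into finiteness in a level.\<close>

lemma level_sorts: "\<exists>S. finite S \<and> S \<subseteq> sorts Leq \<and> level L M n = (\<Union>s\<in>S. univ Meq s)"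
proof (induction n)
  case 0
  show ?case by (rule exI[of _ "{Home_sort}"]) (simp add: sorts_eq_lang_iff)
next
  case (Suc n)
  then obtain S where S: "finite S" "S \<subseteq> sorts Leq" "level L M n = (\<Union>s\<in>S. univ Meq s)" by blast
  define S' where "S' = Quot (Suc n) ` {E. definable_equiv L M (Suc n) E}"
  have "finite S'" using finite_definable_equivs by (simp add: S'_def)
  moreover have "S' \<subseteq> sorts Leq" by (auto simp: S'_def sorts_eq_lang_iff)
  moreover have "level L M (Suc n) = (\<Union>s\<in>S \<union> S'. univ Meq s)" by (auto simp: S(3) S'_def)
  ultimately show ?case using S by (intro exI[of _ "S \<union> S'"]) blast
qed

lemma level_mono: "m \<le> n \<Longrightarrow> level L M m \<subseteq> level L M n"
  by (rule lift_Suc_mono_le) auto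

lemma sort_in_level: "s \<in> sorts Leq \<Longrightarrow> univ Meq s \<subseteq> level L M (arity s)"
proof -
  assume "s \<in> sorts Leq"
  then consider "s = Home_sort" | k E where "s = Quot k E" "1 \<le> k" "definable_equiv L M k E"
    by (auto simp: sorts_eq_lang_iff)
  then show ?thesis
  proof cases
    case (2 k E)
    then show ?thesis by (cases k) auto
  qed auto
qed

text \<open>The represented element is the only solution of an equation with the projection of
  \<open>as\<close>.\<close>

lemma rep_in_acl:
  assumes s: "s \<in> sorts Leq" and as: "as \<in> tuples M (arity s)"
  shows "rep s as \<in> acl Leq Meq (Home ` set as)"
proof (cases s)
  case Home_sort
  then have "as ! 0 \<in> set as" "set as \<subseteq> univ M ()" using as by (auto simp: tuples_def)
  then have "rep s as \<in> Home ` set as" "rep s as \<in> univ Meq Home_sort" using Home_sort by auto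
  then show ?thesis using s Home_sort by (auto intro: acl_refl)
next
  case (Quot k E)
  define ts where "ts = map (\<lambda>i. Var (Home_sort, i) :: ('f + nat \<times> 'a list rel, 'a eq_sort) tm) [0..<k]"
  define x where "x = (s, 0::nat)"
  define e where "e v = Home (as ! snd v)" for v :: "'a eq_sort var"
  have len: "length as = k" "set as \<subseteq> univ M ()" using as Quot by (auto simp: tuples_def)
  have E: "1 \<le> k" "definable_equiv L M k E" using s Quot by (auto simp: sorts_eq_lang_iff)
  define \<phi> :: "('f + nat \<times> 'a list rel, 'r, 'a eq_sort) fm" where "\<phi> = FEq (Var x) (App (Inr (k, E)) ts)"
  have wf: "wf_fm Leq \<phi>"
    using E s Quot by (auto simp: \<phi>_def x_def ts_def fsyms_eq_lang_iff sorts_eq_lang_iff map_replicate_const o_def)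
  have vals: "map home_val (map (val Meq (e(x := b))) ts) = as" for b
    by (rule nth_equalityI) (auto simp: ts_def e_def x_def len Quot)
  have sat: "sat Meq (e(x := b)) \<phi> \<longleftrightarrow> b = rep s as" for b
    unfolding \<phi>_def sat.simps val.simps eq_struct_simps vals Quot by simp
  have b: "rep s as \<in> univ Meq (fst x)" using as by (simp add: univ_eq_struct x_def)
  show ?thesis
  proof (rule acl_witness[where x = x and \<phi> = \<phi> and e = e])
    show "fst x \<in> sorts Leq" using s by (simp add: x_def)
    show "e v \<in> Home ` set as \<inter> univ Meq (fst v)" if v: "v \<in> fv \<phi> - {x}" for v
    proof -
      obtain i where "v = (Home_sort, i)" "i < k" using v by (auto simp: \<phi>_def ts_def)
      moreover from this have "as ! i \<in> set as" using len by simp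
      ultimately show ?thesis using len(2) by (auto simp: e_def)
    qed
  qed (use b wf sat in simp_all)
qed

text \<open>The length of \<open>r\<close> depends only on the sorts, so bounds for home tuples of
  one length carry over uniformly.\<close>

lemma tuple_over_home:
  assumes "bs \<in> insts Meq vs" "\<forall>v\<in>set vs. fst v \<in> sorts Leq"
  shows "\<exists>r\<in>tuples M (\<Sum>v\<leftarrow>vs. arity (fst v)). set bs \<subseteq> acl Leq Meq (Home ` set r)"
  using assms
proof (induction vs arbitrary: bs)
  case Nil
  then show ?case by (auto simp: insts_def tuples_def)
next
  case (Cons v vs)
  then obtain b bs' where b: "bs = b # bs'" "b \<in> univ Meq (fst v)" "bs' \<in> insts Meq vs"
    by (auto simp: insts_def list_all2_Cons2)
  obtain r where r: "r \<in> tuples M (\<Sum>v\<leftarrow>vs. arity (fst v))" "set bs' \<subseteq> acl Leq Meq (Home ` set r)"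
    using Cons.IH[OF b(3)] Cons.prems(2) by auto
  obtain as where as: "as \<in> tuples M (arity (fst v))" "b = rep (fst v) as"
    using b(2) by (auto simp: univ_eq_struct)
  have "b \<in> acl Leq Meq (Home ` set as)" using rep_in_acl[OF _ as(1)] Cons.prems(2) as(2) by simp
  then have "set bs \<subseteq> acl Leq Meq (Home ` set (as @ r))"
    using r(2) acl_mono[of "Home ` set as" "Home ` set (as @ r)" Leq Meq]
      acl_mono[of "Home ` set r" "Home ` set (as @ r)" Leq Meq] by (auto simp: b(1))
  moreover have "as @ r \<in> tuples M (\<Sum>v\<leftarrow>v # vs. arity (fst v))" using as(1) r(1) by (auto simp: tuples_def)
  ultimately show ?case by blast
qed

text \<open>By transitivity the closure of \<open>bs\<close> is contained in that of home
  representatives, whose number is fixed by \<open>vs\<close>. Summing the bounds over the finitely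
  many sorts of the level gives \<open>K\<close>.\<close>

lemma acl_level_bounded:
  assumes vs: "\<forall>v\<in>set vs. fst v \<in> sorts Leq"
  shows "\<exists>K. \<forall>bs\<in>insts Meq vs. finite (acl_level L M n (set bs)) \<and> card (acl_level L M n (set bs)) \<le> K"
proof -
  define l where "l = (\<Sum>v\<leftarrow>vs. arity (fst v))"
  obtain S where S: "finite S" "S \<subseteq> sorts Leq" "level L M n = (\<Union>s\<in>S. univ Meq s)"
    using level_sorts[of n] by (elim exE conjE)
  have "\<forall>s\<in>S. \<exists>K. \<forall>r\<in>tuples M l. finite (acl Leq Meq (Home ` set r) \<inter> univ Meq s) \<and>
      card (acl Leq Meq (Home ` set r) \<inter> univ Meq s) \<le> K"
    using acl_home_bounded S(2) by blast
  then obtain K where K: "\<And>s r. s \<in> S \<Longrightarrow> r \<in> tuples M l \<Longrightarrow>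
      finite (acl Leq Meq (Home ` set r) \<inter> univ Meq s) \<and> card (acl Leq Meq (Home ` set r) \<inter> univ Meq s) \<le> K s"
    by metis
  have "finite (acl_level L M n (set bs)) \<and> card (acl_level L M n (set bs)) \<le> (\<Sum>s\<in>S. K s)"
    if bs: "bs \<in> insts Meq vs" for bs
  proof -
    obtain r where r: "r \<in> tuples M l" "set bs \<subseteq> acl Leq Meq (Home ` set r)"
      using tuple_over_home[OF bs vs] by (auto simp: l_def)
    let ?U = "\<Union>s\<in>S. acl Leq Meq (Home ` set r) \<inter> univ Meq s"
    have sub: "acl_level L M n (set bs) \<subseteq> ?U"
      using acl_trans[OF r(2)] by (auto simp: acl_level_def acl_eq_def S(3))
    have fin: "finite ?U" using S(1) K r(1) by blast
    have "card (acl_level L M n (set bs)) \<le> card ?U" by (rule card_mono[OF fin sub])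
    also have "\<dots> \<le> (\<Sum>s\<in>S. card (acl Leq Meq (Home ` set r) \<inter> univ Meq s))" by (rule card_UN_le[OF S(1)])
    also have "\<dots> \<le> (\<Sum>s\<in>S. K s)" by (rule sum_mono) (use K r(1) in blast)
    finally show ?thesis using finite_subset[OF sub fin] by blast
  qed
  then show ?thesis by blast
qed

lemma finite_acl_level:
  assumes "finite C" "C \<subseteq> eq_univ L M"
  shows "finite (acl_level L M n C)"
proof -
  obtain cs where cs: "set cs = C" using finite_list[OF assms(1)] by blast
  have "\<forall>c\<in>C. \<exists>s\<in>sorts Leq. c \<in> univ Meq s" using assms(2) by (auto simp: eq_univ_def)
  then obtain s where s: "\<And>c. c \<in> C \<Longrightarrow> s c \<in> sorts Leq \<and> c \<in> univ Meq (s c)" by metis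
  \<comment> \<open>\<open>insts\<close> looks only at the sorts of the variables, so one index
    serves for all, even with repetitions.\<close>
  define vs where "vs = map (\<lambda>c. (s c, 0::nat)) cs"
  have "cs \<in> insts Meq vs" using s cs by (intro instsI) (auto simp: vs_def)
  moreover have "\<forall>v\<in>set vs. fst v \<in> sorts Leq" using s cs by (auto simp: vs_def)
  ultimately show ?thesis using acl_level_bounded cs by blast
qed

end

section \<open>The n-rank and exchange\<close>

lemma assign_append:
  assumes "length as = length vs"
  shows "assign e (vs @ ws) (as @ bs) v = (if v \<in> set vs then assign e vs as v else assign e ws bs v)"
proof (cases "v \<in> set vs")
  case True
  then obtain a where "map_of (zip vs as) v = Some a"
    using assms by (metis map_of_zip_is_Some)
  then show ?thesis using True assms by (simp add: assign_def map_add_def)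
next
  case False
  then have "map_of (zip vs as) v = None" by (auto simp: map_of_eq_None_iff dest: set_zip_leftD)
  then show ?thesis
    by (cases "map_of (zip ws bs) v")
      (simp_all only: assign_def zip_append[OF assms[symmetric]] map_of_append map_add_def option.case False if_False)
qed

lemma assign_in:
  assumes "length as = length vs" "v \<in> set vs"
  shows "assign e vs as v = assign e' vs as v"
proof -
  obtain a where "map_of (zip vs as) v = Some a"
    using assms by (metis map_of_zip_is_Some)
  then show ?thesis by (simp add: assign_def)
qed

lemma assign_insts:
  assumes "as \<in> insts M vs" "v \<in> set vs"
  shows "assign e vs as v \<in> set as \<inter> univ M (fst v)"
proof -
  have len: "length as = length vs" using assms(1) by (rule insts_length)
  obtain a where a: "map_of (zip vs as) v = Some a"
    using assms(2) len by (metis map_of_zip_is_Some)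
  then have "(v, a) \<in> set (zip vs as)" by (rule map_of_SomeD)
  then obtain i where "i < length vs" "v = vs ! i" "a = as ! i" by (auto simp: set_zip)
  then have "a \<in> set as \<inter> univ M (fst v)" using insts_nth[OF assms(1)] len by auto
  then show ?thesis using a by (simp add: assign_def)
qed

context imaginaries
begin

abbreviation cl where "cl A \<equiv> acl Leq Meq A"

lemma acl_level_iff: "a \<in> acl_level L M n A \<longleftrightarrow> a \<in> cl A \<and> a \<in> level L M n"
  by (simp add: acl_level_def acl_eq_def)

lemma level_eq_univ: "level L M n \<subseteq> eq_univ L M"
proof -
  obtain S where "S \<subseteq> sorts Leq" "level L M n = (\<Union>s\<in>S. univ Meq s)"
    using level_sorts[of n] by (elim exE conjE)
  then show ?thesis unfolding eq_univ_def by blast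
qed

lemma cl_refl: "A \<subseteq> eq_univ L M \<Longrightarrow> A \<subseteq> cl A"
  by (auto simp: eq_univ_def intro: acl_refl)

text \<open>The same chain works over the weaker base, since whatever avoids \<open>cl B\<close>
  avoids \<open>cl B'\<close>.\<close>

lemma rk_ge_antimono:
  assumes "rk_ge L M n A B m" "B' \<subseteq> cl B" "B \<subseteq> eq_univ L M"
  shows "rk_ge L M n A B' m"
  using assms
proof (induction m arbitrary: B B')
  case (Suc m)
  then obtain a where a: "a \<in> cl A" "a \<in> level L M n" "a \<notin> cl B" "rk_ge L M n A ({a} \<union> B) m"
    by (auto simp: acl_level_iff)
  have U: "{a} \<union> B \<subseteq> eq_univ L M" using a(2) level_eq_univ Suc.prems(3) by blast
  have "cl B \<subseteq> cl ({a} \<union> B)" by (rule acl_mono) blast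
  then have "{a} \<union> B' \<subseteq> cl ({a} \<union> B)" using cl_refl[OF U] Suc.prems(2) by blast
  from Suc.IH[OF a(4) this U] have "rk_ge L M n A ({a} \<union> B') m" .
  moreover have "a \<notin> cl B'" using a(3) acl_trans[OF Suc.prems(2)] by blast
  ultimately show ?case using a(1,2) by (auto simp: acl_level_iff)
qed simp

text \<open>Each link of a chain brings at least itself from the closure of \<open>A\<close> into
  the closure of the base.\<close>

lemma rk_ge_le_card:
  assumes "rk_ge L M n A B m" "finite (acl_level L M n A)" "B \<subseteq> eq_univ L M"
  shows "m \<le> card (acl_level L M n A - acl_level L M n B)"
  using assms(1,3)
proof (induction m arbitrary: B)
  case (Suc m)
  then obtain a where a: "a \<in> acl_level L M n A - acl_level L M n B" "rk_ge L M n A ({a} \<union> B) m"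
    by auto
  have U: "{a} \<union> B \<subseteq> eq_univ L M" using a(1) level_eq_univ Suc.prems(2) by (auto simp: acl_level_iff)
  have "a \<in> acl_level L M n ({a} \<union> B)" using a(1) cl_refl[OF U] by (auto simp: acl_level_iff)
  moreover have "acl_level L M n B \<subseteq> acl_level L M n ({a} \<union> B)"
  proof -
    have "cl B \<subseteq> cl ({a} \<union> B)" by (rule acl_mono) blast
    then show ?thesis by (auto simp: acl_level_iff)
  qed
  ultimately have "acl_level L M n A - acl_level L M n ({a} \<union> B) \<subset> acl_level L M n A - acl_level L M n B"
    using a(1) by blast
  then have "card (acl_level L M n A - acl_level L M n ({a} \<union> B)) < card (acl_level L M n A - acl_level L M n B)"
    using assms(2) by (intro psubset_card_mono) auto
  then show ?case using Suc.IH[OF a(2) U] by simp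
qed simp

text \<open>Among the elements of the closure of \<open>a\<close> outside \<open>cl C\<close>, take
  \<open>b\<close> with the smallest closure in level \<open>n\<close>. A chain of two links for
  \<open>b\<close> would start with some \<open>d\<close> of strictly smaller closure.\<close>

lemma rank_one_exists:
  assumes a: "a \<in> level L M n" "a \<notin> cl C"
  shows "\<exists>a'\<in>acl_level L M n {a}. rk_eq L M n {a'} C 1"
proof -
  have U: "{b} \<subseteq> eq_univ L M" if "b \<in> level L M n" for b using that level_eq_univ by blast
  let ?P = "\<lambda>b. b \<in> acl_level L M n {a} \<and> b \<notin> cl C"
  have "?P a" using a cl_refl[OF U[OF a(1)]] by (auto simp: acl_level_iff)
  then obtain b where b: "?P b" "\<And>d. ?P d \<Longrightarrow> card (acl_level L M n {b}) \<le> card (acl_level L M n {d})"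
    using ex_has_least_nat[of ?P a "\<lambda>b. card (acl_level L M n {b})"] by blast
  have bl: "b \<in> level L M n" "b \<in> cl {a}" using b(1) by (auto simp: acl_level_iff)
  have bb: "b \<in> cl {b}" using cl_refl[OF U[OF bl(1)]] by blast
  have "rk_ge L M n {b} C 1" using b(1) bl bb by (auto simp: acl_level_iff)
  moreover have "\<not> rk_ge L M n {b} C (Suc 1)"
  proof
    assume "rk_ge L M n {b} C (Suc 1)"
    then obtain d e where d: "d \<in> cl {b}" "d \<in> level L M n" "d \<notin> cl C"
      and e: "e \<in> cl {b}" "e \<notin> cl ({d} \<union> C)"
      by (auto simp: acl_level_iff)
    have "cl {b} \<subseteq> cl {a}" using bl(2) by (intro acl_trans) blast
    then have "?P d" using d by (auto simp: acl_level_iff)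
    \<comment> \<open>Otherwise \<open>cl {b}\<close> would lie inside \<open>cl {d}\<close>,
      leaving no room for the second link \<open>e\<close>.\<close>
    have "b \<notin> cl {d}"
    proof
      assume "b \<in> cl {d}"
      then have "cl {b} \<subseteq> cl {d}" by (intro acl_trans) blast
      also have "cl {d} \<subseteq> cl ({d} \<union> C)" by (rule acl_mono) blast
      finally show False using e by blast
    qed
    moreover have "cl {d} \<subseteq> cl {b}" using d(1) by (intro acl_trans) blast
    ultimately have "acl_level L M n {d} \<subset> acl_level L M n {b}"
      using bb bl(1) by (auto simp: acl_level_iff)
    then have "card (acl_level L M n {d}) < card (acl_level L M n {b})"
      using finite_acl_level[OF _ U[OF bl(1)]] by (intro psubset_card_mono) auto
    with b(2)[OF \<open>?P d\<close>] show False by simp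
  qed
  ultimately show ?thesis using b(1) unfolding rk_eq_def by blast
qed

text \<open>The case \<open>k = 2\<close>, where the elements strictly between the first and the
  last are absent.\<close>

lemma exchange_two:
  assumes "exchange_property \<kappa> L M n" "|C| <o \<kappa>" "C \<subseteq> eq_univ L M"
    and "a \<in> level L M n" "b \<in> level L M n" "rk_eq L M n {a} C 1" "rk_eq L M n {b} C 1"
    and "b \<in> cl ({a} \<union> C)" "b \<notin> cl C"
  shows "a \<in> cl ({b} \<union> C)"
proof -
  define s where "s i = (if i = (1::nat) then a else b)" for i
  have two: "{1..2} = {1, 2::nat}" "{1..2 - 1} = {1::nat}" "{2..2 - 1} = ({} :: nat set)" "{2..2} = {2::nat}"
    by auto
  have "s 1 \<in> acl_eq L M (s ` {2..2} \<union> C)"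
    by (rule assms(1)[unfolded exchange_property_def, rule_format])
      (use assms(2-9) in \<open>simp add: two s_def acl_eq_def\<close>)
  then show ?thesis by (simp add: two s_def acl_eq_def)
qed

text \<open>
  If the first step \<open>b\<close> of a chain over \<open>{a} \<union> C\<close> makes \<open>a\<close> algebraic, then by exchange its rank
  over \<open>C\<close> exceeds 1, so it can be split into two steps over \<open>C\<close>.
\<close>

lemma rk_ge_Suc_of_algebraic:
  assumes ex: "exchange_property \<kappa> L M n" and \<kappa>: "\<And>C :: 'a eq_elem set. finite C \<Longrightarrow> |C| <o \<kappa>"
    and A: "A \<subseteq> level L M n" and a: "a \<in> level L M n"
    and C: "finite C" "C \<subseteq> eq_univ L M" "a \<in> cl (A \<union> C)" "a \<notin> cl C" "rk_ge L M n A ({a} \<union> C) m"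
  shows "rk_ge L M n A C (Suc m)"
  using C
proof (induction m arbitrary: C)
  case 0
  \<comment> \<open>An element of \<open>A\<close> itself can serve as the one link: if all of
    \<open>A\<close> were algebraic over \<open>C\<close>, so would be \<open>a\<close>.\<close>
  have "\<not> A \<subseteq> cl C"
  proof
    assume "A \<subseteq> cl C"
    then have "A \<union> C \<subseteq> cl C" using cl_refl[OF 0(2)] by blast
    then show False using acl_trans 0(3,4) by blast
  qed
  then obtain b where "b \<in> A" "b \<notin> cl C" by blast
  moreover have "A \<subseteq> cl A" using A level_eq_univ by (intro cl_refl) blast
  ultimately show ?case using A by (auto simp: acl_level_iff)
next
  case (Suc m)
  then obtain b where b: "b \<in> cl A" "b \<in> level L M n" "b \<notin> cl ({a} \<union> C)" "rk_ge L M n A ({b} \<union> ({a} \<union> C)) m"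
    by (auto simp: acl_level_iff)
  have aU: "a \<in> eq_univ L M" and bU: "b \<in> eq_univ L M" using a b(2) level_eq_univ by blast+
  have bC: "b \<notin> cl C" using b(3) acl_mono[of C "{a} \<union> C" Leq Meq] by blast
  show ?case
  proof (cases "a \<in> cl ({b} \<union> C)")
    case False
    \<comment> \<open>\<open>a\<close> stays outside the closure after adding \<open>b\<close>, so
      the induction hypothesis applies over the larger base, and \<open>b\<close> is a first link
      over \<open>C\<close>.\<close>
    have "rk_ge L M n A ({b} \<union> C) (Suc m)"
    proof (rule Suc.IH)
      show "a \<in> cl (A \<union> ({b} \<union> C))" using Suc.prems(3) acl_mono[of "A \<union> C" "A \<union> ({b} \<union> C)" Leq Meq] by blast
      have "{b} \<union> ({a} \<union> C) = {a} \<union> ({b} \<union> C)" by blast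
      then show "rk_ge L M n A ({a} \<union> ({b} \<union> C)) m" using b(4) by simp
    qed (use False Suc.prems bU in auto)
    then show ?thesis using b(1,2) bC unfolding rk_ge.simps(2)[of _ _ _ _ _ "Suc m"]
      by (auto simp: acl_level_iff simp del: rk_ge.simps)
  next
    case True
    have "\<not> rk_eq L M n {b} C 1"
    proof
      assume rb: "rk_eq L M n {b} C 1"
      \<comment> \<open>\<open>a\<close> itself may have rank above 1; the exchange partner of
        \<open>b\<close> is an element of rank 1 in the closure of \<open>a\<close>.\<close>
      obtain a' where a': "a' \<in> acl_level L M n {a}" "rk_eq L M n {a'} C 1"
        using rank_one_exists[OF a Suc.prems(4)] by blast
      have "a' \<notin> cl C" using a'(2) acl_trans[of "{a'}" C]
        by (auto simp: rk_eq_def acl_level_iff)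
      have "cl {a} \<subseteq> cl ({b} \<union> C)" using True by (intro acl_trans) blast
      then have "a' \<in> cl ({b} \<union> C)" using a'(1) by (auto simp: acl_level_iff)
      with \<open>a' \<notin> cl C\<close> a' rb b(2) have "b \<in> cl ({a'} \<union> C)"
        using exchange_two[OF ex \<kappa>[OF Suc.prems(1)] Suc.prems(2)] by (auto simp: acl_level_iff)
      moreover have "{a'} \<union> C \<subseteq> cl ({a} \<union> C)"
        using a'(1) acl_mono[of "{a}" "{a} \<union> C" Leq Meq] cl_refl[of "{a} \<union> C"] aU Suc.prems(2)
        by (auto simp: acl_level_iff)
      ultimately show False using acl_trans b(3) by blast
    qed
    moreover have bb: "b \<in> cl {b}" using cl_refl[of "{b}"] bU by blast
    then have "rk_ge L M n {b} C 1" using bC b(2) by (auto simp: acl_level_iff)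
    ultimately have "rk_ge L M n {b} C (Suc 1)" unfolding rk_eq_def by blast
    then obtain d e where d: "d \<in> cl {b}" "d \<in> level L M n" "d \<notin> cl C"
      and e: "e \<in> cl {b}" "e \<notin> cl ({d} \<union> C)"
      by (auto simp: acl_level_iff)
    have "b \<notin> cl ({d} \<union> C)" using e acl_trans[of "{b}" "{d} \<union> C"] by blast
    \<comment> \<open>\<open>d\<close> is algebraic over \<open>b\<close>, so this base lies in the
      closure of the old one; \<open>d\<close> and \<open>b\<close> become two links in place of
      \<open>b\<close>.\<close>
    moreover have "rk_ge L M n A ({b} \<union> ({d} \<union> C)) m"
    proof (rule rk_ge_antimono[OF b(4)])
      show U: "{b} \<union> ({a} \<union> C) \<subseteq> eq_univ L M" using aU bU Suc.prems(2) by blast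
      have "cl {b} \<subseteq> cl ({b} \<union> ({a} \<union> C))" by (rule acl_mono) blast
      then show "{b} \<union> ({d} \<union> C) \<subseteq> cl ({b} \<union> ({a} \<union> C))" using cl_refl[OF U] d(1) by blast
    qed
    ultimately have "rk_ge L M n A ({d} \<union> C) (Suc m)" using b(1,2) by (auto simp: acl_level_iff)
    moreover have "d \<in> cl A" using d(1) acl_trans[of "{b}" A] b(1) by blast
    ultimately show ?thesis using d(2,3) unfolding rk_ge.simps(2)[of _ _ _ _ _ "Suc m"]
      by (auto simp: acl_level_iff simp del: rk_ge.simps)
  qed
qed

section \<open>Thorn-ranks are bounded by the n-rank\<close>

text \<open>The conjunction of \<open>\<pi>\<close> and \<open>\<delta>\<close>, with
  \<open>bs\<close> and \<open>cs\<close> as parameters, has \<open>as\<close> among its solutions.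
  It cannot have \<open>k\<close> distinct solutions, since \<open>bs\<close> would be a common
  realisation of the \<open>k\<close> instances of \<open>\<delta>\<close>.\<close>

lemma k_inconsistent_algebraic:
  assumes d: "distinct (xs @ ys @ zs)" "\<forall>v\<in>set (xs @ ys @ zs). fst v \<in> sorts Leq"
    and \<delta>: "wf_fm Leq \<delta>" "fv \<delta> \<subseteq> set xs \<union> set ys" and \<pi>: "wf_fm Leq \<pi>" "fv \<pi> \<subseteq> set ys \<union> set zs"
    and as: "as \<in> insts Meq ys" and bs: "bs \<in> insts Meq xs" and cs: "cs \<in> insts Meq zs"
    and k: "k_inconsistent Meq k \<delta> xs ys {as \<in> insts Meq ys. sat2 Meq \<pi> ys zs as cs}"
    and sat: "sat2 Meq \<pi> ys zs as cs" "sat2 Meq \<delta> xs ys bs as"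
  shows "set as \<subseteq> cl (set bs \<union> set cs)"
proof -
  define e where "e = assign undefined (xs @ zs) (bs @ cs)"
  have len: "length bs = length xs" "length cs = length zs" using bs cs by (auto dest: insts_length)
  have s\<pi>: "sat Meq (assign e ys as) \<pi> \<longleftrightarrow> sat2 Meq \<pi> ys zs as cs" if "as \<in> insts Meq ys" for as
    unfolding sat2_def
  proof (rule sat_cong)
    fix v assume "v \<in> fv \<pi>"
    have la: "length as = length ys" using that by (rule insts_length)
    show "assign e ys as v = assign undefined (ys @ zs) (as @ cs) v"
    proof (cases "v \<in> set ys")
      case True
      then show ?thesis using assign_in[OF la True] by (simp add: assign_append[OF la])
    next
      case False
      then have "v \<in> set zs" "v \<notin> set xs" using \<open>v \<in> fv \<pi>\<close> \<pi>(2) d(1) by auto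
      then show ?thesis using False
        by (simp add: assign_append[OF la] assign_notin e_def assign_append[OF len(1)])
    qed
  qed
  have s\<delta>: "sat Meq (assign e ys as) \<delta> \<longleftrightarrow> sat2 Meq \<delta> xs ys bs as" if "as \<in> insts Meq ys" for as
    unfolding sat2_def
  proof (rule sat_cong)
    fix v assume "v \<in> fv \<delta>"
    have la: "length as = length ys" using that by (rule insts_length)
    show "assign e ys as v = assign undefined (xs @ ys) (bs @ as) v"
    proof (cases "v \<in> set ys")
      case True
      then have "v \<notin> set xs" using d(1) by auto
      then show ?thesis using assign_in[OF la True] by (simp add: assign_append[OF len(1)])
    next
      case False
      then have "v \<in> set xs" using \<open>v \<in> fv \<delta>\<close> \<delta>(2) by auto
      then show ?thesis using False
        by (simp add: assign_notin e_def assign_append[OF len(1)])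
    qed
  qed
  have sat_iff: "sat Meq (assign e ys as) (FConj \<pi> \<delta>) \<longleftrightarrow> sat2 Meq \<pi> ys zs as cs \<and> sat2 Meq \<delta> xs ys bs as"
    if "as \<in> insts Meq ys" for as
    using s\<pi>[OF that] s\<delta>[OF that] by simp
  show ?thesis
  proof (rule acl_block[where \<phi> = "FConj \<pi> \<delta>" and e = e and ys = ys])
    show "wf_fm Leq (FConj \<pi> \<delta>)" using \<pi>(1) \<delta>(1) by simp
    show "distinct ys" "\<forall>y\<in>set ys. fst y \<in> sorts Leq" using d by auto
    show "e v \<in> (set bs \<union> set cs) \<inter> univ Meq (fst v)" if v: "v \<in> fv (FConj \<pi> \<delta>) - set ys" for v
    proof (cases "v \<in> set xs")
      case True
      then show ?thesis using assign_insts[OF bs True] by (simp add: e_def assign_append[OF len(1)])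
    next
      case False
      then have "v \<in> set zs" using v \<pi>(2) \<delta>(2) by auto
      from assign_insts[OF cs this] False show ?thesis by (simp add: e_def assign_append[OF len(1)])
    qed
    show "finite {as \<in> insts Meq ys. sat Meq (assign e ys as) (FConj \<pi> \<delta>)}" (is "finite ?X")
    proof (rule ccontr)
      assume "infinite ?X"
      then obtain S0 where S0: "finite S0" "card S0 = k" "S0 \<subseteq> ?X"
        using infinite_arbitrarily_large by blast
      then have "S0 \<subseteq> {as \<in> insts Meq ys. sat2 Meq \<pi> ys zs as cs}" "\<forall>as\<in>S0. sat2 Meq \<delta> xs ys bs as"
        using sat_iff by blast+
      then show False using k S0(1,2) bs unfolding k_inconsistent_def by blast
    qed
  qed (use as sat sat_iff in auto)
qed

text \<open>The tuple \<open>bs\<close> is known only after all steps are made. Stating the claim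
  for every finite base \<open>C\<close> lets each step put its parameters \<open>cs\<close> and
  \<open>as\<close> into the base before the induction hypothesis delivers \<open>bs\<close>; the
  link gained by removing \<open>as\<close> again is supplied by
  \<open>rk_ge_Suc_of_algebraic\<close>.\<close>

lemma thorn_ge_rk_ge:
  assumes ex: "exchange_property \<kappa> L M n" and \<kappa>: "\<And>C :: 'a eq_elem set. finite C \<Longrightarrow> |C| <o \<kappa>"
    and d: "distinct (xs @ ys @ zs)" "\<forall>v\<in>set (xs @ ys @ zs). fst v \<in> sorts Leq"
    and \<Delta>: "\<forall>\<delta>\<in>\<Delta>. wf_fm Leq \<delta> \<and> fv \<delta> \<subseteq> set xs \<union> set ys"
    and \<Pi>: "\<forall>\<pi>\<in>\<Pi>. wf_fm Leq \<pi> \<and> fv \<pi> \<subseteq> set ys \<union> set zs"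
    and n: "\<And>v. v \<in> set xs \<union> set ys \<Longrightarrow> univ Meq (fst v) \<subseteq> level L M n"
    and D: "D \<subseteq> insts Meq xs" "thorn_ge Meq k xs ys zs \<Delta> \<Pi> D m"
    and C: "finite C" "C \<subseteq> eq_univ L M"
  shows "\<exists>bs\<in>D. rk_ge L M n (set bs) C m"
  using D C
proof (induction m arbitrary: D C)
  case 0
  then show ?case by auto
next
  case (Suc m)
  obtain \<delta> \<pi> cs where \<delta>: "\<delta> \<in> \<Delta>" and \<pi>: "\<pi> \<in> \<Pi>" and cs: "cs \<in> insts Meq zs"
    and inf: "infinite {as \<in> insts Meq ys. sat2 Meq \<pi> ys zs as cs \<and>
      thorn_ge Meq k xs ys zs \<Delta> \<Pi> {bs \<in> D. sat2 Meq \<delta> xs ys bs as} m}" (is "infinite ?X")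
    and k: "k_inconsistent Meq k \<delta> xs ys {as \<in> insts Meq ys. sat2 Meq \<pi> ys zs as cs}"
    using Suc.prems(2) by auto
  have in_level: "set as \<subseteq> level L M n" if vs: "as \<in> insts Meq vs" "set vs \<subseteq> set xs \<union> set ys" for as vs
  proof
    fix a assume "a \<in> set as"
    then obtain i where "i < length vs" "a = as ! i" using insts_length[OF vs(1)] by (auto simp: in_set_conv_nth)
    then show "a \<in> level L M n" using insts_nth[OF vs(1)] n[of "vs ! i"] vs(2) nth_mem[of i vs] by blast
  qed
  \<comment> \<open>\<open>as\<close> will be algebraic over \<open>bs\<close> only together with
    \<open>cs\<close>, so \<open>cs\<close> must be in the base before ranks are compared.\<close>
  define C1 where "C1 = C \<union> set cs"
  have "set cs \<subseteq> eq_univ L M"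
  proof
    fix c assume "c \<in> set cs"
    then obtain i where "i < length zs" "c = cs ! i" using insts_length[OF cs] by (auto simp: in_set_conv_nth)
    then have "c \<in> univ Meq (fst (zs ! i))" "fst (zs ! i) \<in> sorts Leq"
      using insts_nth[OF cs] d(2) by simp_all
    then show "c \<in> eq_univ L M" by (auto simp: eq_univ_def)
  qed
  then have C1: "finite C1" "C1 \<subseteq> eq_univ L M" using Suc.prems(3,4) by (auto simp: C1_def)
  \<comment> \<open>Only finitely many tuples have all coordinates in the finite closure of
    \<open>C1\<close>, so the infinite set \<open>?X\<close> contains one with a coordinate
    outside.\<close>
  have "finite {as. set as \<subseteq> acl_level L M n C1 \<and> length as = length ys}"
    by (rule finite_lists_length_eq[OF finite_acl_level[OF C1]])
  then have "infinite (?X - {as. set as \<subseteq> acl_level L M n C1 \<and> length as = length ys})"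
    using inf by (rule Diff_infinite_finite)
  then obtain as where "as \<in> ?X - {as. set as \<subseteq> acl_level L M n C1 \<and> length as = length ys}"
    using infinite_imp_nonempty by blast
  then have as: "as \<in> insts Meq ys" "sat2 Meq \<pi> ys zs as cs"
    "thorn_ge Meq k xs ys zs \<Delta> \<Pi> {bs \<in> D. sat2 Meq \<delta> xs ys bs as} m"
    "\<not> set as \<subseteq> acl_level L M n C1"
    by (auto dest: insts_length)
  have as_level: "set as \<subseteq> level L M n" by (rule in_level[OF as(1)]) simp
  then obtain a where a: "a \<in> set as" "a \<in> level L M n" "a \<notin> cl C1" 
    using as(4) unfolding acl_level_iff subset_iff by blast
  have C2: "finite (C1 \<union> set as)" "C1 \<union> set as \<subseteq> eq_univ L M" using C1 as_level level_eq_univ by auto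
  have "{bs \<in> D. sat2 Meq \<delta> xs ys bs as} \<subseteq> insts Meq xs" using Suc.prems(1) by blast
  from Suc.IH[OF this as(3) C2] obtain bs where bs: "bs \<in> D" "sat2 Meq \<delta> xs ys bs as"
    "rk_ge L M n (set bs) (C1 \<union> set as) m" by blast
  have bs_xs: "bs \<in> insts Meq xs" using bs(1) Suc.prems(1) by blast
  have bs_level: "set bs \<subseteq> level L M n" by (rule in_level[OF bs_xs]) simp
  have "set as \<subseteq> cl (set bs \<union> set cs)"
    by (rule k_inconsistent_algebraic[OF d _ _ _ _ as(1) bs_xs cs k as(2) bs(2)]) (use \<Delta> \<Pi> \<delta> \<pi> in auto)
  then have "a \<in> cl (set bs \<union> C1)"
    using a(1) acl_mono[of "set bs \<union> set cs" "set bs \<union> C1" Leq Meq] by (auto simp: C1_def)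
  \<comment> \<open>Of the tuple \<open>as\<close> a single nonalgebraic coordinate is kept;
    shrinking the base preserves the lower bound on the rank.\<close>
  moreover have "rk_ge L M n (set bs) ({a} \<union> C1) m"
    by (rule rk_ge_antimono[OF bs(3) _ C2(2)]) (use cl_refl[OF C2(2)] a(1) in blast)
  ultimately have "rk_ge L M n (set bs) C1 (Suc m)"
    by (intro rk_ge_Suc_of_algebraic[OF ex \<kappa> bs_level a(2) C1]) (use a(3) in auto)
  then have "rk_ge L M n (set bs) C (Suc m)"
    by (rule rk_ge_antimono[OF _ _ C1(2)]) (use cl_refl[OF C1(2)] in \<open>auto simp: C1_def\<close>)
  with bs(1) show ?case by blast
qed

text \<open>A chain of \<open>Suc K\<close> links over the empty base would not fit into a closure
  of at most \<open>K\<close> elements, and \<open>K\<close> depends only on \<open>xs\<close> and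
  the level.\<close>

theorem exchange_imp_rosy:
  assumes ex: "\<And>n. exchange_property \<kappa> L M n" and \<kappa>: "\<And>C :: 'a eq_elem set. finite C \<Longrightarrow> |C| <o \<kappa>"
  shows "rosy L M"
  unfolding rosy_def thorn_ranks_finite_def
proof (intro allI impI, elim conjE)
  fix k xs ys zs \<Delta> \<Pi> and \<phi> :: "('f + nat \<times> 'a list rel, 'r, 'a eq_sort) fm" and e
  assume d: "distinct (xs @ ys @ zs)" "\<forall>v\<in>set (xs @ ys @ zs). fst v \<in> sorts Leq"
    and \<Delta>: "\<forall>\<delta>\<in>\<Delta>. wf_fm Leq \<delta> \<and> fv \<delta> \<subseteq> set xs \<union> set ys"
    and \<Pi>: "\<forall>\<pi>\<in>\<Pi>. wf_fm Leq \<pi> \<and> fv \<pi> \<subseteq> set ys \<union> set zs"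
  define D where "D = {bs \<in> insts Meq xs. sat Meq (assign e xs bs) \<phi>}"
  \<comment> \<open>A level that contains the sorts of all element and parameter variables.
    Imaginaries of every arity can occur, so exchange is called for at every level; the 0 covers
    empty lists.\<close>
  define n where "n = Max (insert 0 ((\<lambda>v. arity (fst v)) ` (set xs \<union> set ys)))"
  have n: "univ Meq (fst v) \<subseteq> level L M n" if v: "v \<in> set xs \<union> set ys" for v
  proof -
    have "arity (fst v) \<le> n" unfolding n_def using v by (intro Max_ge) auto
    moreover have "univ Meq (fst v) \<subseteq> level L M (arity (fst v))" using d(2) v by (intro sort_in_level) auto
    ultimately show ?thesis using level_mono by blast
  qed
  obtain K where K: "\<And>bs. bs \<in> insts Meq xs \<Longrightarrow>
      finite (acl_level L M n (set bs)) \<and> card (acl_level L M n (set bs)) \<le> K"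
    using acl_level_bounded[of xs n] d(2) by auto
  have "\<not> thorn_ge Meq k xs ys zs \<Delta> \<Pi> D (Suc K)"
  proof
    assume "thorn_ge Meq k xs ys zs \<Delta> \<Pi> D (Suc K)"
    then obtain bs where bs: "bs \<in> D" "rk_ge L M n (set bs) {} (Suc K)"
      using thorn_ge_rk_ge[OF ex \<kappa> d \<Delta> \<Pi> n, of D k "Suc K" "{}"] by (auto simp: D_def)
    then have "Suc K \<le> card (acl_level L M n (set bs) - acl_level L M n {})"
      using K by (intro rk_ge_le_card) (auto simp: D_def)
    also have "\<dots> \<le> card (acl_level L M n (set bs))" using K bs(1) by (intro card_mono) (auto simp: D_def)
    also have "\<dots> \<le> K" using K bs(1) by (auto simp: D_def)
    finally show False by simp
  qed
  then show "\<exists>m. \<not> thorn_ge Meq k xs ys zs \<Delta> \<Pi> {b \<in> insts Meq xs. sat Meq (assign e xs b) \<phi>} m"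
    unfolding D_def by blast
qed

end

theorem theorem6p10:
  fixes L :: "('f, 'r, unit) lang"
    and T :: "('f, 'r, unit) fm set"
    and M :: "('f, 'r, unit, 'a) struct"
    and \<kappa> :: "'k rel"
  assumes "one_sorted L" and "countable_lang L"
    and "complete_theory L T" and "omega_categorical L T"
    and "Card_order \<kappa>" and "cinfinite \<kappa>"
    and "is_model L M T" and "saturated \<kappa> L M"
    and "\<And>n. exchange_property \<kappa> L M n"
  shows "rosy L M"
proof -
  interpret imaginaries L M
  proof
    show "sorts L = {()}" using assms(1) by (simp add: one_sorted_def)
    show "is_struct L M" using assms(7) by (simp add: is_model_def)
    show "finite {D. definable L M k D}" for k by (rule ryll_nardzewski[OF assms(1-8)])
  qed
  show ?thesis
    by (rule exchange_imp_rosy[OF assms(9)]) (rule finite_ordLess_cinfinite[OF assms(5,6)])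
qed

end
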